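(* Let $\Phi=\{\varphi_i\}_{i=1}^K$ be a homogeneous IFS on $\mathbb R^d$ with common contraction ratio $r\in(0,1)$ satisfying the strong separation condition, and let $\mu$ be the Gibbs measure on $\Sigma=\{1,\dots,K\}^{\mathbb N}$ of a Hölder continuous potential that is not cohomologous to a constant. For $\varepsilon>0$ let $\psi_\varepsilon^{\pm}:\mathbb N\to[0,\infty)$ be $$\psi_\varepsilon^{+}(n)=\frac{\log n}{h_\mu}+\frac{1+\varepsilon}{h_\mu^{3/2}}\sqrt{2\rho_\mu\log n\log\log\log n},\qquad \psi_\varepsilon^{-}(n)=\frac{\log n}{h_\mu}+\frac{1-\varepsilon}{h_\mu^{3/2}}\sqrt{2\rho_\mu\log n\log\log\log n}.$$ Then for every $\varepsilon>0$, $\pi^*\mu(\tilde R_{\psi_\varepsilon^+})=0$ and $\pi^*\mu(\tilde R_{\psi_\varepsilon^-})=1$.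
   Context: A contracting similarity is a map $\varphi:\mathbb R^d\to\mathbb R^d$ with $\|\varphi(x)-\varphi(y)\|=r\|x-y\|$, $r\in(0,1)$; a homogeneous IFS is a finite set $\{\varphi_i\}_{i=1}^K$ of such maps with common ratio $r$; its self-similar set is the unique nonempty compact $X$ with $X=\bigcup_i\varphi_i(X)$. The coding map is $\pi(\mathbf i)=\lim_n\varphi_{i_1}\circ\cdots\circ\varphi_{i_n}(0)$ and $\pi^*\mu=\mu\circ\pi^{-1}$. Strong separation condition: $\varphi_i(X)\cap\varphi_j(X)=\emptyset$ for $i\ne j$; then $T:X\to X$, $T(x)=\varphi_i^{-1}(x)$ for $x\in\varphi_i(X)$. For $\psi:\mathbb N\to[0,\infty)$, $\tilde R_\psi=\{x\in X:\|T^n(x)-x\|\le r^{\psi(n)}\text{ for infinitely many }n\}$. On $\Sigma$ with left shift $\sigma$ and $|\mathbf i\wedge\mathbf j|=\inf\{n\ge0:i_{n+1}\ne j_{n+1}\}$: $f:\Sigma\to\mathbb R$ is Hölder continuous if $|f(\mathbf i)-f(\mathbf j)|\le b\alpha^{|\mathbf i\wedge\mathbf j|}$ for some $b>0,0<\alpha<1$; $P(f)=\lim_n\frac1n\log\sum_{w\in\{1..K\}^n}\sup_{\mathbf j\in[w]}e^{\sum_{k=0}^{n-1}f(\sigma^k\mathbf j)}$; the Gibbs measure of $f$ is the unique $\sigma$-invariant ergodic probability $\mu$ with $C^{-1}\le\mu([i_1\dots i_n])/\exp(-nP(f)+\sum_{k=0}^{n-1}f(\sigma^k\mathbf i))\le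 C$ for some $C>1$ and all $\mathbf i,n$. $h_\mu=\lim_n-\frac1n\sum_{|w|=n}\mu([w])\log\mu([w])$, $\rho_\mu=\lim_n\frac1n\int(\sum_{k=0}^{n-1}f\circ\sigma^k-n\int fd\mu)^2d\mu$. Cohomologous to a constant: $f=g\circ\sigma-g+c$, $g$ continuous, $c$ constant. Convention: $\log x=0$ for $x\le1$. *)

theory Defs
  imports "HOL-Probability.Probability"
begin

text \<open>Symbolic space: sequences indexed from 0 (i.e. omega 0 is the first symbol i_1)
  with symbols in {1..K}.\<close>

definition Sigma_K :: "nat \<Rightarrow> (nat \<Rightarrow> nat) set" where
  "Sigma_K K = {\<omega>. \<forall>n. \<omega> n \<in> {1..K}}"

definition shift :: "(nat \<Rightarrow> nat) \<Rightarrow> (nat \<Rightarrow> nat)" where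
  "shift \<omega> = (\<lambda>n. \<omega> (Suc n))"

definition words :: "nat \<Rightarrow> nat \<Rightarrow> nat list set" where
  "words K n = {w. length w = n \<and> set w \<subseteq> {1..K}}"

definition cylinder :: "nat \<Rightarrow> nat list \<Rightarrow> (nat \<Rightarrow> nat) set" where
  "cylinder K w = {\<omega> \<in> Sigma_K K. \<forall>k<length w. \<omega> k = w ! k}"

definition birkhoff :: "((nat \<Rightarrow> nat) \<Rightarrow> real) \<Rightarrow> nat \<Rightarrow> (nat \<Rightarrow> nat) \<Rightarrow> real" where
  "birkhoff f n \<omega> = (\<Sum>k<n. f ((shift ^^ k) \<omega>))"

definition holder_continuous :: "nat \<Rightarrow> ((nat \<Rightarrow> nat) \<Rightarrow> real) \<Rightarrow> bool" where
  "holder_continuous K f \<longleftrightarrow> (\<exists>b>0. \<exists>\<alpha>. 0 < \<alpha> \<and> \<alpha> < 1 \<and>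
     (\<forall>\<omega>\<in>Sigma_K K. \<forall>\<eta>\<in>Sigma_K K. \<forall>n. (\<forall>k<n. \<omega> k = \<eta> k) \<longrightarrow> \<bar>f \<omega> - f \<eta>\<bar> \<le> b * \<alpha> ^ n))"

definition pressure :: "nat \<Rightarrow> ((nat \<Rightarrow> nat) \<Rightarrow> real) \<Rightarrow> real" where
  "pressure K f = lim (\<lambda>n. ln (\<Sum>w\<in>words K n. (SUP \<omega>\<in>cylinder K w. exp (birkhoff f n \<omega>))) / real n)"

definition cohomologous_to_constant :: "nat \<Rightarrow> ((nat \<Rightarrow> nat) \<Rightarrow> real) \<Rightarrow> bool" where
  "cohomologous_to_constant K f \<longleftrightarrow> (\<exists>g c. continuous_on (Sigma_K K) g \<and>
     (\<forall>\<omega>\<in>Sigma_K K. f \<omega> = g (shift \<omega>) - g \<omega> + c))"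

definition Sigma_space :: "nat \<Rightarrow> (nat \<Rightarrow> nat) measure" where
  "Sigma_space K = PiM UNIV (\<lambda>_. count_space {1..K})"

definition is_gibbs_measure :: "nat \<Rightarrow> ((nat \<Rightarrow> nat) \<Rightarrow> real) \<Rightarrow> (nat \<Rightarrow> nat) measure \<Rightarrow> bool" where
  "is_gibbs_measure K f \<mu> \<longleftrightarrow>
     prob_space \<mu> \<and> sets \<mu> = sets (Sigma_space K) \<and>
     shift \<in> measurable \<mu> \<mu> \<and>
     (\<forall>A\<in>sets \<mu>. measure \<mu> (shift -` A \<inter> space \<mu>) = measure \<mu> A) \<and>
     (\<forall>A\<in>sets \<mu>. shift -` A \<inter> space \<mu> = A \<longrightarrow> measure \<mu> A = 0 \<or> measure \<mu> A = 1) \<and>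
     (\<exists>C>1. \<forall>\<omega>\<in>Sigma_K K. \<forall>n.
        inverse C \<le> measure \<mu> (cylinder K (map \<omega> [0..<n])) / exp (- real n * pressure K f + birkhoff f n \<omega>)
      \<and> measure \<mu> (cylinder K (map \<omega> [0..<n])) / exp (- real n * pressure K f + birkhoff f n \<omega>) \<le> C)"

definition entropy :: "nat \<Rightarrow> (nat \<Rightarrow> nat) measure \<Rightarrow> real" where
  "entropy K \<mu> = lim (\<lambda>n. - (\<Sum>w\<in>words K n. measure \<mu> (cylinder K w) * ln (measure \<mu> (cylinder K w))) / real n)"

definition asymp_variance :: "((nat \<Rightarrow> nat) \<Rightarrow> real) \<Rightarrow> (nat \<Rightarrow> nat) measure \<Rightarrow> real" where
  "asymp_variance f \<mu> = lim (\<lambda>n. (\<integral>\<omega>. (birkhoff f n \<omega> - real n * (\<integral>\<eta>. f \<eta> \<partial>\<mu>))\<^sup>2 \<partial>\<mu>) / real n)"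

definition logc :: "real \<Rightarrow> real" where
  "logc x = (if x \<le> 1 then 0 else ln x)"

definition similarity :: "real \<Rightarrow> ('a::euclidean_space \<Rightarrow> 'a) \<Rightarrow> bool" where
  "similarity r \<phi> \<longleftrightarrow> (\<forall>x y. norm (\<phi> x - \<phi> y) = r * norm (x - y))"

definition homogeneous_IFS :: "nat \<Rightarrow> real \<Rightarrow> (nat \<Rightarrow> 'a::euclidean_space \<Rightarrow> 'a) \<Rightarrow> bool" where
  "homogeneous_IFS K r \<phi> \<longleftrightarrow> 0 < r \<and> r < 1 \<and> (\<forall>i\<in>{1..K}. similarity r (\<phi> i))"

definition self_similar_set :: "nat \<Rightarrow> (nat \<Rightarrow> 'a::euclidean_space \<Rightarrow> 'a) \<Rightarrow> 'a set \<Rightarrow> bool" where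
  "self_similar_set K \<phi> X \<longleftrightarrow> X \<noteq> {} \<and> compact X \<and> X = (\<Union>i\<in>{1..K}. \<phi> i ` X)"

definition strong_separation :: "nat \<Rightarrow> (nat \<Rightarrow> 'a \<Rightarrow> 'a) \<Rightarrow> 'a set \<Rightarrow> bool" where
  "strong_separation K \<phi> X \<longleftrightarrow> (\<forall>i\<in>{1..K}. \<forall>j\<in>{1..K}. i \<noteq> j \<longrightarrow> \<phi> i ` X \<inter> \<phi> j ` X = {})"

definition expanding_map :: "nat \<Rightarrow> (nat \<Rightarrow> 'a \<Rightarrow> 'a) \<Rightarrow> 'a set \<Rightarrow> 'a \<Rightarrow> 'a" where
  "expanding_map K \<phi> X x = (THE y. y \<in> X \<and> (\<exists>i\<in>{1..K}. x = \<phi> i y))"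

definition compose_word :: "(nat \<Rightarrow> 'a \<Rightarrow> 'a) \<Rightarrow> nat \<Rightarrow> (nat \<Rightarrow> nat) \<Rightarrow> 'a \<Rightarrow> 'a" where
  "compose_word \<phi> n \<omega> = foldr (\<lambda>k g. \<phi> (\<omega> k) \<circ> g) [0..<n] id"

definition coding_map :: "(nat \<Rightarrow> 'a::euclidean_space \<Rightarrow> 'a) \<Rightarrow> (nat \<Rightarrow> nat) \<Rightarrow> 'a" where
  "coding_map \<phi> \<omega> = lim (\<lambda>n. compose_word \<phi> n \<omega> 0)"

definition recurrence_set :: "nat \<Rightarrow> real \<Rightarrow> (nat \<Rightarrow> 'a::euclidean_space \<Rightarrow> 'a) \<Rightarrow> 'a set \<Rightarrow> (nat \<Rightarrow> real) \<Rightarrow> 'a set" where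
  "recurrence_set K r \<phi> X \<psi> = {x \<in> X. \<exists>\<^sub>\<infinity>n. norm ((expanding_map K \<phi> X ^^ n) x - x) \<le> r powr \<psi> n}"

definition psi_plus :: "real \<Rightarrow> real \<Rightarrow> real \<Rightarrow> nat \<Rightarrow> real" where
  "psi_plus h \<rho> \<epsilon> n = logc (real n) / h
     + (1 + \<epsilon>) / h powr (3/2) * sqrt (2 * \<rho> * logc (real n) * logc (logc (logc (real n))))"

definition psi_minus :: "real \<Rightarrow> real \<Rightarrow> real \<Rightarrow> nat \<Rightarrow> real" where
  "psi_minus h \<rho> \<epsilon> n = logc (real n) / h
     + (1 - \<epsilon>) / h powr (3/2) * sqrt (2 * \<rho> * logc (real n) * logc (logc (logc (real n))))"

end

theory Submission
  imports Defs "HOL-Real_Asymp.Real_Asymp"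
begin

text \<open>
  The quantity \<open>- ln \<mu>[\<omega>\<^sub>1 \<dots> \<omega>\<^sub>k]\<close> equals \<open>k h\<close> minus the centred Birkhoff sum of the potential, up to
  a bounded error. Cone contraction of the transfer operator normalizes the potential and solves
  the Poisson equation, so the centred potential is a reverse martingale difference \<open>m\<close> plus a
  coboundary; the asymptotic variance is \<open>\<integral> m\<^sup>2 d\<mu>\<close>, which vanishes only for potentials cohomologous
  to a constant. A second Poisson equation, for \<open>m\<^sup>2\<close>, gives the Gaussian exponential moments of the
  Birkhoff sums conditionally on the future, and these yield the law of the iterated logarithm for
  the measures of cylinders.

  A point returns to its own cylinder of length \<open>k\<close> for the first time at about the inverse of the
  measure of that cylinder. By the quasi-Bernoulli property the probability of a return at time \<open>n\<close>
  is at most a multiple of this measure, so below the upper envelope of the fluctuations returns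
  occur finitely often (Borel--Cantelli); along the sequence of large fluctuations the returns at
  times \<open>k, 2k, \<dots>\<close> fail with summable probability. Strong separation translates agreement
  of symbols into distance in the attractor.
\<close>

text \<open>Keeps the base point \<open>\<lambda>_. 1\<close> in a single normal form.\<close>
declare One_nat_def [simp del]

section \<open>Transfer operators on the shift\<close>

text \<open>The form of \<open>psi_plus\<close> and \<open>psi_minus\<close> comes from inverting
  one relation. A cylinder of length k has mass exp (X - k h), where X is the centred sum, so a
  return takes about exp (k h - X) steps. As X reaches about sqrt (2 \<rho> k ln ln k) infinitely
  often, heavy cylinders decide, and solving k h - sqrt (2 \<rho> k ln ln k) = ln n for k yields ln
  n / h plus a correction whose factor \<open>h powr (3/2)\<close> combines sqrt h from k = ln n / h
  with the division by h. The obstacle is that \<mu> is known only through two-sided bounds on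
  cylinders and not as an eigenmeasure of a dual operator. The bounds keep the iterates of the
  operator with weight exp (f - P) on the constant 1 between 1/C and C, which is enough for an
  eigenfunction; that \<mu>-integrals are invariant under the normalized operator is recovered later
  from a variance estimate. The operator sums out the first symbol, so its estimates hold uniformly
  in the future of a block. Where a classical proof would use independence forward in time (maximal
  inequality, repeated returns), the two-sided quasi-Bernoulli bounds take its place.\<close>

definition agree :: "nat \<Rightarrow> (nat \<Rightarrow> nat) \<Rightarrow> (nat \<Rightarrow> nat) \<Rightarrow> bool" where
  "agree n \<omega> \<eta> \<longleftrightarrow> (\<forall>k<n. \<omega> k = \<eta> k)"

lemma agree_0 [simp]: "agree 0 \<omega> \<eta>"
  by (simp add: agree_def)

lemma agree_refl [simp]: "agree n \<omega> \<omega>"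
  by (simp add: agree_def)

lemma agree_sym: "agree n \<omega> \<eta> \<Longrightarrow> agree n \<eta> \<omega>"
  by (simp add: agree_def)

lemma agree_Suc_iff: "agree (Suc n) \<omega> \<eta> \<longleftrightarrow> \<omega> 0 = \<eta> 0 \<and> agree n (shift \<omega>) (shift \<eta>)"
  unfolding agree_def shift_def by (auto simp: less_Suc_eq_0_disj)

lemma agree_case_nat [simp]: "agree (Suc n) (case_nat i \<omega>) (case_nat i \<eta>) \<longleftrightarrow> agree n \<omega> \<eta>"
  unfolding agree_Suc_iff by (simp add: shift_def)

lemma shift_case_nat [simp]: "shift (case_nat i \<omega>) = \<omega>"
  by (simp add: shift_def)

lemma shift_funpow: "(shift ^^ n) \<omega> = (\<lambda>k. \<omega> (n + k))"
  by (induction n) (simp_all add: shift_def)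

lemma agree_shift: "agree n \<omega> \<eta> \<Longrightarrow> agree (n - 1) (shift \<omega>) (shift \<eta>)"
  by (auto simp: agree_def shift_def)

lemma Sigma_K_case_nat [simp]: "case_nat i \<omega> \<in> Sigma_K K \<longleftrightarrow> i \<in> {1..K} \<and> \<omega> \<in> Sigma_K K"
proof
  assume "case_nat i \<omega> \<in> Sigma_K K"
  then have "case_nat i \<omega> n \<in> {1..K}" for n by (simp add: Sigma_K_def)
  from this[of 0] this[of "Suc _"] show "i \<in> {1..K} \<and> \<omega> \<in> Sigma_K K" by (simp add: Sigma_K_def)
qed (auto simp: Sigma_K_def split: nat.split)

lemma Sigma_K_shift: "\<omega> \<in> Sigma_K K \<Longrightarrow> shift \<omega> \<in> Sigma_K K"
  by (auto simp: Sigma_K_def shift_def)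

lemma Sigma_K_shift_funpow: "\<omega> \<in> Sigma_K K \<Longrightarrow> (shift ^^ n) \<omega> \<in> Sigma_K K"
  by (auto simp: Sigma_K_def shift_funpow)

text \<open>The Ruelle operator with an arbitrary weight q. With q = exp (f - P) its iterates sum
  Gibbs weights over words; with a weight of total mass 1 it plays the role of a conditional
  expectation given the shifted sequence.\<close>

definition transfer :: "nat \<Rightarrow> ((nat \<Rightarrow> nat) \<Rightarrow> real) \<Rightarrow> ((nat \<Rightarrow> nat) \<Rightarrow> real) \<Rightarrow> (nat \<Rightarrow> nat) \<Rightarrow> real" where
  "transfer K q \<phi> \<omega> = (\<Sum>i\<in>{1..K}. q (case_nat i \<omega>) * \<phi> (case_nat i \<omega>))"

lemma transfer_add: "transfer K q (\<lambda>\<omega>. \<phi> \<omega> + \<psi> \<omega>) = (\<lambda>\<omega>. transfer K q \<phi> \<omega> + transfer K q \<psi> \<omega>)"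
  by (simp add: transfer_def fun_eq_iff sum.distrib ring_distribs)

lemma transfer_diff: "transfer K q (\<lambda>\<omega>. \<phi> \<omega> - \<psi> \<omega>) = (\<lambda>\<omega>. transfer K q \<phi> \<omega> - transfer K q \<psi> \<omega>)"
  by (simp add: transfer_def fun_eq_iff sum_subtractf ring_distribs)

lemma transfer_cmult: "transfer K q (\<lambda>\<omega>. c * \<phi> \<omega>) = (\<lambda>\<omega>. c * transfer K q \<phi> \<omega>)"
  by (simp add: transfer_def fun_eq_iff sum_distrib_left algebra_simps)

lemma transfer_mult_shift: "transfer K q (\<lambda>\<omega>. \<phi> \<omega> * \<psi> (shift \<omega>)) = (\<lambda>\<omega>. transfer K q \<phi> \<omega> * \<psi> \<omega>)"
  by (simp add: transfer_def fun_eq_iff sum_distrib_right mult.assoc)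

lemma transfer_funpow_add:
  "(transfer K q ^^ n) (\<lambda>\<omega>. \<phi> \<omega> + \<psi> \<omega>) = (\<lambda>\<omega>. (transfer K q ^^ n) \<phi> \<omega> + (transfer K q ^^ n) \<psi> \<omega>)"
  by (induction n) (simp_all add: transfer_add)

lemma transfer_funpow_diff:
  "(transfer K q ^^ n) (\<lambda>\<omega>. \<phi> \<omega> - \<psi> \<omega>) = (\<lambda>\<omega>. (transfer K q ^^ n) \<phi> \<omega> - (transfer K q ^^ n) \<psi> \<omega>)"
  by (induction n) (simp_all add: transfer_diff)

lemma transfer_funpow_cmult:
  "(transfer K q ^^ n) (\<lambda>\<omega>. c * \<phi> \<omega>) = (\<lambda>\<omega>. c * (transfer K q ^^ n) \<phi> \<omega>)"
  by (induction n) (simp_all add: transfer_cmult)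

text \<open>Pull-out rule of conditional expectations: a factor that reads only the symbols from
  position n on does not see the n symbols being summed out. Conditioning on the future is expressed
  in this way.\<close>

lemma transfer_funpow_mult_shift:
  "(transfer K q ^^ n) (\<lambda>\<omega>. \<phi> \<omega> * \<psi> ((shift ^^ n) \<omega>)) = (\<lambda>\<omega>. (transfer K q ^^ n) \<phi> \<omega> * \<psi> \<omega>)"
proof (induction n arbitrary: \<phi>)
  case (Suc n)
  have "(transfer K q ^^ Suc n) (\<lambda>\<omega>. \<phi> \<omega> * \<psi> ((shift ^^ Suc n) \<omega>))
      = (transfer K q ^^ n) (transfer K q (\<lambda>\<omega>. \<phi> \<omega> * (\<psi> \<circ> (shift ^^ n)) (shift \<omega>)))"
    by (simp add: funpow_swap1 o_def del: funpow.simps add: funpow_Suc_right)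
  also have "\<dots> = (\<lambda>\<omega>. (transfer K q ^^ Suc n) \<phi> \<omega> * \<psi> \<omega>)"
    unfolding transfer_mult_shift using Suc[of "transfer K q \<phi>"]
    by (simp add: o_def funpow_Suc_right del: funpow.simps)
  finally show ?case .
qed simp

lemma transfer_mono:
  assumes "\<And>\<omega>. \<omega> \<in> Sigma_K K \<Longrightarrow> 0 \<le> q \<omega>" "\<And>\<omega>. \<omega> \<in> Sigma_K K \<Longrightarrow> \<phi> \<omega> \<le> \<psi> \<omega>" "\<omega> \<in> Sigma_K K"
  shows "transfer K q \<phi> \<omega> \<le> transfer K q \<psi> \<omega>"
  unfolding transfer_def using assms by (intro sum_mono mult_left_mono) auto

lemma transfer_funpow_mono:
  assumes "\<And>\<omega>. \<omega> \<in> Sigma_K K \<Longrightarrow> 0 \<le> q \<omega>" "\<And>\<omega>. \<omega> \<in> Sigma_K K \<Longrightarrow> \<phi> \<omega> \<le> \<psi> \<omega>" "\<omega> \<in> Sigma_K K"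
  shows "(transfer K q ^^ n) \<phi> \<omega> \<le> (transfer K q ^^ n) \<psi> \<omega>"
  using assms(3)
proof (induction n arbitrary: \<omega>)
  case (Suc n) then show ?case by (auto intro!: transfer_mono assms(1))
qed (simp add: assms)

lemma transfer_cong:
  assumes "\<And>\<omega>. \<omega> \<in> Sigma_K K \<Longrightarrow> \<phi> \<omega> = \<psi> \<omega>" "\<omega> \<in> Sigma_K K"
  shows "transfer K q \<phi> \<omega> = transfer K q \<psi> \<omega>"
  unfolding transfer_def using assms by (intro sum.cong) auto

lemma transfer_tendsto:
  assumes "\<And>\<omega>. \<omega> \<in> Sigma_K K \<Longrightarrow> (\<lambda>n. \<phi> n \<omega>) \<longlonglongrightarrow> \<psi> \<omega>" "\<omega> \<in> Sigma_K K"
  shows "(\<lambda>n. transfer K q (\<phi> n) \<omega>) \<longlonglongrightarrow> transfer K q \<psi> \<omega>"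
  unfolding transfer_def using assms by (intro tendsto_sum tendsto_mult_left) auto

section \<open>Cones of log-Hoelder functions and the space of Hoelder functions\<close>

locale symbolic =
  fixes K :: nat and \<alpha> :: real
  assumes K_pos: "1 \<le> K" and alpha: "0 < \<alpha>" "\<alpha> < 1"
begin

abbreviation S where "S \<equiv> Sigma_K K"

text \<open>The exponent \<alpha> is fixed by the locale and only the constant varies, so that sums,
  products, shifts and transfer operators stay in one space.\<close>

definition hoelder_with :: "real \<Rightarrow> ((nat \<Rightarrow> nat) \<Rightarrow> real) \<Rightarrow> bool" where
  "hoelder_with B \<phi> \<longleftrightarrow> 0 \<le> B \<and> (\<forall>\<omega>\<in>S. \<forall>\<eta>\<in>S. \<forall>n. agree n \<omega> \<eta> \<longrightarrow> \<bar>\<phi> \<omega> - \<phi> \<eta>\<bar> \<le> B * \<alpha> ^ n)"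

definition hoelder :: "((nat \<Rightarrow> nat) \<Rightarrow> real) \<Rightarrow> bool" where
  "hoelder \<phi> \<longleftrightarrow> (\<exists>B. hoelder_with B \<phi>)"

text \<open>The Birkhoff cone of functions whose logarithm is Hoelder with constant D. The
  multiplicative form admits the zero function and is preserved by pointwise limits; n = 0 bounds
  the ratio of any two values by exp D.\<close>

definition cone :: "real \<Rightarrow> ((nat \<Rightarrow> nat) \<Rightarrow> real) \<Rightarrow> bool" where
  "cone D \<phi> \<longleftrightarrow> (\<forall>\<omega>\<in>S. 0 \<le> \<phi> \<omega>) \<and>
     (\<forall>\<omega>\<in>S. \<forall>\<eta>\<in>S. \<forall>n. agree n \<omega> \<eta> \<longrightarrow> \<phi> \<omega> \<le> exp (D * \<alpha> ^ n) * \<phi> \<eta>)"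

lemma alpha_power: "0 < \<alpha> ^ n" "0 \<le> \<alpha> ^ n" "\<alpha> ^ n \<le> 1"
  using alpha by (auto intro: power_le_one)

lemma base_point: "(\<lambda>_. 1) \<in> S"
  using K_pos by (auto simp: Sigma_K_def)

lemma coneD:
  "cone D \<phi> \<Longrightarrow> \<omega> \<in> S \<Longrightarrow> 0 \<le> \<phi> \<omega>"
  "cone D \<phi> \<Longrightarrow> \<omega> \<in> S \<Longrightarrow> \<eta> \<in> S \<Longrightarrow> agree n \<omega> \<eta> \<Longrightarrow> \<phi> \<omega> \<le> exp (D * \<alpha> ^ n) * \<phi> \<eta>"
  by (auto simp: cone_def)

lemma cone_ratio: "cone D \<phi> \<Longrightarrow> \<omega> \<in> S \<Longrightarrow> \<eta> \<in> S \<Longrightarrow> \<phi> \<omega> \<le> exp D * \<phi> \<eta>"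
  using coneD(2)[of D \<phi> \<omega> \<eta> 0] by simp

lemma coneI:
  "(\<And>\<omega>. \<omega> \<in> S \<Longrightarrow> 0 \<le> \<phi> \<omega>) \<Longrightarrow>
   (\<And>\<omega> \<eta> n. \<omega> \<in> S \<Longrightarrow> \<eta> \<in> S \<Longrightarrow> agree n \<omega> \<eta> \<Longrightarrow> \<phi> \<omega> \<le> exp (D * \<alpha> ^ n) * \<phi> \<eta>) \<Longrightarrow> cone D \<phi>"
  by (auto simp: cone_def)

lemma cone_mono:
  assumes "cone D \<phi>" "D \<le> E" shows "cone E \<phi>"
proof (rule coneI)
  fix \<omega> \<eta> n assume H: "\<omega> \<in> S" "\<eta> \<in> S" "agree n \<omega> \<eta>"
  have "\<phi> \<omega> \<le> exp (D * \<alpha> ^ n) * \<phi> \<eta>" using coneD(2)[OF assms(1) H] .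
  also have "\<dots> \<le> exp (E * \<alpha> ^ n) * \<phi> \<eta>"
    using assms alpha_power coneD(1)[OF assms(1) H(2)] by (intro mult_right_mono) (auto intro!: mult_right_mono)
  finally show "\<phi> \<omega> \<le> exp (E * \<alpha> ^ n) * \<phi> \<eta>" .
qed (use assms coneD in auto)

lemma cone_mult:
  assumes "cone D \<phi>" "cone E \<psi>" shows "cone (D + E) (\<lambda>\<omega>. \<phi> \<omega> * \<psi> \<omega>)"
proof (rule coneI)
  fix \<omega> \<eta> n assume H: "\<omega> \<in> S" "\<eta> \<in> S" "agree n \<omega> \<eta>"
  have "\<phi> \<omega> * \<psi> \<omega> \<le> (exp (D * \<alpha> ^ n) * \<phi> \<eta>) * (exp (E * \<alpha> ^ n) * \<psi> \<eta>)"
    using coneD(2)[OF assms(1) H] coneD(2)[OF assms(2) H] coneD(1)[OF assms(1) H(2)] coneD(1)[OF assms(2) H(1)]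
    by (intro mult_mono) auto
  then show "\<phi> \<omega> * \<psi> \<omega> \<le> exp ((D + E) * \<alpha> ^ n) * (\<phi> \<eta> * \<psi> \<eta>)"
    by (simp add: ring_distribs exp_add mult_ac)
qed (use assms coneD in auto)

text \<open>Putting the same symbol in front of two sequences lengthens their agreement by one, so
  the aperture b + D of the summands shrinks by the factor \<alpha>.\<close>

lemma cone_transfer:
  assumes "cone b q" "cone D \<phi>"
  shows "cone ((b + D) * \<alpha>) (transfer K q \<phi>)"
proof (rule coneI)
  fix \<omega> \<eta> n assume H: "\<omega> \<in> S" "\<eta> \<in> S" "agree n \<omega> \<eta>"
  note c = cone_mult[OF assms]
  have "transfer K q \<phi> \<omega> \<le> (\<Sum>i\<in>{1..K}. exp ((b + D) * \<alpha> ^ Suc n) * (q (case_nat i \<eta>) * \<phi> (case_nat i \<eta>)))"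
    unfolding transfer_def using H by (intro sum_mono coneD(2)[OF c]) auto
  then show "transfer K q \<phi> \<omega> \<le> exp ((b + D) * \<alpha> * \<alpha> ^ n) * transfer K q \<phi> \<eta>"
    by (simp add: transfer_def sum_distrib_left mult_ac)
next
  fix \<omega> assume H: "\<omega> \<in> S"
  then show "0 \<le> transfer K q \<phi> \<omega>"
    unfolding transfer_def by (intro sum_nonneg mult_nonneg_nonneg coneD(1)[OF assms(1)] coneD(1)[OF assms(2)]) auto
qed

lemma cone_limit:
  assumes "\<And>n. cone D (\<phi> n)" "\<And>\<omega>. \<omega> \<in> S \<Longrightarrow> (\<lambda>n. \<phi> n \<omega>) \<longlonglongrightarrow> \<psi> \<omega>"
  shows "cone D \<psi>"
proof (rule coneI)
  fix \<omega> assume H: "\<omega> \<in> S"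
  show "0 \<le> \<psi> \<omega>" by (rule LIMSEQ_le_const[OF assms(2)[OF H]]) (use coneD(1)[OF assms(1) H] in auto)
next
  fix \<omega> \<eta> n assume H: "\<omega> \<in> S" "\<eta> \<in> S" "agree n \<omega> \<eta>"
  show "\<psi> \<omega> \<le> exp (D * \<alpha> ^ n) * \<psi> \<eta>"
    by (rule LIMSEQ_le[OF assms(2)[OF H(1)] tendsto_mult_left[OF assms(2)[OF H(2)]]])
      (use coneD(2)[OF assms(1) H] in auto)
qed

text \<open>The limit superior of the iterates is a subsolution \<open>h0 \<le> L h0\<close>, and its
  increasing iterates converge to a fixed point.\<close>
lemma transfer_fixed_point:
  assumes q: "cone b q" "0 \<le> b" and A: "0 < A"
    "\<And>n \<omega>. \<omega> \<in> S \<Longrightarrow> 1 / A \<le> (transfer K q ^^ n) (\<lambda>_. 1) \<omega>"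
    "\<And>n \<omega>. \<omega> \<in> S \<Longrightarrow> (transfer K q ^^ n) (\<lambda>_. 1) \<omega> \<le> A"
  obtains h D where "cone D h" "0 \<le> D" "\<And>\<omega>. \<omega> \<in> S \<Longrightarrow> 1 / A \<le> h \<omega>"
    "\<And>\<omega>. \<omega> \<in> S \<Longrightarrow> transfer K q h \<omega> = h \<omega>"
proof -
  define L where "L = transfer K q"
  \<comment> \<open>D solves (b + D) * \<alpha> = D, which makes the cone of aperture D invariant
    under the operator.\<close>
  define D where "D = b * \<alpha> / (1 - \<alpha>)"
  have D: "(b + D) * \<alpha> = D" "0 \<le> D" using alpha q(2) by (auto simp: D_def field_simps)
  have q0: "\<And>\<omega>. \<omega> \<in> S \<Longrightarrow> 0 \<le> q \<omega>" using coneD(1)[OF q(1)] .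
  have Lc: "cone D (L \<phi>)" if "cone D \<phi>" for \<phi> using cone_transfer[OF q(1) that] D by (simp add: L_def)
  have c1: "cone D (\<lambda>_. 1)" using D alpha_power by (auto intro!: coneI)
  have cn: "cone D ((L ^^ n) \<phi>)" if "cone D \<phi>" for n \<phi> using that by (induction n) (auto simp: Lc)
  define e where "e n = (L ^^ n) (\<lambda>_. 1)" for n
  have e: "1 / A \<le> e n \<omega>" "e n \<omega> \<le> A" if "\<omega> \<in> S" for n \<omega>
    using A that by (auto simp: e_def L_def)
  \<comment> \<open>Convergence of \<open>e n\<close> is not known here, hence suprema over tails:
    they decrease in n and inherit the cone condition and the bounds 1/A and A.\<close>
  define s where "s n \<omega> = (SUP k\<in>{n..}. e k \<omega>)" for n \<omega>
  have bdd: "bdd_above ((\<lambda>k. e k \<omega>) ` {n..})" if "\<omega> \<in> S" for n \<omega>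
    using e(2)[OF that] by (auto intro!: bdd_aboveI)
  have sup: "e k \<omega> \<le> s n \<omega>" if "\<omega> \<in> S" "n \<le> k" for n k \<omega>
    unfolding s_def using that bdd by (intro cSUP_upper) auto
  have sA: "s n \<omega> \<le> A" if "\<omega> \<in> S" for n \<omega>
    unfolding s_def using that e by (intro cSUP_least) auto
  have sA': "1 / A \<le> s n \<omega>" if "\<omega> \<in> S" for n \<omega>
    using e(1)[OF that, of n] sup[OF that, of n n] by simp
  have sdec: "decseq (\<lambda>n. s n \<omega>)" if "\<omega> \<in> S" for \<omega>
  proof (rule decseq_SucI)
    fix n show "s (Suc n) \<omega> \<le> s n \<omega>"
      unfolding s_def using bdd[OF that] by (intro cSUP_subset_mono) auto
  qed
  have cs: "cone D (s n)" for n
  proof (rule coneI)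
    fix \<omega> assume "\<omega> \<in> S" then show "0 \<le> s n \<omega>"
      using sA'[of \<omega> n] A(1) by (meson divide_pos_pos order.trans less_imp_le zero_less_one)
  next
    fix \<omega> \<eta> k assume H: "\<omega> \<in> S" "\<eta> \<in> S" "agree k \<omega> \<eta>"
    have "e j \<omega> \<le> exp (D * \<alpha> ^ k) * s n \<eta>" if "n \<le> j" for j
    proof -
      have "e j \<omega> \<le> exp (D * \<alpha> ^ k) * e j \<eta>" unfolding e_def by (rule coneD(2)[OF cn[OF c1] H])
      also have "\<dots> \<le> exp (D * \<alpha> ^ k) * s n \<eta>" using sup[OF H(2) that] by simp
      finally show ?thesis .
    qed
    then show "s n \<omega> \<le> exp (D * \<alpha> ^ k) * s n \<eta>" unfolding s_def[of n \<omega>] by (intro cSUP_least) auto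
  qed
  \<comment> \<open>Each \<open>e (Suc j)\<close> is the image of \<open>e j\<close>, and the
    operator is monotone; the supremum of images lies below the image of the supremum. In the limit
    this gives a subsolution.\<close>
  have Ls: "s (Suc n) \<omega> \<le> L (s n) \<omega>" if "\<omega> \<in> S" for n \<omega>
    unfolding s_def[of "Suc n"]
  proof (rule cSUP_least)
    fix k assume "k \<in> {Suc n..}"
    then obtain j where j: "k = Suc j" "n \<le> j" by (cases k) auto
    show "e k \<omega> \<le> L (s n) \<omega>" unfolding j e_def L_def
      using that sup[OF _ j(2)] q0 by (auto intro!: transfer_mono simp: e_def L_def)
  qed simp
  have "\<exists>l. (\<lambda>n. s n \<omega>) \<longlonglongrightarrow> l" if "\<omega> \<in> S" for \<omega>
    using decseq_convergent[OF sdec[OF that], of "1 / A"] sA'[OF that] by metis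
  then obtain h0 where h0: "\<And>\<omega>. \<omega> \<in> S \<Longrightarrow> (\<lambda>n. s n \<omega>) \<longlonglongrightarrow> h0 \<omega>" by metis
  have ch0: "cone D h0" by (rule cone_limit[OF cs h0])
  have h0A: "1 / A \<le> h0 \<omega>" "h0 \<omega> \<le> A" if "\<omega> \<in> S" for \<omega>
    using LIMSEQ_le_const[OF h0[OF that]] LIMSEQ_le_const2[OF h0[OF that]] sA[OF that] sA'[OF that] by blast+
  have Lh0: "h0 \<omega> \<le> L h0 \<omega>" if "\<omega> \<in> S" for \<omega>
  proof (rule LIMSEQ_le)
    show "(\<lambda>n. s (Suc n) \<omega>) \<longlonglongrightarrow> h0 \<omega>" using h0[OF that] by (rule LIMSEQ_Suc)
    show "(\<lambda>n. L (s n) \<omega>) \<longlonglongrightarrow> L h0 \<omega>" unfolding L_def by (rule transfer_tendsto[OF h0 that])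
  qed (use Ls that in auto)
  have inc: "(L ^^ n) h0 \<omega> \<le> (L ^^ Suc n) h0 \<omega>" if "\<omega> \<in> S" for n \<omega>
  proof -
    have "(L ^^ n) h0 \<omega> \<le> (L ^^ n) (L h0) \<omega>" unfolding L_def
      using that q0 Lh0 by (intro transfer_funpow_mono) (auto simp: L_def)
    then show ?thesis by (simp add: funpow_swap1)
  qed
  have bd: "(L ^^ n) h0 \<omega> \<le> A * A" if "\<omega> \<in> S" for n \<omega>
  proof -
    have "(L ^^ n) h0 \<omega> \<le> (L ^^ n) (\<lambda>\<omega>. A * 1) \<omega>" unfolding L_def
      using that q0 h0A by (intro transfer_funpow_mono) auto
    also have "\<dots> = A * e n \<omega>" unfolding L_def e_def by (rule fun_cong[OF transfer_funpow_cmult])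
    also have "\<dots> \<le> A * A" using e[OF that] A by simp
    finally show ?thesis .
  qed
  have "\<exists>l. (\<lambda>n. (L ^^ n) h0 \<omega>) \<longlonglongrightarrow> l" if "\<omega> \<in> S" for \<omega>
    using incseq_convergent[of "\<lambda>n. (L ^^ n) h0 \<omega>"] incseq_SucI[of "\<lambda>n. (L ^^ n) h0 \<omega>"] inc[OF that] bd[OF that] by metis
  then obtain h where h: "\<And>\<omega>. \<omega> \<in> S \<Longrightarrow> (\<lambda>n. (L ^^ n) h0 \<omega>) \<longlonglongrightarrow> h \<omega>" by metis
  have ch: "cone D h" by (rule cone_limit[OF cn[OF ch0] h])
  have hA: "1 / A \<le> h \<omega>" if "\<omega> \<in> S" for \<omega>
  proof -
    have "h0 \<omega> \<le> (L ^^ n) h0 \<omega>" for n using inc[OF that] by (induction n) (auto intro: order_trans)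
    then have "h0 \<omega> \<le> h \<omega>" using LIMSEQ_le_const[OF h[OF that]] by blast
    then show ?thesis using h0A[OF that] by simp
  qed
  have Lh: "L h \<omega> = h \<omega>" if "\<omega> \<in> S" for \<omega>
  proof (rule LIMSEQ_unique)
    show "(\<lambda>n. L ((L ^^ n) h0) \<omega>) \<longlonglongrightarrow> L h \<omega>" unfolding L_def
      by (rule transfer_tendsto[OF h[unfolded L_def] that])
    show "(\<lambda>n. L ((L ^^ n) h0) \<omega>) \<longlonglongrightarrow> h \<omega>" using LIMSEQ_Suc[OF h[OF that]] by simp
  qed
  show ?thesis by (rule that[OF ch D(2) hA]) (use Lh in \<open>auto simp: L_def\<close>)
qed

lemma hoelderI:
  "0 \<le> B \<Longrightarrow> (\<And>\<omega> \<eta> n. \<omega> \<in> S \<Longrightarrow> \<eta> \<in> S \<Longrightarrow> agree n \<omega> \<eta> \<Longrightarrow> \<bar>\<phi> \<omega> - \<phi> \<eta>\<bar> \<le> B * \<alpha> ^ n) \<Longrightarrow> hoelder \<phi>"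
  unfolding hoelder_def hoelder_with_def by blast

lemma hoelder_withD:
  "hoelder_with B \<phi> \<Longrightarrow> 0 \<le> B"
  "hoelder_with B \<phi> \<Longrightarrow> \<omega> \<in> S \<Longrightarrow> \<eta> \<in> S \<Longrightarrow> agree n \<omega> \<eta> \<Longrightarrow> \<bar>\<phi> \<omega> - \<phi> \<eta>\<bar> \<le> B * \<alpha> ^ n"
  by (auto simp: hoelder_with_def)

lemma hoelder_bounded:
  assumes "hoelder \<phi>"
  obtains B where "0 < B" "\<And>\<omega>. \<omega> \<in> S \<Longrightarrow> \<bar>\<phi> \<omega>\<bar> \<le> B"
proof -
  obtain B where "hoelder_with B \<phi>" using assms unfolding hoelder_def by blast
  note B = hoelder_withD[OF this]
  have "\<bar>\<phi> \<omega>\<bar> \<le> B + \<bar>\<phi> (\<lambda>_. 1)\<bar> + 1" if "\<omega> \<in> S" for \<omega>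
    using B(2)[OF that base_point, of 0] by simp
  then show ?thesis using B(1) by (intro that[of "B + \<bar>\<phi> (\<lambda>_. 1)\<bar> + 1"]) auto
qed

lemma hoelder_const [intro, simp]: "hoelder (\<lambda>_. c)"
  by (rule hoelderI[of 0]) auto

lemma hoelder_add [intro]:
  assumes "hoelder \<phi>" "hoelder \<psi>" shows "hoelder (\<lambda>\<omega>. \<phi> \<omega> + \<psi> \<omega>)"
proof -
  obtain B where "hoelder_with B \<phi>" using assms(1) unfolding hoelder_def by blast
  note B = hoelder_withD[OF this]
  obtain C where "hoelder_with C \<psi>" using assms(2) unfolding hoelder_def by blast
  note C = hoelder_withD[OF this]
  show ?thesis using B(1) C(1)
  proof (intro hoelderI[of "B + C"])
    fix \<omega> \<eta> n assume H: "\<omega> \<in> S" "\<eta> \<in> S" "agree n \<omega> \<eta>"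
    show "\<bar>\<phi> \<omega> + \<psi> \<omega> - (\<phi> \<eta> + \<psi> \<eta>)\<bar> \<le> (B + C) * \<alpha> ^ n"
      unfolding ring_distribs using B(2)[OF H] C(2)[OF H] by linarith
  qed auto
qed

lemma hoelder_mult [intro]:
  assumes "hoelder \<phi>" "hoelder \<psi>" shows "hoelder (\<lambda>\<omega>. \<phi> \<omega> * \<psi> \<omega>)"
proof -
  obtain B where "hoelder_with B \<phi>" using assms(1) unfolding hoelder_def by blast
  note B = hoelder_withD[OF this]
  obtain C where "hoelder_with C \<psi>" using assms(2) unfolding hoelder_def by blast
  note C = hoelder_withD[OF this]
  obtain U where U: "0 < U" "\<And>\<omega>. \<omega> \<in> S \<Longrightarrow> \<bar>\<phi> \<omega>\<bar> \<le> U" by (rule hoelder_bounded[OF assms(1)]) blast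
  obtain V where V: "0 < V" "\<And>\<omega>. \<omega> \<in> S \<Longrightarrow> \<bar>\<psi> \<omega>\<bar> \<le> V" by (rule hoelder_bounded[OF assms(2)]) blast
  show ?thesis
  proof (rule hoelderI[of "B * V + U * C"])
    fix \<omega> \<eta> n assume H: "\<omega> \<in> S" "\<eta> \<in> S" "agree n \<omega> \<eta>"
    have "\<phi> \<omega> * \<psi> \<omega> - \<phi> \<eta> * \<psi> \<eta> = (\<phi> \<omega> - \<phi> \<eta>) * \<psi> \<omega> + \<phi> \<eta> * (\<psi> \<omega> - \<psi> \<eta>)" by (simp add: algebra_simps)
    also have "\<bar>\<dots>\<bar> \<le> \<bar>\<phi> \<omega> - \<phi> \<eta>\<bar> * \<bar>\<psi> \<omega>\<bar> + \<bar>\<phi> \<eta>\<bar> * \<bar>\<psi> \<omega> - \<psi> \<eta>\<bar>"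
      by (simp add: abs_mult[symmetric])
    also have "\<dots> \<le> (B * \<alpha> ^ n) * V + U * (C * \<alpha> ^ n)"
      using B(2)[OF H] C(2)[OF H] U(2)[OF H(2)] V(2)[OF H(1)] B(1) C(1) U(1) V(1) alpha_power
      by (intro add_mono mult_mono) auto
    finally show "\<bar>\<phi> \<omega> * \<psi> \<omega> - \<phi> \<eta> * \<psi> \<eta>\<bar> \<le> (B * V + U * C) * \<alpha> ^ n" by (simp add: algebra_simps)
  qed (use B C U V in auto)
qed

lemma hoelder_cmult: "hoelder \<phi> \<Longrightarrow> hoelder (\<lambda>\<omega>. c * \<phi> \<omega>)"
  by (rule hoelder_mult) auto

lemma hoelder_uminus [intro]: "hoelder \<phi> \<Longrightarrow> hoelder (\<lambda>\<omega>. - \<phi> \<omega>)"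
  using hoelder_cmult[of \<phi> "-1"] by simp

lemma hoelder_diff [intro]: "hoelder \<phi> \<Longrightarrow> hoelder \<psi> \<Longrightarrow> hoelder (\<lambda>\<omega>. \<phi> \<omega> - \<psi> \<omega>)"
  using hoelder_add[of \<phi> "\<lambda>\<omega>. - \<psi> \<omega>"] by auto

lemma hoelder_power [intro]: "hoelder \<phi> \<Longrightarrow> hoelder (\<lambda>\<omega>. \<phi> \<omega> ^ n)"
  by (induction n) auto

lemma hoelder_shift:
  assumes "hoelder \<phi>" shows "hoelder (\<lambda>\<omega>. \<phi> (shift \<omega>))"
proof -
  obtain B where "hoelder_with B \<phi>" using assms(1) unfolding hoelder_def by blast
  note B = hoelder_withD[OF this]
  show ?thesis
  proof (rule hoelderI[of "B / \<alpha>"])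
    fix \<omega> \<eta> n assume H: "\<omega> \<in> S" "\<eta> \<in> S" "agree n \<omega> \<eta>"
    have "\<bar>\<phi> (shift \<omega>) - \<phi> (shift \<eta>)\<bar> \<le> B * \<alpha> ^ (n - 1)"
      using H by (intro B(2) Sigma_K_shift agree_shift)
    \<comment> \<open>For n = 0 truncated subtraction leaves the exponent 0, and B \<le> B /
      \<alpha> absorbs this case.\<close>
    also have "\<dots> \<le> B / \<alpha> * \<alpha> ^ n" using alpha B(1) by (cases n) (auto simp: field_simps mult_left_le)
    finally show "\<bar>\<phi> (shift \<omega>) - \<phi> (shift \<eta>)\<bar> \<le> B / \<alpha> * \<alpha> ^ n" .
  qed (use B alpha in auto)
qed

lemma hoelder_shift_funpow: "hoelder \<phi> \<Longrightarrow> hoelder (\<lambda>\<omega>. \<phi> ((shift ^^ n) \<omega>))"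
proof (induction n)
  case (Suc n)
  show ?case using hoelder_shift[OF Suc.IH[OF Suc.prems]] by (simp add: funpow_swap1)
qed simp

lemma hoelder_sum [intro]: "(\<And>i. i \<in> I \<Longrightarrow> hoelder (\<phi> i)) \<Longrightarrow> hoelder (\<lambda>\<omega>. \<Sum>i\<in>I. \<phi> i \<omega>)"
  by (induction I rule: infinite_finite_induct) auto

lemma hoelder_birkhoff [intro]: "hoelder \<phi> \<Longrightarrow> hoelder (birkhoff \<phi> n)"
  unfolding birkhoff_def by (intro hoelder_sum hoelder_shift_funpow)

text \<open>The inequality exp y - 1 \<le> y * exp y turns the multiplicative condition into an
  additive one. The bound is proportional to A, so a small function in the cone has a small Hoelder
  constant.\<close>

lemma cone_hoelder:
  assumes "cone D \<phi>" "0 \<le> D" "\<And>\<omega>. \<omega> \<in> S \<Longrightarrow> \<phi> \<omega> \<le> A"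
    "\<omega> \<in> S" "\<eta> \<in> S" "agree n \<omega> \<eta>"
  shows "\<bar>\<phi> \<omega> - \<phi> \<eta>\<bar> \<le> D * exp D * A * \<alpha> ^ n"
proof -
  have *: "\<phi> \<omega> - \<phi> \<eta> \<le> D * exp D * A * \<alpha> ^ n"
    if H: "\<omega> \<in> S" "\<eta> \<in> S" "agree n \<omega> \<eta>" for \<omega> \<eta>
  proof -
    let ?y = "D * \<alpha> ^ n"
    have y: "0 \<le> ?y" "?y \<le> D" using assms(2) alpha_power by (auto simp: mult_left_le)
    have "1 - ?y \<le> exp (- ?y)" using exp_ge_add_one_self[of "- ?y"] by simp
    then have "(1 - ?y) * exp ?y \<le> exp (- ?y) * exp ?y" by (intro mult_right_mono) auto
    then have "exp ?y - 1 \<le> ?y * exp ?y" by (simp add: algebra_simps flip: exp_add)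
    also have "\<dots> \<le> ?y * exp D" using y by (intro mult_left_mono) auto
    finally have e: "exp ?y - 1 \<le> ?y * exp D" .
    have "\<phi> \<omega> - \<phi> \<eta> \<le> (exp ?y - 1) * \<phi> \<eta>" using coneD(2)[OF assms(1) H] by (simp add: algebra_simps)
    also have "\<dots> \<le> (?y * exp D) * A" using e y assms(3)[OF H(2)] coneD(1)[OF assms(1) H(2)]
      by (intro mult_mono) auto
    finally show ?thesis by (simp add: mult_ac)
  qed
  show ?thesis using *[of \<omega> \<eta>] *[of \<eta> \<omega>] assms(4-6) agree_sym by fastforce
qed

lemma cone_imp_hoelder: "cone D \<phi> \<Longrightarrow> 0 \<le> D \<Longrightarrow> hoelder \<phi>"
proof -
  assume a: "cone D \<phi>" "0 \<le> D"
  let ?A = "exp D * \<phi> (\<lambda>_. 1)"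
  have b: "\<phi> \<omega> \<le> ?A" if "\<omega> \<in> S" for \<omega> using cone_ratio[OF a(1) that base_point] .
  show ?thesis
    by (rule hoelderI[of "D * exp D * ?A"])
       (use a coneD(1)[OF a(1) base_point] cone_hoelder[OF a b] in auto)
qed

text \<open>Adding a large constant makes the additive oscillation small relative to the values. The
  constant does no harm later, because a normalized operator fixes constants.\<close>

lemma hoelder_shift_into_cone:
  assumes "hoelder \<phi>" "0 < D"
  obtains c where "cone D (\<lambda>\<omega>. \<phi> \<omega> + c)"
proof -
  obtain B where "hoelder_with B \<phi>" using assms(1) unfolding hoelder_def by blast
  note B = hoelder_withD[OF this]
  obtain U where U: "0 < U" "\<And>\<omega>. \<omega> \<in> S \<Longrightarrow> \<bar>\<phi> \<omega>\<bar> \<le> U" by (rule hoelder_bounded[OF assms(1)]) blast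
  \<comment> \<open>With this choice the shifted function is at least B / D, so the oscillation B *
    \<alpha> ^ n is at most D * \<alpha> ^ n times its value.\<close>
  let ?c = "U + B / D"
  have ge: "B / D \<le> \<phi> \<omega> + ?c" if "\<omega> \<in> S" for \<omega> using U(2)[OF that] by linarith
  show ?thesis
  proof (rule that[of ?c], rule coneI)
    fix \<omega> assume "\<omega> \<in> S" then show "0 \<le> \<phi> \<omega> + ?c"
      using ge[of \<omega>] B(1) assms(2) by (meson divide_nonneg_pos order_trans)
  next
    fix \<omega> \<eta> n assume H: "\<omega> \<in> S" "\<eta> \<in> S" "agree n \<omega> \<eta>"
    have "B * \<alpha> ^ n = (D * \<alpha> ^ n) * (B / D)" using assms(2) by simp
    also have "\<dots> \<le> (D * \<alpha> ^ n) * (\<phi> \<eta> + ?c)" using ge[OF H(2)] assms(2) alpha_power by (intro mult_left_mono) auto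
    finally have 1: "\<phi> \<omega> + ?c \<le> (1 + D * \<alpha> ^ n) * (\<phi> \<eta> + ?c)" using B(2)[OF H] unfolding ring_distribs by linarith
    have "0 \<le> \<phi> \<eta> + ?c" using ge[OF H(2)] B(1) assms(2) by (meson divide_nonneg_pos order_trans)
    then have "(1 + D * \<alpha> ^ n) * (\<phi> \<eta> + ?c) \<le> exp (D * \<alpha> ^ n) * (\<phi> \<eta> + ?c)"
      by (intro mult_right_mono) auto
    then show "\<phi> \<omega> + ?c \<le> exp (D * \<alpha> ^ n) * (\<phi> \<eta> + ?c)" using 1 by linarith
  qed
qed

end

section \<open>Geometric contraction and the Poisson equation for a normalized weight\<close>

locale normalized = symbolic +
  fixes g :: "(nat \<Rightarrow> nat) \<Rightarrow> real" and b :: real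
  assumes g_cone: "cone b g" and b_nonneg: "0 \<le> b"
    and g_sum: "\<And>\<omega>. \<omega> \<in> S \<Longrightarrow> transfer K g (\<lambda>_. 1) \<omega> = 1"
begin

abbreviation G where "G \<equiv> transfer K g"

lemma g_nonneg: "\<omega> \<in> S \<Longrightarrow> 0 \<le> g \<omega>"
  using coneD(1)[OF g_cone] .

lemma G_const: "\<omega> \<in> S \<Longrightarrow> G (\<lambda>_. c) \<omega> = c"
  using fun_cong[OF transfer_cmult[of K g c "\<lambda>_. 1"], of \<omega>] by (simp add: g_sum)

lemma Gn_const: "\<omega> \<in> S \<Longrightarrow> (G ^^ n) (\<lambda>_. c) \<omega> = c"
proof (induction n arbitrary: \<omega>)
  case (Suc n)
  have "(G ^^ Suc n) (\<lambda>_. c) \<omega> = G (\<lambda>_. c) \<omega>" using Suc by (auto intro!: transfer_cong)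
  then show ?case using G_const Suc by simp
qed simp

lemma Gn_le: "(\<And>\<omega>. \<omega> \<in> S \<Longrightarrow> \<phi> \<omega> \<le> c) \<Longrightarrow> \<omega> \<in> S \<Longrightarrow> (G ^^ n) \<phi> \<omega> \<le> c"
  using transfer_funpow_mono[of K g \<phi> "\<lambda>_. c" \<omega> n] g_nonneg Gn_const by simp

lemma Gn_ge: "(\<And>\<omega>. \<omega> \<in> S \<Longrightarrow> c \<le> \<phi> \<omega>) \<Longrightarrow> \<omega> \<in> S \<Longrightarrow> c \<le> (G ^^ n) \<phi> \<omega>"
  using transfer_funpow_mono[of K g "\<lambda>_. c" \<phi> \<omega> n] g_nonneg Gn_const by simp

text \<open>The solution of (b + D) * \<alpha> = D - 1: one application of \<open>G\<close> leaves a
  margin of 1 in the aperture, which pays for subtracting a constant.\<close>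

definition D\<^sub>c where "D\<^sub>c = (b * \<alpha> + 1) / (1 - \<alpha>)"
text \<open>The share \<open>1 - \<theta>\<^sub>c\<close> of a function that can be split off as a
  constant: the factors exp (- D) / D and exp (- 2 * D) of the subtracted constant, and a further
  exp (- D) for comparing the base point with an arbitrary point.\<close>

definition \<theta>\<^sub>c where "\<theta>\<^sub>c = 1 - exp (- 3 * D\<^sub>c) / D\<^sub>c * exp (- D\<^sub>c)"

lemma Dc: "1 \<le> D\<^sub>c" "(b + D\<^sub>c) * \<alpha> = D\<^sub>c - 1"
proof -
  have "0 \<le> b * \<alpha>" using alpha b_nonneg by simp
  then have "1 - \<alpha> \<le> b * \<alpha> + 1" using alpha by linarith
  then show "1 \<le> D\<^sub>c" unfolding D\<^sub>c_def using alpha by (simp add: le_divide_eq)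
  have "D\<^sub>c * (1 - \<alpha>) = b * \<alpha> + 1" unfolding D\<^sub>c_def using alpha by simp
  then show "(b + D\<^sub>c) * \<alpha> = D\<^sub>c - 1" by (simp add: algebra_simps)
qed

lemma theta_c: "0 < \<theta>\<^sub>c" "\<theta>\<^sub>c < 1"
proof -
  have "exp (- 3 * D\<^sub>c) / D\<^sub>c < 1 / 1"
    by (rule frac_less) (use Dc(1) in auto)
  then have "exp (- 3 * D\<^sub>c) / D\<^sub>c * exp (- D\<^sub>c) < 1 * 1"
    by (intro mult_strict_mono) (use Dc(1) in auto)
  then show "0 < \<theta>\<^sub>c" by (simp add: \<theta>\<^sub>c_def)
  have "0 < exp (- 3 * D\<^sub>c) / D\<^sub>c * exp (- D\<^sub>c)" using Dc(1) by (intro mult_pos_pos divide_pos_pos) auto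
  then show "\<theta>\<^sub>c < 1" by (simp add: \<theta>\<^sub>c_def)
qed

text \<open>Since \<open>G\<close> maps the cone of aperture \<open>D\<^sub>c\<close> into the narrower cone of aperture \<open>D\<^sub>c - 1\<close>,
  a fixed proportion of \<open>G \<phi>\<close> can be split off as a constant.\<close>
lemma cone_contraction_step:
  assumes "cone D\<^sub>c \<phi>" "\<And>\<omega>. \<omega> \<in> S \<Longrightarrow> \<phi> \<omega> \<le> A"
  obtains c where "cone D\<^sub>c (\<lambda>\<omega>. G \<phi> \<omega> - c)" "\<And>\<omega>. \<omega> \<in> S \<Longrightarrow> G \<phi> \<omega> - c \<le> \<theta>\<^sub>c * A"
proof -
  let ?D = "D\<^sub>c" and ?p = "G \<phi>" and ?k = "exp (- D\<^sub>c) / D\<^sub>c"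
  \<comment> \<open>The factor exp (- D) / D is the inverse of D * exp D, which bounds the slope of
    exp on [0, D]; exp (- 2 * D) keeps the value at the base point below the value at any other
    point.\<close>
  define c where "c = ?k * exp (- 2 * ?D) * ?p (\<lambda>_. 1)"
  have cp: "cone (?D - 1) ?p" using cone_transfer[OF g_cone assms(1)] Dc(2) by simp
  then have cp': "cone ?D ?p" by (rule cone_mono) simp
  have pos: "0 \<le> ?p \<omega>" if "\<omega> \<in> S" for \<omega> using coneD(1)[OF cp that] .
  have k: "0 < ?k" "?k < 1" "?k * (?D * exp ?D) = 1"
  proof -
    show "0 < ?k" using Dc(1) by simp
    have "exp (- ?D) / ?D < 1 / 1" by (rule frac_less) (use Dc(1) in auto)
    then show "?k < 1" by simp
    show "?k * (?D * exp ?D) = 1" using Dc(1) by (simp flip: exp_add)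
  qed
  have cle: "c \<le> ?k * ?p \<eta>" if "\<eta> \<in> S" for \<eta>
  proof -
    have "?p (\<lambda>_. 1) \<le> exp ?D * ?p \<eta>" using cone_ratio[OF cp' base_point that] .
    also have "\<dots> \<le> exp (2 * ?D) * ?p \<eta>" using Dc(1) pos[OF that] by (intro mult_right_mono) auto
    finally have "exp (- 2 * ?D) * ?p (\<lambda>_. 1) \<le> exp (- 2 * ?D) * (exp (2 * ?D) * ?p \<eta>)"
      by (intro mult_left_mono) auto
    also have "\<dots> = ?p \<eta>" by (simp add: mult.assoc[symmetric] flip: exp_add)
    finally have "exp (- 2 * ?D) * ?p (\<lambda>_. 1) \<le> ?p \<eta>" .
    then have "?k * (exp (- 2 * ?D) * ?p (\<lambda>_. 1)) \<le> ?k * ?p \<eta>" by (rule mult_left_mono) (use k(1) in simp)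
    then show ?thesis unfolding c_def by (simp add: mult.assoc)
  qed
  have c0: "0 \<le> c" unfolding c_def using k(1) pos[OF base_point] by (intro mult_nonneg_nonneg) auto
  show ?thesis
  proof (rule that[of c])
    show "cone ?D (\<lambda>\<omega>. G \<phi> \<omega> - c)"
    proof (rule coneI)
      fix \<omega> assume H: "\<omega> \<in> S"
      have "?k * ?p \<omega> \<le> ?p \<omega>" using k pos[OF H] by (intro mult_left_le_one_le) auto
      then show "0 \<le> G \<phi> \<omega> - c" using cle[OF H] by linarith
    next
      fix \<omega> \<eta> n assume H: "\<omega> \<in> S" "\<eta> \<in> S" "agree n \<omega> \<eta>"
      let ?x = "\<alpha> ^ n"
      have x: "0 \<le> ?x" "?x \<le> 1" using alpha_power by auto
      have y: "0 \<le> ?D * ?x" "?D * ?x \<le> ?D" using Dc(1) x by (auto simp: mult_left_le)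
      have "1 - ?D * ?x \<le> exp (- (?D * ?x))" using exp_ge_add_one_self[of "- (?D * ?x)"] by simp
      then have "(1 - ?D * ?x) * exp (?D * ?x) \<le> exp (- (?D * ?x)) * exp (?D * ?x)" by (intro mult_right_mono) auto
      then have "exp (?D * ?x) - 1 \<le> ?D * ?x * exp (?D * ?x)" by (simp add: algebra_simps flip: exp_add)
      also have "\<dots> \<le> ?D * ?x * exp ?D" using y by (intro mult_left_mono) auto
      finally have e1: "exp (?D * ?x) - 1 \<le> ?D * ?x * exp ?D" .
      \<comment> \<open>Subtracting c costs c * (exp (D x) - 1) in the cone inequality, and having
        aperture D - 1 in place of D gains p \<eta> * (exp (D x) - exp ((D - 1) x)). The cost is at
        most p \<eta> * x and the gain at least that.\<close>
      have "c * (exp (?D * ?x) - 1) \<le> (?k * ?p \<eta>) * (?D * ?x * exp ?D)"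
        using e1 cle[OF H(2)] c0 y by (intro mult_mono) (auto intro: order_trans)
      also have "\<dots> = (?k * (?D * exp ?D)) * (?p \<eta> * ?x)" by (simp add: mult_ac)
      also have "\<dots> = ?p \<eta> * ?x" using k(3) by simp
      also have "\<dots> \<le> ?p \<eta> * (exp (?D * ?x) - exp ((?D - 1) * ?x))"
      proof (intro mult_left_mono pos H)
        have "exp (?D * ?x) - exp ((?D - 1) * ?x) = exp ((?D - 1) * ?x) * (exp ?x - 1)"
          by (simp add: algebra_simps flip: exp_add)
        moreover have "1 * ?x \<le> exp ((?D - 1) * ?x) * (exp ?x - 1)"
        proof (intro mult_mono)
          show "1 \<le> exp ((D\<^sub>c - 1) * \<alpha> ^ n)" using Dc(1) x by simp
          show "?x \<le> exp ?x - 1" using exp_ge_add_one_self[of ?x] by linarith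
        qed (use x in auto)
        ultimately show "?x \<le> exp (?D * ?x) - exp ((?D - 1) * ?x)" by simp
      qed
      finally have "c * (exp (?D * ?x) - 1) \<le> ?p \<eta> * (exp (?D * ?x) - exp ((?D - 1) * ?x))" .
      then show "G \<phi> \<omega> - c \<le> exp (?D * ?x) * (G \<phi> \<eta> - c)"
        using coneD(2)[OF cp H] by (simp add: algebra_simps)
    qed
  next
    fix \<omega> assume H: "\<omega> \<in> S"
    have "exp (- ?D) * ?p \<omega> \<le> exp (- ?D) * (exp ?D * ?p (\<lambda>_. 1))"
      using cone_ratio[OF cp' H base_point] by simp
    then have "exp (- ?D) * ?p \<omega> \<le> ?p (\<lambda>_. 1)" by (simp add: mult.assoc[symmetric] flip: exp_add)
    then have "?k * exp (- 2 * ?D) * (exp (- ?D) * ?p \<omega>) \<le> c"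
      unfolding c_def using k(1) by (intro mult_left_mono mult_nonneg_nonneg) auto
    moreover have "?k * exp (- 2 * ?D) * (exp (- ?D) * ?p \<omega>) = (1 - \<theta>\<^sub>c) * ?p \<omega>"
      unfolding \<theta>\<^sub>c_def by (simp add: mult.assoc[symmetric] flip: exp_add)
    ultimately have "G \<phi> \<omega> - c \<le> \<theta>\<^sub>c * ?p \<omega>" by (simp add: algebra_simps)
    also have "\<dots> \<le> \<theta>\<^sub>c * A"
      using theta_c Gn_le[of \<phi> A \<omega> "Suc 0"] assms(2) H by (intro mult_left_mono) auto
    finally show "G \<phi> \<omega> - c \<le> \<theta>\<^sub>c * A" .
  qed
qed

text \<open>\<open>G\<close> fixes constants, so the constants split off at the successive steps
  simply add up to c, while the remainder stays in the cone and shrinks by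
  \<open>\<theta>\<^sub>c\<close> each time.\<close>

lemma cone_contraction:
  assumes "cone D\<^sub>c \<phi>" "\<And>\<omega>. \<omega> \<in> S \<Longrightarrow> \<phi> \<omega> \<le> A"
  shows "\<exists>c. cone D\<^sub>c (\<lambda>\<omega>. (G ^^ n) \<phi> \<omega> - c) \<and> (\<forall>\<omega>\<in>S. (G ^^ n) \<phi> \<omega> - c \<le> \<theta>\<^sub>c ^ n * A)"
proof (induction n)
  case 0
  then show ?case using assms by (intro exI[of _ 0]) auto
next
  case (Suc n)
  then obtain c where c: "cone D\<^sub>c (\<lambda>\<omega>. (G ^^ n) \<phi> \<omega> - c)" "\<And>\<omega>. \<omega>\<in>S \<Longrightarrow> (G ^^ n) \<phi> \<omega> - c \<le> \<theta>\<^sub>c ^ n * A"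
    by auto
  obtain d where d: "cone D\<^sub>c (\<lambda>\<omega>. G (\<lambda>\<omega>. (G ^^ n) \<phi> \<omega> - c) \<omega> - d)"
     "\<And>\<omega>. \<omega> \<in> S \<Longrightarrow> G (\<lambda>\<omega>. (G ^^ n) \<phi> \<omega> - c) \<omega> - d \<le> \<theta>\<^sub>c * (\<theta>\<^sub>c ^ n * A)"
    using cone_contraction_step[OF c(1), of "\<theta>\<^sub>c ^ n * A"] c(2) by blast
  have eq: "G (\<lambda>\<omega>. (G ^^ n) \<phi> \<omega> - c) \<omega> - d = (G ^^ Suc n) \<phi> \<omega> - (c + d)" if "\<omega> \<in> S" for \<omega>
    using G_const[OF that] by (simp add: transfer_diff)
  have "cone D\<^sub>c (\<lambda>\<omega>. (G ^^ Suc n) \<phi> \<omega> - (c + d))"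
    using d(1) unfolding cone_def using eq by simp
  moreover have "\<forall>\<omega>\<in>S. (G ^^ Suc n) \<phi> \<omega> - (c + d) \<le> \<theta>\<^sub>c ^ Suc n * A"
    using d(2) eq by (simp add: mult.assoc)
  ultimately show ?case by blast
qed

text \<open>By cone contraction the iterates differ from constants by members of a fixed cone of
  size \<open>\<theta>\<^sub>c ^ n\<close>, so oscillation and Hoelder constant decay geometrically.
  The limit c is not yet tied to a measure; none is present in this locale.\<close>

lemma G_iterates_converge:
  assumes "hoelder \<phi>"
  obtains c A where "0 \<le> A" "\<And>n \<omega>. \<omega> \<in> S \<Longrightarrow> \<bar>(G ^^ n) \<phi> \<omega> - c\<bar> \<le> A * \<theta>\<^sub>c ^ n"
    "\<And>n \<omega> \<eta> j. \<omega> \<in> S \<Longrightarrow> \<eta> \<in> S \<Longrightarrow> agree j \<omega> \<eta> \<Longrightarrow> \<bar>(G ^^ n) \<phi> \<omega> - (G ^^ n) \<phi> \<eta>\<bar> \<le> A * \<theta>\<^sub>c ^ n * \<alpha> ^ j"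
proof -
  obtain c0 where c0: "cone D\<^sub>c (\<lambda>\<omega>. \<phi> \<omega> + c0)" using hoelder_shift_into_cone[OF assms, of D\<^sub>c] Dc(1) by auto
  define A where "A = exp D\<^sub>c * (\<phi> (\<lambda>_. 1) + c0)"
  have A: "\<phi> \<omega> + c0 \<le> A" if "\<omega> \<in> S" for \<omega> unfolding A_def using cone_ratio[OF c0 that base_point] .
  have A0: "0 \<le> A" using coneD(1)[OF c0 base_point] by (simp add: A_def)
  have shiftc: "(G ^^ n) (\<lambda>\<omega>. \<phi> \<omega> + c0) \<omega> = (G ^^ n) \<phi> \<omega> + c0" if "\<omega> \<in> S" for n \<omega>
    using Gn_const[OF that] by (simp add: transfer_funpow_add)
  define A' where "A' = D\<^sub>c * exp D\<^sub>c * A"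
  have A': "0 \<le> A'" using A0 Dc(1) by (auto simp: A'_def)
  have osc: "\<bar>(G ^^ n) \<phi> \<omega> - (G ^^ n) \<phi> \<eta>\<bar> \<le> A' * \<theta>\<^sub>c ^ n * \<alpha> ^ j"
    if H: "\<omega> \<in> S" "\<eta> \<in> S" "agree j \<omega> \<eta>" for n \<omega> \<eta> j
  proof -
    obtain c where c: "cone D\<^sub>c (\<lambda>\<omega>. (G ^^ n) (\<lambda>\<omega>. \<phi> \<omega> + c0) \<omega> - c)"
      "\<And>\<omega>. \<omega>\<in>S \<Longrightarrow> (G ^^ n) (\<lambda>\<omega>. \<phi> \<omega> + c0) \<omega> - c \<le> \<theta>\<^sub>c ^ n * A"
      using cone_contraction[OF c0 A] by blast
    show ?thesis using cone_hoelder[OF c(1) _ c(2) H] Dc(1) shiftc H by (simp add: A'_def mult_ac)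
  qed
  define a where "a n = (G ^^ n) \<phi> (\<lambda>_. 1)" for n
  have oa: "\<bar>(G ^^ n) \<phi> \<omega> - a n\<bar> \<le> A' * \<theta>\<^sub>c ^ n" if "\<omega> \<in> S" for n \<omega>
    using osc[OF that base_point, of 0 n] by (simp add: a_def)
  \<comment> \<open>\<open>G\<close> averages, so the next value at the base point lies within the
    oscillation of the current iterate. The values at the base point therefore form a Cauchy
    sequence.\<close>
  have step: "\<bar>a (Suc n) - a n\<bar> \<le> A' * \<theta>\<^sub>c ^ n" for n
  proof -
    have "G ((G ^^ n) \<phi>) (\<lambda>_. 1) \<le> a n + A' * \<theta>\<^sub>c ^ n"
      using Gn_le[of "(G ^^ n) \<phi>" "a n + A' * \<theta>\<^sub>c ^ n" "\<lambda>_. 1" "Suc 0"] oa[of _ n] base_point by (simp add: abs_le_iff algebra_simps)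
    moreover have "a n - A' * \<theta>\<^sub>c ^ n \<le> G ((G ^^ n) \<phi>) (\<lambda>_. 1)"
      using Gn_ge[of "a n - A' * \<theta>\<^sub>c ^ n" "(G ^^ n) \<phi>" "\<lambda>_. 1" "Suc 0"] oa[of _ n] base_point by (simp add: abs_le_iff algebra_simps)
    ultimately show ?thesis by (simp add: a_def)
  qed
  define d where "d n = a (Suc n) - a n" for n
  have gs: "summable (\<lambda>n. A' * \<theta>\<^sub>c ^ n)" using theta_c by (intro summable_mult summable_geometric) auto
  have sd: "summable (\<lambda>n. \<bar>d n\<bar>)" by (rule summable_comparison_test'[OF gs, of 0]) (use step in \<open>auto simp: d_def\<close>)
  define c where "c = a 0 + (\<Sum>n. d n)"
  have tail: "c - a n = (\<Sum>k. d (k + n))" for n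
  proof -
    have "(\<Sum>k. d k) = (\<Sum>k. d (k + n)) + (\<Sum>k<n. d k)" by (rule suminf_split_initial_segment[OF summable_rabs_cancel[OF sd]])
    moreover have "(\<Sum>k<n. d k) = a n - a 0" unfolding d_def by (rule sum_lessThan_telescope)
    ultimately show ?thesis by (simp add: c_def)
  qed
  have ca: "\<bar>c - a n\<bar> \<le> A' / (1 - \<theta>\<^sub>c) * \<theta>\<^sub>c ^ n" for n
  proof -
    have s: "summable (\<lambda>k. \<bar>d (k + n)\<bar>)" using sd by (subst summable_iff_shift)
    have "\<bar>\<Sum>k. d (k + n)\<bar> \<le> (\<Sum>k. \<bar>d (k + n)\<bar>)" by (rule summable_rabs[OF s])
    also have "\<dots> \<le> (\<Sum>k. A' * \<theta>\<^sub>c ^ n * \<theta>\<^sub>c ^ k)"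
    proof (rule suminf_le[OF _ s])
      show "\<bar>d (k + n)\<bar> \<le> A' * \<theta>\<^sub>c ^ n * \<theta>\<^sub>c ^ k" for k using step[of "k + n"] by (simp add: d_def power_add mult_ac)
      show "summable (\<lambda>k. A' * \<theta>\<^sub>c ^ n * \<theta>\<^sub>c ^ k)" using theta_c by (intro summable_mult summable_geometric) auto
    qed
    also have "\<dots> = A' / (1 - \<theta>\<^sub>c) * \<theta>\<^sub>c ^ n" using theta_c by (subst suminf_mult) (auto simp: suminf_geometric intro!: summable_geometric)
    finally show ?thesis by (simp add: tail)
  qed
  define A2 where "A2 = A' + A' / (1 - \<theta>\<^sub>c)"
  have A2: "A' \<le> A2" "0 \<le> A2" using A' theta_c by (auto simp: A2_def)
  show ?thesis
  proof (rule that[of A2 c])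
    fix n \<omega> assume "\<omega> \<in> S"
    then have "\<bar>(G ^^ n) \<phi> \<omega> - c\<bar> \<le> A' * \<theta>\<^sub>c ^ n + A' / (1 - \<theta>\<^sub>c) * \<theta>\<^sub>c ^ n"
      using oa[of \<omega> n] ca[of n] by linarith
    then show "\<bar>(G ^^ n) \<phi> \<omega> - c\<bar> \<le> A2 * \<theta>\<^sub>c ^ n" unfolding A2_def by (simp add: ring_distribs)
  next
    fix n \<omega> \<eta> j assume H: "\<omega> \<in> S" "\<eta> \<in> S" "agree j \<omega> \<eta>"
    have "A' * \<theta>\<^sub>c ^ n * \<alpha> ^ j \<le> A2 * \<theta>\<^sub>c ^ n * \<alpha> ^ j" using A2 theta_c alpha by (intro mult_right_mono) auto
    then show "\<bar>(G ^^ n) \<phi> \<omega> - (G ^^ n) \<phi> \<eta>\<bar> \<le> A2 * \<theta>\<^sub>c ^ n * \<alpha> ^ j" using osc[OF H, of n] by linarith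
  qed (rule A2)
qed

text \<open>u is the Neumann series of \<open>(G ^^ n) \<phi> - c\<close> over n \<ge> 1. Omitting n
  = 0 is what makes \<phi> - c + u - u (shift) a function annihilated by \<open>G\<close>, that is,
  a reverse martingale difference.\<close>

lemma poisson_equation:
  assumes "hoelder \<phi>"
  obtains c u where "hoelder u" "\<And>\<omega>. \<omega> \<in> S \<Longrightarrow> G \<phi> \<omega> - c + G u \<omega> = u \<omega>"
proof -
  obtain c A where A: "0 \<le> A" "\<And>n \<omega>. \<omega> \<in> S \<Longrightarrow> \<bar>(G ^^ n) \<phi> \<omega> - c\<bar> \<le> A * \<theta>\<^sub>c ^ n"
    "\<And>n \<omega> \<eta> j. \<omega> \<in> S \<Longrightarrow> \<eta> \<in> S \<Longrightarrow> agree j \<omega> \<eta> \<Longrightarrow> \<bar>(G ^^ n) \<phi> \<omega> - (G ^^ n) \<phi> \<eta>\<bar> \<le> A * \<theta>\<^sub>c ^ n * \<alpha> ^ j"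
    by (rule G_iterates_converge[OF assms]) blast
  have gs: "summable (\<lambda>n. B * \<theta>\<^sub>c ^ n)" for B using theta_c by (intro summable_mult summable_geometric) auto
  define w where "w n \<omega> = (G ^^ n) \<phi> \<omega> - c" for n \<omega>
  have sw: "summable (\<lambda>n. w n \<omega>)" if "\<omega> \<in> S" for \<omega>
    by (rule summable_comparison_test'[OF gs[of A], of 0]) (use A(2)[OF that] in \<open>auto simp: w_def\<close>)
  define u where "u \<omega> = (\<Sum>n. w (Suc n) \<omega>)" for \<omega>
  have su: "(\<lambda>n. w (Suc n) \<omega>) sums u \<omega>" if "\<omega> \<in> S" for \<omega>
    unfolding u_def using sw[OF that] by (subst summable_sums_iff[symmetric]) (subst summable_Suc_iff)
  have "hoelder u"
  proof (rule hoelderI[of "(\<Sum>n. A * \<theta>\<^sub>c ^ n)"])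
    show "0 \<le> (\<Sum>n. A * \<theta>\<^sub>c ^ n)" using gs A(1) theta_c by (intro suminf_nonneg) auto
    fix \<omega> \<eta> j assume H: "\<omega> \<in> S" "\<eta> \<in> S" "agree j \<omega> \<eta>"
    have le: "\<bar>w (Suc n) \<omega> - w (Suc n) \<eta>\<bar> \<le> \<alpha> ^ j * (A * \<theta>\<^sub>c ^ n)" for n
    proof -
      have "\<bar>w (Suc n) \<omega> - w (Suc n) \<eta>\<bar> \<le> A * \<theta>\<^sub>c ^ Suc n * \<alpha> ^ j" using A(3)[OF H, of "Suc n"] by (simp add: w_def)
      also have "\<dots> \<le> A * \<theta>\<^sub>c ^ n * \<alpha> ^ j"
        using A(1) theta_c alpha by (intro mult_right_mono mult_left_mono power_decreasing) auto
      finally show ?thesis by (simp add: mult_ac)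
    qed
    have s: "summable (\<lambda>n. \<bar>w (Suc n) \<omega> - w (Suc n) \<eta>\<bar>)"
      by (rule summable_comparison_test'[OF summable_mult[OF gs[of A], of "\<alpha> ^ j"], of 0]) (use le in auto)
    have "(\<lambda>n. w (Suc n) \<omega> - w (Suc n) \<eta>) sums (u \<omega> - u \<eta>)" by (intro sums_diff su H)
    then have "\<bar>u \<omega> - u \<eta>\<bar> = \<bar>\<Sum>n. w (Suc n) \<omega> - w (Suc n) \<eta>\<bar>" by (simp add: sums_iff)
    also have "\<dots> \<le> (\<Sum>n. \<bar>w (Suc n) \<omega> - w (Suc n) \<eta>\<bar>)" by (rule summable_rabs[OF s])
    also have "\<dots> \<le> (\<Sum>n. \<alpha> ^ j * (A * \<theta>\<^sub>c ^ n))" by (rule suminf_le[OF le s summable_mult[OF gs]])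
    also have "\<dots> = (\<Sum>n. A * \<theta>\<^sub>c ^ n) * \<alpha> ^ j" by (subst suminf_mult[OF gs]) simp
    finally show "\<bar>u \<omega> - u \<eta>\<bar> \<le> (\<Sum>n. A * \<theta>\<^sub>c ^ n) * \<alpha> ^ j" .
  qed
  moreover have "G \<phi> \<omega> - c + G u \<omega> = u \<omega>" if H: "\<omega> \<in> S" for \<omega>
  proof -
    have "(\<lambda>n. G (w (Suc n)) \<omega>) sums G u \<omega>" unfolding transfer_def
      using H su by (intro sums_sum sums_mult) auto
    moreover have "G (w n) \<omega> = w (Suc n) \<omega>" for n
      unfolding w_def using G_const[OF H] by (simp add: transfer_diff)
    ultimately have "(\<lambda>n. w (Suc (Suc n)) \<omega>) sums G u \<omega>" by simp
    then have "(\<lambda>n. w (Suc n) \<omega>) sums (G u \<omega> + w (Suc 0) \<omega>)" by (subst (asm) sums_Suc_iff)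
    then have "u \<omega> = G u \<omega> + w (Suc 0) \<omega>" using su[OF H] sums_unique2 by blast
    then show ?thesis by (simp add: w_def)
  qed
  ultimately show ?thesis using that by blast
qed

end

section \<open>Invariant measures and Gibbs measures\<close>

definition prefix_of :: "nat \<Rightarrow> (nat \<Rightarrow> nat) \<Rightarrow> nat list" where
  "prefix_of n \<omega> = map \<omega> [0..<n]"

definition prepend :: "nat list \<Rightarrow> (nat \<Rightarrow> nat) \<Rightarrow> nat \<Rightarrow> nat" where
  "prepend w \<omega> = (\<lambda>k. if k < length w then w ! k else \<omega> (k - length w))"

lemma length_prefix_of [simp]: "length (prefix_of n \<omega>) = n"
  by (simp add: prefix_of_def)

lemma prepend_Nil [simp]: "prepend [] \<omega> = \<omega>"
  by (simp add: prepend_def)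

lemma prepend_Cons [simp]: "prepend (i # w) \<omega> = case_nat i (prepend w \<omega>)"
  by (auto simp: prepend_def fun_eq_iff split: nat.split)

lemma prefix_of_prepend: "length w = n \<Longrightarrow> prefix_of n (prepend w \<omega>) = w"
  by (auto simp: prefix_of_def prepend_def intro!: nth_equalityI)

lemma prefix_of_eq_iff: "prefix_of n \<omega> = prefix_of n \<eta> \<longleftrightarrow> agree n \<omega> \<eta>"
  by (auto simp: prefix_of_def agree_def list_eq_iff_nth_eq)

lemma prefix_of_add: "prefix_of (m + n) \<omega> = prefix_of m \<omega> @ prefix_of n ((shift ^^ m) \<omega>)"
proof (rule nth_equalityI)
  fix i assume "i < length (prefix_of (m + n) \<omega>)"
  then show "prefix_of (m + n) \<omega> ! i = (prefix_of m \<omega> @ prefix_of n ((shift ^^ m) \<omega>)) ! i"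
    by (auto simp: prefix_of_def shift_funpow nth_append)
qed simp

lemma agree_prepend_prefix_of: "agree n \<omega> (prepend (prefix_of n \<omega>) \<eta>)"
  by (auto simp: agree_def prepend_def prefix_of_def)

lemma finite_words [simp]: "finite (words K n)"
  unfolding words_def using finite_lists_length_eq[of "{1..K}" n] by (simp add: conj_commute)

lemma words_Suc: "words K (Suc n) = (\<lambda>(i, w). i # w) ` ({1..K} \<times> words K n)"
  by (auto simp: words_def length_Suc_conv image_iff)

lemma words_append: "u \<in> words K m \<Longrightarrow> v \<in> words K n \<Longrightarrow> u @ v \<in> words K (m + n)"
  by (auto simp: words_def)

lemma prefix_of_words [intro]: "\<omega> \<in> Sigma_K K \<Longrightarrow> prefix_of n \<omega> \<in> words K n"
  by (auto simp: prefix_of_def words_def Sigma_K_def)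

lemma prepend_Sigma_K [intro]: "w \<in> words K n \<Longrightarrow> \<omega> \<in> Sigma_K K \<Longrightarrow> prepend w \<omega> \<in> Sigma_K K"
  by (auto simp: prepend_def words_def Sigma_K_def) (metis atLeastAtMost_iff nth_mem subsetD)+

lemma cylinder_prefix_of:
  "length w = n \<Longrightarrow> \<omega> \<in> cylinder K w \<longleftrightarrow> \<omega> \<in> Sigma_K K \<and> prefix_of n \<omega> = w"
  by (auto simp: cylinder_def prefix_of_def list_eq_iff_nth_eq)

text \<open>Bridge between operators and cylinders: for the weight exp (f - P) the product is
  exactly the exponential occurring in the Gibbs bounds.\<close>

lemma transfer_funpow_words:
  "(transfer K q ^^ n) \<phi> \<omega> = (\<Sum>w\<in>words K n. (\<Prod>k<n. q ((shift ^^ k) (prepend w \<omega>))) * \<phi> (prepend w \<omega>))"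
proof (induction n arbitrary: \<phi>)
  case 0
  have "words K 0 = {[]}" by (auto simp: words_def)
  then show ?case by simp
next
  case (Suc n)
  let ?Q = "\<lambda>n \<omega>. \<Prod>k<n. q ((shift ^^ k) \<omega>)"
  have Q: "?Q (Suc n) (case_nat i \<eta>) = q (case_nat i \<eta>) * ?Q n \<eta>" for i \<eta>
    unfolding prod.lessThan_Suc_shift funpow_Suc_right by simp
  have "(transfer K q ^^ Suc n) \<phi> \<omega> = (transfer K q ^^ n) (transfer K q \<phi>) \<omega>" by (simp add: funpow_swap1)
  also have "\<dots> = (\<Sum>w\<in>words K n. \<Sum>i\<in>{1..K}. ?Q (Suc n) (prepend (i # w) \<omega>) * \<phi> (prepend (i # w) \<omega>))"
    unfolding Suc.IH prepend_Cons Q by (simp add: transfer_def sum_distrib_left mult_ac)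
  also have "\<dots> = (\<Sum>(i, w)\<in>{1..K} \<times> words K n. ?Q (Suc n) (prepend (i # w) \<omega>) * \<phi> (prepend (i # w) \<omega>))"
    by (subst sum.swap) (rule sum.cartesian_product)
  also have "\<dots> = (\<Sum>w\<in>words K (Suc n). ?Q (Suc n) (prepend w \<omega>) * \<phi> (prepend w \<omega>))"
    unfolding words_Suc by (subst sum.reindex) (auto simp: inj_on_def case_prod_unfold)
  finally show ?case .
qed

lemma birkhoff_Suc: "birkhoff \<phi> (Suc n) \<omega> = \<phi> \<omega> + birkhoff \<phi> n (shift \<omega>)"
  unfolding birkhoff_def sum.lessThan_Suc_shift funpow_Suc_right by simp

lemma birkhoff_add: "birkhoff \<phi> (m + n) \<omega> = birkhoff \<phi> m \<omega> + birkhoff \<phi> n ((shift ^^ m) \<omega>)"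
proof (induction m arbitrary: \<omega>)
  case (Suc m)
  show ?case unfolding add_Suc birkhoff_Suc Suc.IH funpow_Suc_right by simp
qed (simp add: birkhoff_def)

lemma birkhoff_coboundary:
  "birkhoff (\<lambda>\<omega>. \<phi> \<omega> - c + u \<omega> - u (shift \<omega>)) n \<omega> = birkhoff \<phi> n \<omega> - n * c + u \<omega> - u ((shift ^^ n) \<omega>)"
proof (induction n)
  case (Suc n) then show ?case by (simp add: birkhoff_def algebra_simps)
qed (simp add: birkhoff_def)

text \<open>Bounded distortion: after k shifts the sequences still agree on n - k symbols, so the
  differences are dominated by a geometric series, independently of n.\<close>

lemma (in symbolic) birkhoff_distortion:
  assumes "hoelder \<phi>"
  obtains B where "0 < B" "\<And>n \<omega> \<eta>. \<omega> \<in> S \<Longrightarrow> \<eta> \<in> S \<Longrightarrow> agree n \<omega> \<eta> \<Longrightarrow> \<bar>birkhoff \<phi> n \<omega> - birkhoff \<phi> n \<eta>\<bar> \<le> B"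
proof -
  obtain B where "hoelder_with B \<phi>" using assms(1) unfolding hoelder_def by blast
  note B = hoelder_withD[OF this]
  have "\<bar>birkhoff \<phi> n \<omega> - birkhoff \<phi> n \<eta>\<bar> \<le> B * (1 - \<alpha> ^ n) / (1 - \<alpha>)"
    if H: "\<omega> \<in> S" "\<eta> \<in> S" "agree n \<omega> \<eta>" for n \<omega> \<eta>
    using H
  proof (induction n arbitrary: \<omega> \<eta>)
    case (Suc n)
    then have "\<bar>birkhoff \<phi> n (shift \<omega>) - birkhoff \<phi> n (shift \<eta>)\<bar> \<le> B * (1 - \<alpha> ^ n) / (1 - \<alpha>)"
      by (auto simp: agree_Suc_iff Sigma_K_shift)
    moreover have "B * \<alpha> ^ Suc n \<le> B * \<alpha> ^ n"
      using B(1) alpha by (intro mult_left_mono power_decreasing) auto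
    then have "\<bar>\<phi> \<omega> - \<phi> \<eta>\<bar> \<le> B * \<alpha> ^ n" using B(2)[OF Suc.prems] by linarith
    ultimately have "\<bar>birkhoff \<phi> (Suc n) \<omega> - birkhoff \<phi> (Suc n) \<eta>\<bar> \<le> B * \<alpha> ^ n + B * (1 - \<alpha> ^ n) / (1 - \<alpha>)"
      unfolding birkhoff_Suc by linarith
    also have "\<dots> = B * (1 - \<alpha> ^ Suc n) / (1 - \<alpha>)" using alpha by (simp add: field_simps)
    finally show ?case .
  qed (simp add: birkhoff_def)
  moreover have "B * (1 - \<alpha> ^ n) / (1 - \<alpha>) \<le> B / (1 - \<alpha>) + 1" for n
  proof -
    have "B * (1 - \<alpha> ^ n) / (1 - \<alpha>) \<le> B / (1 - \<alpha>)"
      using B(1) alpha alpha_power[of n] by (intro divide_right_mono) (auto simp: mult_left_le)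
    then show ?thesis by simp
  qed
  moreover have "0 < B / (1 - \<alpha>) + 1" using B(1) alpha by (simp add: add_nonneg_pos)
  ultimately show ?thesis using that[of "B / (1 - \<alpha>) + 1"] by (meson order_trans)
qed

section \<open>Shift-invariant measures on the sequence space\<close>

locale invariant = symbolic K \<alpha> + prob_space \<mu> for K \<alpha> and \<mu> :: "(nat \<Rightarrow> nat) measure" +
  assumes sets_mu: "sets \<mu> = sets (Sigma_space K)"
    and shift_measurable [measurable]: "shift \<in> measurable \<mu> \<mu>"
    and shift_invariant: "\<And>A. A \<in> sets \<mu> \<Longrightarrow> prob (shift -` A \<inter> space \<mu>) = prob A"
begin

lemma space_mu: "space \<mu> = S"
  using sets_eq_imp_space_eq[OF sets_mu]
  by (auto simp: Sigma_space_def space_PiM Sigma_K_def PiE_def Pi_def)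

lemma cylinder_sets [measurable]: "cylinder K w \<in> sets \<mu>"
proof -
  have "{\<omega> \<in> space \<mu>. \<omega> k = a} \<in> sets \<mu>" for k a
  proof -
    have 1: "(\<lambda>\<omega>. \<omega> k) \<in> measurable \<mu> (count_space {1..K})"
      unfolding measurable_cong_sets[OF sets_mu refl] Sigma_space_def
      by (rule measurable_component_singleton) simp
    \<comment> \<open>The coordinate space carries only subsets of {1..K}, so the singleton is
      intersected with it; for other symbols both sides are empty.\<close>
    have "{\<omega> \<in> space \<mu>. \<omega> k = a} = (\<lambda>\<omega>. \<omega> k) -` ({a} \<inter> {1..K}) \<inter> space \<mu>"
      using 1 by (auto simp: space_mu Sigma_K_def)
    also have "\<dots> \<in> sets \<mu>" using measurable_sets[OF 1, of "{a} \<inter> {1..K}"] by simp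
    finally show ?thesis .
  qed
  then have "{\<omega> \<in> space \<mu>. \<forall>k\<in>{..<length w}. \<omega> k = w ! k} \<in> sets \<mu>"
    by (intro sets.sets_Collect_finite_All) auto
  also have "{\<omega> \<in> space \<mu>. \<forall>k\<in>{..<length w}. \<omega> k = w ! k} = cylinder K w"
    by (auto simp: cylinder_def space_mu)
  finally show ?thesis .
qed

lemma prefix_of_measurable [measurable]: "prefix_of n \<in> measurable \<mu> (count_space (words K n))"
proof (subst measurable_count_space_eq2[OF finite_words], intro conjI ballI)
  fix w assume w: "w \<in> words K n"
  then have "prefix_of n -` {w} \<inter> space \<mu> = cylinder K w"
    using cylinder_prefix_of[of w n] by (auto simp: words_def space_mu)
  then show "prefix_of n -` {w} \<inter> space \<mu> \<in> sets \<mu>" by simp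
qed (auto simp: space_mu)

lemma prefix_fun_measurable [measurable]: "(\<lambda>\<omega>. F (prefix_of n \<omega>)) \<in> borel_measurable \<mu>"
  by (rule measurable_compose[OF prefix_of_measurable]) simp

lemma prefix_pred_sets [measurable]: "{\<omega> \<in> S. Q (prefix_of n \<omega>)} \<in> sets \<mu>"
proof -
  have "Measurable.pred \<mu> (\<lambda>\<omega>. Q (prefix_of n \<omega>))"
    by (rule measurable_compose[OF prefix_of_measurable]) simp
  then show ?thesis by (simp add: pred_def space_mu)
qed

lemma shift_funpow_measurable [measurable]: "(shift ^^ n) \<in> measurable \<mu> \<mu>"
  by (induction n) (auto intro: measurable_comp)

lemma integrable_prefix: "integrable \<mu> (\<lambda>\<omega>. F (prefix_of n \<omega>) :: real)"
proof (rule integrable_const_bound[of _ "Max ((\<lambda>w. \<bar>F w\<bar>) ` words K n)"])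
  show "AE \<omega> in \<mu>. norm (F (prefix_of n \<omega>)) \<le> Max ((\<lambda>w. \<bar>F w\<bar>) ` words K n)"
    by (rule AE_I2) (auto simp: space_mu intro!: Max_ge)
qed simp

lemma integral_prefix:
  "(\<integral>\<omega>. F (prefix_of n \<omega>) \<partial>\<mu>) = (\<Sum>w\<in>words K n. F w * prob (cylinder K w))"
proof -
  have "(\<integral>\<omega>. F (prefix_of n \<omega>) \<partial>\<mu>) = (\<integral>\<omega>. (\<Sum>w\<in>words K n. F w * indicator (cylinder K w) \<omega>) \<partial>\<mu>)"
  proof (rule Bochner_Integration.integral_cong[OF refl])
    fix \<omega> assume "\<omega> \<in> space \<mu>"
    then have H: "\<omega> \<in> S" by (simp add: space_mu)
    have "(\<Sum>w\<in>words K n. F w * indicator (cylinder K w) \<omega>) = (\<Sum>w\<in>words K n. if w = prefix_of n \<omega> then F w else 0)"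
      using H cylinder_prefix_of by (intro sum.cong refl) (auto simp: indicator_def words_def)
    also have "\<dots> = F (prefix_of n \<omega>)" using H by (simp add: prefix_of_words)
    finally show "F (prefix_of n \<omega>) = (\<Sum>w\<in>words K n. F w * indicator (cylinder K w) \<omega>)" by simp
  qed
  also have "\<dots> = (\<Sum>w\<in>words K n. F w * prob (cylinder K w))"
    by (subst Bochner_Integration.integral_sum) (auto simp: emeasure_eq_measure)
  finally show ?thesis .
qed

lemma measure_prefix:
  "prob {\<omega> \<in> S. Q (prefix_of n \<omega>)} = (\<Sum>w\<in>{w\<in>words K n. Q w}. prob (cylinder K w))"
proof -
  have "prob {\<omega> \<in> S. Q (prefix_of n \<omega>)} = (\<integral>\<omega>. indicator {\<omega> \<in> S. Q (prefix_of n \<omega>)} \<omega> \<partial>\<mu>)"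
    by simp
  also have "\<dots> = (\<integral>\<omega>. of_bool (Q (prefix_of n \<omega>)) \<partial>\<mu>)"
    by (rule Bochner_Integration.integral_cong) (auto simp: space_mu indicator_def)
  also have "\<dots> = (\<Sum>w\<in>words K n. of_bool (Q w) * prob (cylinder K w))"
    by (rule integral_prefix)
  also have "\<dots> = (\<Sum>w\<in>{w\<in>words K n. Q w}. prob (cylinder K w))"
    by (subst sum.inter_filter[OF finite_words], rule sum.cong) auto
  finally show ?thesis .
qed

lemma sum_cylinders: "(\<Sum>w\<in>words K n. prob (cylinder K w)) = 1"
  using measure_prefix[of "\<lambda>_. True" n] prob_space by (simp add: space_mu)

text \<open>Functions of finitely many symbols are measurable, and so are their pointwise limits.
  The target is a metric space because this serves the coding map as well as real Hoelder
  functions.\<close>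

lemma measurable_if_prefix_limit:
  fixes F :: "(nat \<Rightarrow> nat) \<Rightarrow> 'b::{second_countable_topology, metric_space}"
  assumes "\<And>\<omega>. \<omega> \<in> S \<Longrightarrow> (\<lambda>n. F (prepend (prefix_of n \<omega>) (\<lambda>_. 1))) \<longlonglongrightarrow> F \<omega>"
  shows "F \<in> borel_measurable \<mu>"
proof (rule borel_measurable_LIMSEQ_metric)
  show "(\<lambda>\<omega>. F (prepend (prefix_of n \<omega>) (\<lambda>_. 1))) \<in> borel_measurable \<mu>" for n
    by (rule measurable_compose[OF prefix_of_measurable]) simp
qed (use assms space_mu in auto)

lemma hoelder_measurable [measurable]:
  assumes "hoelder \<phi>" shows "\<phi> \<in> borel_measurable \<mu>"
proof (rule measurable_if_prefix_limit)
  fix \<omega> assume H: "\<omega> \<in> S"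
  obtain B where "hoelder_with B \<phi>" using assms(1) unfolding hoelder_def by blast
  note B = hoelder_withD[OF this]
  have "(\<lambda>n. \<phi> \<omega> - \<phi> (prepend (prefix_of n \<omega>) (\<lambda>_. 1))) \<longlonglongrightarrow> 0"
  proof (rule Lim_null_comparison)
    show "\<forall>\<^sub>F n in sequentially. norm (\<phi> \<omega> - \<phi> (prepend (prefix_of n \<omega>) (\<lambda>_. 1))) \<le> B * \<alpha> ^ n"
      using B(2)[OF H _ agree_prepend_prefix_of] prepend_Sigma_K[OF prefix_of_words[OF H] base_point] by auto
    show "(\<lambda>n. B * \<alpha> ^ n) \<longlonglongrightarrow> 0" using alpha by (intro tendsto_mult_right_zero LIMSEQ_power_zero) auto
  qed
  from tendsto_diff[OF tendsto_const[of "\<phi> \<omega>"] this]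
  show "(\<lambda>n. \<phi> (prepend (prefix_of n \<omega>) (\<lambda>_. 1))) \<longlonglongrightarrow> \<phi> \<omega>" by simp
qed

lemma hoelder_integrable: "hoelder \<phi> \<Longrightarrow> integrable \<mu> \<phi>"
  by (metis (no_types, lifting) AE_I2 hoelder_bounded hoelder_measurable integrable_const_bound real_norm_def space_mu)

lemma distr_shift: "distr \<mu> \<mu> shift = \<mu>"
  by (rule measure_eqI) (auto simp: emeasure_distr emeasure_eq_measure shift_invariant)

lemma measure_shift_funpow:
  "A \<in> sets \<mu> \<Longrightarrow> prob ((shift ^^ n) -` A \<inter> space \<mu>) = prob A"
proof (induction n arbitrary: A)
  case 0
  then show ?case using sets.sets_into_space[OF 0] by (simp add: Int_absorb2)
next
  case (Suc n)
  have "(shift ^^ Suc n) -` A \<inter> space \<mu> = shift -` ((shift ^^ n) -` A \<inter> space \<mu>) \<inter> space \<mu>"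
    using measurable_space[OF shift_measurable] by (auto simp: funpow_swap1)
  also have "prob \<dots> = prob ((shift ^^ n) -` A \<inter> space \<mu>)"
    using Suc.prems by (intro shift_invariant) simp
  also have "\<dots> = prob A" by (rule Suc.IH[OF Suc.prems])
  finally show ?case .
qed

lemma integral_shift:
  assumes "hoelder \<phi>" shows "(\<integral>\<omega>. \<phi> (shift \<omega>) \<partial>\<mu>) = (\<integral>\<omega>. \<phi> \<omega> \<partial>\<mu>)"
  using integral_distr[OF shift_measurable hoelder_measurable[OF assms]] by (simp add: distr_shift)

lemma integral_birkhoff:
  assumes "hoelder \<phi>" shows "(\<integral>\<omega>. birkhoff \<phi> n \<omega> \<partial>\<mu>) = n * (\<integral>\<omega>. \<phi> \<omega> \<partial>\<mu>)"
proof (induction n)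
  case (Suc n)
  have "(\<integral>\<omega>. birkhoff \<phi> (Suc n) \<omega> \<partial>\<mu>) = (\<integral>\<omega>. \<phi> \<omega> + birkhoff \<phi> n (shift \<omega>) \<partial>\<mu>)"
    by (simp add: birkhoff_Suc)
  also have "\<dots> = (\<integral>\<omega>. \<phi> \<omega> \<partial>\<mu>) + (\<integral>\<omega>. birkhoff \<phi> n (shift \<omega>) \<partial>\<mu>)"
    by (intro Bochner_Integration.integral_add hoelder_integrable assms hoelder_shift hoelder_birkhoff)
  also have "(\<integral>\<omega>. birkhoff \<phi> n (shift \<omega>) \<partial>\<mu>) = (\<integral>\<omega>. birkhoff \<phi> n \<omega> \<partial>\<mu>)"
    by (intro integral_shift hoelder_birkhoff assms)
  finally show ?case using Suc by (simp add: algebra_simps)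
qed (simp add: birkhoff_def)

end

section \<open>Gibbs bounds, quasi-Bernoulli property and normalization of the potential\<close>

locale gibbs = invariant K \<alpha> \<mu> for K \<alpha> \<mu> +
  fixes f :: "(nat \<Rightarrow> nat) \<Rightarrow> real" and P C :: real
  assumes f_hoelder: "hoelder f" and C_gt: "1 < C"
    and gibbs_lower: "\<And>\<omega> n. \<omega> \<in> S \<Longrightarrow> exp (- real n * P + birkhoff f n \<omega>) / C \<le> prob (cylinder K (prefix_of n \<omega>))"
    and gibbs_upper: "\<And>\<omega> n. \<omega> \<in> S \<Longrightarrow> prob (cylinder K (prefix_of n \<omega>)) \<le> C * exp (- real n * P + birkhoff f n \<omega>)"
begin

definition q where "q \<omega> = exp (f \<omega> - P)"

lemma prod_q: "(\<Prod>k<n. q ((shift ^^ k) \<omega>)) = exp (- real n * P + birkhoff f n \<omega>)"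
  unfolding q_def birkhoff_def exp_sum[symmetric, OF finite_lessThan] by (simp add: sum_subtractf)

lemma cylinder_pos: "w \<in> words K n \<Longrightarrow> 0 < prob (cylinder K w)"
  using gibbs_lower[of "prepend w (\<lambda>_. 1)" n] prepend_Sigma_K[OF _ base_point] prefix_of_prepend[of w n] C_gt
  by (smt (verit) divide_pos_pos exp_gt_zero mem_Collect_eq words_def)

text \<open>The Birkhoff sum along the concatenated word splits exactly, and each of the three
  cylinders is within a factor C of its exponential; hence the cube.\<close>

lemma quasi_bernoulli:
  assumes "u \<in> words K m" "v \<in> words K n"
  shows "prob (cylinder K u) * prob (cylinder K v) / C ^ 3 \<le> prob (cylinder K (u @ v))"
    and "prob (cylinder K (u @ v)) \<le> C ^ 3 * (prob (cylinder K u) * prob (cylinder K v))"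
proof -
  define \<omega> where "\<omega> = prepend (u @ v) (\<lambda>_. 1)"
  have len: "length u = m" "length v = n" using assms by (auto simp: words_def)
  have w: "\<omega> \<in> S" unfolding \<omega>_def using words_append[OF assms] base_point by blast
  have s: "(shift ^^ m) \<omega> \<in> S" by (rule Sigma_K_shift_funpow[OF w])
  have uv: "prefix_of (m + n) \<omega> = u @ v" unfolding \<omega>_def by (rule prefix_of_prepend) (simp add: len)
  then have p: "prefix_of m \<omega> = u" "prefix_of n ((shift ^^ m) \<omega>) = v" using len by (simp_all add: prefix_of_add)
  let ?a = "exp (- real m * P + birkhoff f m \<omega>)" and ?b = "exp (- real n * P + birkhoff f n ((shift ^^ m) \<omega>))"
  have ab: "exp (- real (m + n) * P + birkhoff f (m + n) \<omega>) = ?a * ?b"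
    by (simp add: birkhoff_add algebra_simps flip: exp_add)
  note u1 = gibbs_lower[OF w, of m, unfolded p] and u2 = gibbs_upper[OF w, of m, unfolded p]
  note v1 = gibbs_lower[OF s, of n, unfolded p] and v2 = gibbs_upper[OF s, of n, unfolded p]
  note w1 = gibbs_lower[OF w, of "m + n", unfolded uv ab] and w2 = gibbs_upper[OF w, of "m + n", unfolded uv ab]
  have "prob (cylinder K u) * prob (cylinder K v) \<le> (C * ?a) * (C * ?b)"
    by (rule mult_mono[OF u2 v2]) (use C_gt in auto)
  then have "prob (cylinder K u) * prob (cylinder K v) / C ^ 3 \<le> (?a * ?b) / C"
    using C_gt by (simp add: field_simps power3_eq_cube)
  then show "prob (cylinder K u) * prob (cylinder K v) / C ^ 3 \<le> prob (cylinder K (u @ v))"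
    using w1 by linarith
  have "(?a / C) * (?b / C) \<le> prob (cylinder K u) * prob (cylinder K v)"
    using C_gt by (intro mult_mono u1 v1) auto
  then have "C * (?a * ?b) \<le> C ^ 3 * (prob (cylinder K u) * prob (cylinder K v))"
    using C_gt by (simp add: field_simps power3_eq_cube)
  then show "prob (cylinder K (u @ v)) \<le> C ^ 3 * (prob (cylinder K u) * prob (cylinder K v))"
    using w2 by linarith
qed

text \<open>The iterate is the sum of the Gibbs exponentials over all words of length n, each
  comparable to a cylinder measure, and those measures add up to 1.\<close>

lemma transfer_q_one:
  assumes "\<omega> \<in> S"
  shows "1 / C \<le> (transfer K q ^^ n) (\<lambda>_. 1) \<omega>" "(transfer K q ^^ n) (\<lambda>_. 1) \<omega> \<le> C"
proof -
  have e: "(transfer K q ^^ n) (\<lambda>_. 1) \<omega> = (\<Sum>w\<in>words K n. exp (- real n * P + birkhoff f n (prepend w \<omega>)))"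
    unfolding transfer_funpow_words prod_q by simp
  have p: "prefix_of n (prepend w \<omega>) = w" "prepend w \<omega> \<in> S" if "w \<in> words K n" for w
    using that prefix_of_prepend prepend_Sigma_K[OF that assms] by (auto simp: words_def)
  have "(\<Sum>w\<in>words K n. prob (cylinder K w) / C) \<le> (\<Sum>w\<in>words K n. exp (- real n * P + birkhoff f n (prepend w \<omega>)))"
  proof (rule sum_mono)
    fix w assume "w \<in> words K n"
    from gibbs_upper[OF p(2)[OF this], of n] p(1)[OF this]
    show "prob (cylinder K w) / C \<le> exp (- real n * P + birkhoff f n (prepend w \<omega>))"
      using C_gt by (simp add: field_simps)
  qed
  then show "1 / C \<le> (transfer K q ^^ n) (\<lambda>_. 1) \<omega>" unfolding e by (simp add: sum_cylinders flip: sum_divide_distrib)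
  have "(\<Sum>w\<in>words K n. exp (- real n * P + birkhoff f n (prepend w \<omega>))) \<le> (\<Sum>w\<in>words K n. C * prob (cylinder K w))"
  proof (rule sum_mono)
    fix w assume "w \<in> words K n"
    from gibbs_lower[OF p(2)[OF this], of n] p(1)[OF this]
    show "exp (- real n * P + birkhoff f n (prepend w \<omega>)) \<le> C * prob (cylinder K w)"
      using C_gt by (simp add: field_simps)
  qed
  then show "(transfer K q ^^ n) (\<lambda>_. 1) \<omega> \<le> C" unfolding e by (simp add: sum_cylinders flip: sum_distrib_left)
qed

text \<open>An eigenfunction h of the operator with weight q, bounded above and below, conjugates it
  to an operator fixing constants. The domination of iterates costs only sup h / inf h and carries
  Gibbs estimates over to the normalized operator.\<close>

lemma normalization:
  obtains g b A where "normalized K \<alpha> g b" "0 < A"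
    "\<And>n \<phi> \<omega>. (\<And>\<omega>. \<omega> \<in> S \<Longrightarrow> 0 \<le> \<phi> \<omega>) \<Longrightarrow> \<omega> \<in> S \<Longrightarrow>
        (transfer K q ^^ n) \<phi> \<omega> \<le> A * (transfer K g ^^ n) \<phi> \<omega>"
proof -
  obtain B where "hoelder_with B f" using f_hoelder unfolding hoelder_def by blast
  note B = hoelder_withD[OF this]
  have cq: "cone B q"
  proof (rule coneI)
    fix \<omega> \<eta> n assume "\<omega> \<in> S" "\<eta> \<in> S" "agree n \<omega> \<eta>"
    from B(2)[OF this] have "f \<omega> - P \<le> B * \<alpha> ^ n + (f \<eta> - P)" by linarith
    then show "q \<omega> \<le> exp (B * \<alpha> ^ n) * q \<eta>" unfolding q_def exp_add[symmetric] by simp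
  qed (simp add: q_def)
  have C0: "0 < C" using C_gt by simp
  obtain h D where h: "cone D h" "0 \<le> D" "\<And>\<omega>. \<omega> \<in> S \<Longrightarrow> 1 / C \<le> h \<omega>"
    "\<And>\<omega>. \<omega> \<in> S \<Longrightarrow> transfer K q h \<omega> = h \<omega>"
    by (rule transfer_fixed_point[OF cq B(1) C0 transfer_q_one]) blast+
  have hpos: "0 < h \<omega>" if "\<omega> \<in> S" for \<omega> using h(3)[OF that] C0 by (smt (verit) divide_pos_pos)
  define H where "H = exp D * h (\<lambda>_. 1)"
  have hH: "h \<omega> \<le> H" if "\<omega> \<in> S" for \<omega> unfolding H_def by (rule cone_ratio[OF h(1) that base_point])
  have H0: "0 < H" using hpos[OF base_point] by (simp add: H_def)
  \<comment> \<open>log g is f - P plus the coboundary log h - log h (shift); the eigenvalue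
    equation for h says precisely that g sums to 1 over preimages.\<close>
  define g where "g \<omega> = q \<omega> * h \<omega> * (1 / h (shift \<omega>))" for \<omega>
  have "cone (D / \<alpha>) (\<lambda>\<omega>. 1 / h (shift \<omega>))"
  proof (rule coneI)
    fix \<omega> \<eta> n assume a: "\<omega> \<in> S" "\<eta> \<in> S" "agree n \<omega> \<eta>"
    note s = Sigma_K_shift[OF a(1)] Sigma_K_shift[OF a(2)]
    have "h (shift \<eta>) \<le> exp (D * \<alpha> ^ (n - 1)) * h (shift \<omega>)"
      by (rule coneD(2)[OF h(1) s(2,1)]) (rule agree_shift[OF agree_sym[OF a(3)]])
    also have "\<dots> \<le> exp (D / \<alpha> * \<alpha> ^ n) * h (shift \<omega>)"
    proof (intro mult_right_mono)
      show "exp (D * \<alpha> ^ (n - 1)) \<le> exp (D / \<alpha> * \<alpha> ^ n)"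
        using alpha h(2) by (cases n) (auto simp: field_simps mult_left_le)
    qed (use hpos[OF s(1)] in simp)
    finally show "1 / h (shift \<omega>) \<le> exp (D / \<alpha> * \<alpha> ^ n) * (1 / h (shift \<eta>))"
      using hpos[OF s(1)] hpos[OF s(2)] by (simp add: field_simps)
  qed (use hpos[OF Sigma_K_shift] in \<open>simp add: less_imp_le\<close>)
  then have cg: "cone (B + D + D / \<alpha>) g" unfolding g_def by (intro cone_mult cq h(1))
  have tg: "transfer K g \<phi> \<omega> = transfer K q (\<lambda>\<omega>. h \<omega> * \<phi> \<omega>) \<omega> / h \<omega>" for \<phi> \<omega>
    by (simp add: transfer_def g_def sum_divide_distrib mult_ac)
  have tgn: "(transfer K q ^^ n) (\<lambda>\<omega>. h \<omega> * \<phi> \<omega>) \<omega> = h \<omega> * (transfer K g ^^ n) \<phi> \<omega>" if "\<omega> \<in> S" for n \<phi> \<omega>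
    using that
  proof (induction n arbitrary: \<omega>)
    case (Suc n)
    have "(transfer K q ^^ Suc n) (\<lambda>\<omega>. h \<omega> * \<phi> \<omega>) \<omega> = transfer K q (\<lambda>\<omega>. h \<omega> * (transfer K g ^^ n) \<phi> \<omega>) \<omega>"
      using Suc by (auto intro!: transfer_cong)
    then show ?case using hpos[OF Suc.prems] tg[of "(transfer K g ^^ n) \<phi>" \<omega>] by simp
  qed simp
  interpret nm: normalized K \<alpha> g "B + D + D / \<alpha>"
  proof
    fix \<omega> assume "\<omega> \<in> S"
    then show "transfer K g (\<lambda>_. 1) \<omega> = 1" using h(4) hpos[of \<omega>] by (simp add: tg)
  qed (use cg B h alpha in auto)
  show ?thesis
  proof (rule that[of g "B + D + D / \<alpha>" "H * C"])
    show "normalized K \<alpha> g (B + D + D / \<alpha>)" by (rule nm.normalized_axioms)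
    show "0 < H * C" using H0 C0 by simp
    fix n \<phi> \<omega> assume a: "\<And>\<omega>. \<omega> \<in> S \<Longrightarrow> (0::real) \<le> \<phi> \<omega>" and w: "\<omega> \<in> S"
    have "(transfer K q ^^ n) \<phi> \<omega> \<le> (transfer K q ^^ n) (\<lambda>\<omega>. h \<omega> * (C * \<phi> \<omega>)) \<omega>"
    proof (rule transfer_funpow_mono[OF _ _ w])
      fix \<eta> assume e: "\<eta> \<in> S"
      have "1 * \<phi> \<eta> \<le> (h \<eta> * C) * \<phi> \<eta>" using h(3)[OF e] a[OF e] C0 by (intro mult_right_mono) (auto simp: field_simps)
      then show "\<phi> \<eta> \<le> h \<eta> * (C * \<phi> \<eta>)" by simp
    qed (simp add: q_def)
    also have "\<dots> = h \<omega> * (C * (transfer K g ^^ n) \<phi> \<omega>)"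
      unfolding tgn[OF w] transfer_funpow_cmult ..
    also have "\<dots> \<le> H * (C * (transfer K g ^^ n) \<phi> \<omega>)"
      using hH[OF w] nm.Gn_ge[of 0 \<phi> \<omega> n] a w C0 by (intro mult_right_mono) auto
    finally show "(transfer K q ^^ n) \<phi> \<omega> \<le> H * C * (transfer K g ^^ n) \<phi> \<omega>" by simp
  qed
qed

end

section \<open>Martingale differences and their exponential moments\<close>

lemma exp_le_quadratic:
  fixes x :: real assumes "x \<le> 1" shows "exp x \<le> 1 + x + x\<^sup>2"
proof (cases "0 \<le> x")
  case True then show ?thesis using exp_bound assms by blast
next
  case False
  define z where "z = - x"
  have z: "0 \<le> z" using False by (simp add: z_def)
  \<comment> \<open>The quadratic Taylor polynomial bounds exp z from below, and its product with 1
    - z + z * z exceeds 1 only by nonnegative terms.\<close>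
  have "(1 + z + z\<^sup>2 / 2) * (1 - z + z\<^sup>2) = 1 + (z\<^sup>2 + z ^ 3 + z ^ 4) / 2"
    by (simp add: field_simps power2_eq_square power3_eq_cube power4_eq_xxxx)
  then have "1 \<le> (1 + z + z\<^sup>2 / 2) * (1 - z + z\<^sup>2)" using z by simp
  also have "\<dots> \<le> exp z * (1 - z + z\<^sup>2)"
  proof (rule mult_right_mono[OF exp_lower_Taylor_quadratic[OF z]])
    have "1 - z + z\<^sup>2 = (z - 1 / 2)\<^sup>2 + 3 / 4" by (simp add: power2_eq_square algebra_simps)
    then show "0 \<le> 1 - z + z\<^sup>2" by simp
  qed
  finally have "exp x * 1 \<le> exp x * (exp z * (1 - z + z\<^sup>2))" by (intro mult_left_mono) auto
  also have "\<dots> = 1 + x + x\<^sup>2" by (simp add: z_def mult.assoc[symmetric] flip: exp_add)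
  finally show ?thesis by simp
qed

lemma (in symbolic) hoelder_case_nat:
  assumes "hoelder \<phi>" "i \<in> {1..K}" shows "hoelder (\<lambda>\<omega>. \<phi> (case_nat i \<omega>))"
proof -
  obtain B where "hoelder_with B \<phi>" using assms(1) unfolding hoelder_def by blast
  note B = hoelder_withD[OF this]
  show ?thesis
  proof (rule hoelderI[OF B(1)])
    fix \<omega> \<eta> n assume H: "\<omega> \<in> S" "\<eta> \<in> S" "agree n \<omega> \<eta>"
    have "\<bar>\<phi> (case_nat i \<omega>) - \<phi> (case_nat i \<eta>)\<bar> \<le> B * \<alpha> ^ Suc n"
      using H assms(2) by (intro B(2)) auto
    also have "\<dots> \<le> B * \<alpha> ^ n" using B(1) alpha by (intro mult_left_mono power_decreasing) auto
    finally show "\<bar>\<phi> (case_nat i \<omega>) - \<phi> (case_nat i \<eta>)\<bar> \<le> B * \<alpha> ^ n" .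
  qed
qed

context normalized begin

lemma hoelder_G: "hoelder \<phi> \<Longrightarrow> hoelder (G \<phi>)"
  unfolding transfer_def
  by (intro hoelder_sum hoelder_mult hoelder_case_nat cone_imp_hoelder[OF g_cone b_nonneg])

lemma hoelder_Gn: "hoelder \<phi> \<Longrightarrow> hoelder ((G ^^ n) \<phi>)"
  by (induction n) (auto simp: hoelder_G)

lemma G_shift: "\<omega> \<in> S \<Longrightarrow> G (\<lambda>\<omega>. \<phi> (shift \<omega>)) \<omega> = \<phi> \<omega>"
  using fun_cong[OF transfer_mult_shift[of K g "\<lambda>_. 1" \<phi>], of \<omega>] g_sum by simp

text \<open>Orthogonality of reverse martingale differences: the cross term is m times a function of
  the shifted sequence, so the pull-out rule and \<open>G m = 0\<close> remove it.\<close>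

lemma G_martingale_square:
  assumes "\<omega> \<in> S" "\<And>\<omega>. \<omega> \<in> S \<Longrightarrow> G m \<omega> = 0"
  shows "G (\<lambda>\<omega>. (birkhoff m (Suc n) \<omega>)\<^sup>2) \<omega> = G (\<lambda>\<omega>. (m \<omega>)\<^sup>2) \<omega> + (birkhoff m n \<omega>)\<^sup>2"
proof -
  let ?M = "birkhoff m n"
  have "(\<lambda>\<omega>. (birkhoff m (Suc n) \<omega>)\<^sup>2) = (\<lambda>\<omega>. (m \<omega>)\<^sup>2 + (2 * (m \<omega> * ?M (shift \<omega>)) + (?M (shift \<omega>))\<^sup>2))"
    by (auto simp: birkhoff_Suc power2_eq_square algebra_simps)
  then show ?thesis
    using assms G_shift[of \<omega> "\<lambda>\<omega>. (?M \<omega>)\<^sup>2"] by (simp add: transfer_add transfer_cmult transfer_mult_shift)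
qed

lemma Gn_martingale_square:
  assumes "\<omega> \<in> S" "\<And>\<omega>. \<omega> \<in> S \<Longrightarrow> G m \<omega> = 0" "\<And>\<omega>. \<omega> \<in> S \<Longrightarrow> \<bar>m \<omega>\<bar> \<le> U"
  shows "(G ^^ n) (\<lambda>\<omega>. (birkhoff m n \<omega>)\<^sup>2) \<omega> \<le> n * U\<^sup>2"
proof (induction n)
  case (Suc n)
  have "(G ^^ Suc n) (\<lambda>\<omega>. (birkhoff m (Suc n) \<omega>)\<^sup>2) \<omega> = (G ^^ n) (G (\<lambda>\<omega>. (birkhoff m (Suc n) \<omega>)\<^sup>2)) \<omega>"
    by (simp add: funpow_swap1)
  also have "\<dots> \<le> (G ^^ n) (\<lambda>\<omega>. U\<^sup>2 + (birkhoff m n \<omega>)\<^sup>2) \<omega>"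
  proof (rule transfer_funpow_mono[OF g_nonneg _ assms(1)])
    fix \<eta> assume e: "\<eta> \<in> S"
    have "(G ^^ Suc 0) (\<lambda>\<omega>. (m \<omega>)\<^sup>2) \<eta> \<le> U\<^sup>2"
      using assms(3) by (intro Gn_le e) (simp add: abs_le_square_iff[symmetric] order_trans[OF _ abs_ge_self])
    then show "G (\<lambda>\<omega>. (birkhoff m (Suc n) \<omega>)\<^sup>2) \<eta> \<le> U\<^sup>2 + (birkhoff m n \<eta>)\<^sup>2"
      using G_martingale_square[OF e, of m n] assms(2) by simp
  qed
  also have "\<dots> = U\<^sup>2 + (G ^^ n) (\<lambda>\<omega>. (birkhoff m n \<omega>)\<^sup>2) \<omega>"
    using Gn_const[OF assms(1)] by (simp add: transfer_funpow_add)
  finally show ?case using Suc by (simp add: algebra_simps)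
qed (simp add: birkhoff_def)

text \<open>The perturbed eigenfunction \<open>1 + t\<^sup>2 v / 2\<close> solves the eigenvalue equation of the
  tilted operator up to third order in \<open>t\<close>.\<close>
lemma Gn_exp_martingale:
  assumes m: "\<And>\<omega>. \<omega> \<in> S \<Longrightarrow> G m \<omega> = 0" "\<And>\<omega>. \<omega> \<in> S \<Longrightarrow> \<bar>m \<omega>\<bar> \<le> U" "0 < U"
    and v: "\<And>\<omega>. \<omega> \<in> S \<Longrightarrow> G (\<lambda>\<omega>. (m \<omega>)\<^sup>2) \<omega> - \<rho> + G v \<omega> = v \<omega>"
      "\<And>\<omega>. \<omega> \<in> S \<Longrightarrow> \<bar>v \<omega>\<bar> \<le> V" "0 < V" and rho: "0 \<le> \<rho>"
  obtains B t0 where "0 < B" "0 < t0" "\<And>n t \<omega>. \<omega> \<in> S \<Longrightarrow> \<bar>t\<bar> \<le> t0 \<Longrightarrow>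
      exp (n * (\<rho> * t\<^sup>2 / 2 - B * \<bar>t\<bar> ^ 3)) / 3 \<le> (G ^^ n) (\<lambda>\<omega>. exp (t * birkhoff m n \<omega>)) \<omega>"
    "\<And>n t \<omega>. \<omega> \<in> S \<Longrightarrow> \<bar>t\<bar> \<le> t0 \<Longrightarrow>
      (G ^^ n) (\<lambda>\<omega>. exp (t * birkhoff m n \<omega>)) \<omega> \<le> 3 * exp (n * (\<rho> * t\<^sup>2 / 2 + B * \<bar>t\<bar> ^ 3))"
proof -
  \<comment> \<open>\<open>B0\<close> bounds the cubic remainder \<open>R\<close>. B is larger since
    Q may be as small as 1/2 (the factor 4), since \<rho> t t / 2 appears multiplied by Q (the term
    \<rho> V), and since the second-order term of exp must be absorbed in the lower bound (the
    1).\<close>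
  define B0 where "B0 = U * V + 2 * U ^ 3"
  define B where "B = 4 * B0 + \<rho> * V + 1"
  \<comment> \<open>The four bounds serve, in this order, to compare powers of t, to expand exp (t
    m), to keep Q within 1/2 of 1, and to make the square of the exponent y at most a sixth of the
    cube of t.\<close>
  define t0 where "t0 = min (min 1 (1 / U)) (min (1 / V) (1 / (1 + 6 * (\<rho> / 2 + B)\<^sup>2)))"
  have B0: "0 < B0" using m(3) v(3) by (simp add: B0_def add_pos_pos)
  have B: "1 \<le> B" "4 * B0 + \<rho> * V \<le> B" using B0 rho v(3) by (auto simp: B_def)
  have t0: "0 < t0" using m(3) v(3) by (auto simp: t0_def add_pos_nonneg)
  define Q where "Q t \<omega> = 1 + t\<^sup>2 * v \<omega> / 2" for t \<omega>
  have small: "\<bar>t\<bar> \<le> 1" "\<bar>t\<bar> * U \<le> 1" "t\<^sup>2 * V \<le> 1" "\<bar>t\<bar> * (\<rho> / 2 + B)\<^sup>2 \<le> 1 / 6" if "\<bar>t\<bar> \<le> t0" for t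
  proof -
    have t: "\<bar>t\<bar> \<le> 1" "\<bar>t\<bar> \<le> 1 / U" "\<bar>t\<bar> \<le> 1 / V" "\<bar>t\<bar> \<le> 1 / (1 + 6 * (\<rho> / 2 + B)\<^sup>2)"
      using that by (auto simp: t0_def)
    show "\<bar>t\<bar> \<le> 1" "\<bar>t\<bar> * U \<le> 1" using t m(3) by (auto simp: field_simps)
    have "t\<^sup>2 * V = \<bar>t\<bar> * (\<bar>t\<bar> * V)" by (simp add: power2_eq_square flip: abs_mult)
    also have "\<dots> \<le> \<bar>t\<bar> * 1" using t(3) v(3) by (intro mult_left_mono) (auto simp: field_simps)
    finally show "t\<^sup>2 * V \<le> 1" using t(1) by linarith
    have "\<bar>t\<bar> * (1 + 6 * (\<rho> / 2 + B)\<^sup>2) \<le> 1"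
      using t(4) by (subst (asm) pos_le_divide_eq) (auto intro: add_pos_nonneg)
    then show "\<bar>t\<bar> * (\<rho> / 2 + B)\<^sup>2 \<le> 1 / 6" unfolding ring_distribs by linarith
  qed
  have Qb: "\<bar>Q t \<omega> - 1\<bar> \<le> 1 / 2" if "\<bar>t\<bar> \<le> t0" "\<omega> \<in> S" for t \<omega>
  proof -
    have "t\<^sup>2 * \<bar>v \<omega>\<bar> \<le> t\<^sup>2 * V" using v(2)[OF that(2)] by (intro mult_left_mono) auto
    then show ?thesis using small(3)[OF that(1)] by (simp add: Q_def abs_mult)
  qed
  have exp3: "\<bar>exp x - 1 - x - x\<^sup>2 / 2\<bar> \<le> \<bar>x\<bar> ^ 3" if x1: "\<bar>x\<bar> \<le> 1" for x :: real
  proof -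
    obtain s where s: "\<bar>s\<bar> \<le> \<bar>x\<bar>" "exp x = (\<Sum>m<3. x ^ m / fact m) + exp s / fact 3 * x ^ 3"
      using Maclaurin_exp_le[of x 3] by auto
    have "exp s \<le> exp 1" using s(1) x1 by simp
    then have "exp s \<le> 3" using exp_le by linarith
    then have le: "exp s / 6 * \<bar>x\<bar> ^ 3 \<le> 1 * \<bar>x\<bar> ^ 3" by (intro mult_right_mono) auto
    have eq: "exp x - 1 - x - x\<^sup>2 / 2 = exp s / 6 * x ^ 3"
    proof -
      have "(\<Sum>m<3. x ^ m / fact m) = 1 + x + x\<^sup>2 / 2" by (simp add: numeral_3_eq_3 lessThan_Suc power2_eq_square)
      moreover have "fact 3 = (6::real)" by (simp add: fact_numeral)
      ultimately show ?thesis using s(2) by simp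
    qed
    show ?thesis unfolding eq abs_mult power_abs using le by simp
  qed
  define R where "R t \<omega> = exp (t * m \<omega>) * Q t \<omega> - (1 + t * m \<omega> + t\<^sup>2 / 2 * ((m \<omega>)\<^sup>2 + v \<omega>))" for t \<omega>
  have Rb: "\<bar>R t \<omega>\<bar> \<le> B0 * \<bar>t\<bar> ^ 3" if t: "\<bar>t\<bar> \<le> t0" and w: "\<omega> \<in> S" for t \<omega>
  proof -
    note sm = small[OF t]
    have tm: "\<bar>t * m \<omega>\<bar> \<le> \<bar>t\<bar> * U" unfolding abs_mult using m(2)[OF w] by (intro mult_left_mono) auto
    define r where "r = exp (t * m \<omega>) - 1 - t * m \<omega> - (t * m \<omega>)\<^sup>2 / 2"
    have "\<bar>r\<bar> \<le> \<bar>t * m \<omega>\<bar> ^ 3" unfolding r_def by (rule exp3) (use tm sm in linarith)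
    also have "\<dots> \<le> (\<bar>t\<bar> * U) ^ 3" by (rule power_mono[OF tm]) simp
    finally have r: "\<bar>r\<bar> \<le> \<bar>t\<bar> ^ 3 * U ^ 3" by (simp add: power_mult_distrib)
    have "R t \<omega> = r * Q t \<omega> + t ^ 3 * (m \<omega> * v \<omega> / 2) + t ^ 4 * ((m \<omega>)\<^sup>2 * v \<omega> / 4)"
      unfolding R_def r_def Q_def by (simp add: algebra_simps power2_eq_square power3_eq_cube power4_eq_xxxx)
    then have "\<bar>R t \<omega>\<bar> \<le> \<bar>r * Q t \<omega>\<bar> + \<bar>t ^ 3 * (m \<omega> * v \<omega> / 2)\<bar> + \<bar>t ^ 4 * ((m \<omega>)\<^sup>2 * v \<omega> / 4)\<bar>" by linarith
    moreover have "\<bar>r * Q t \<omega>\<bar> \<le> (\<bar>t\<bar> ^ 3 * U ^ 3) * 2"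
    proof -
      have "\<bar>Q t \<omega>\<bar> \<le> 2" using Qb[OF t w] by linarith
      then show ?thesis unfolding abs_mult using r by (intro mult_mono) auto
    qed
    moreover have mv: "\<bar>m \<omega> * v \<omega>\<bar> \<le> U * V" unfolding abs_mult using m v w by (intro mult_mono) auto
    have "\<bar>t ^ 3 * (m \<omega> * v \<omega> / 2)\<bar> \<le> \<bar>t\<bar> ^ 3 * (U * V / 2)"
      unfolding abs_mult power_abs using mv by (intro mult_left_mono) auto
    moreover have "\<bar>t ^ 4 * ((m \<omega>)\<^sup>2 * v \<omega> / 4)\<bar> \<le> \<bar>t\<bar> ^ 3 * (U * V / 4)"
    proof -
      have "\<bar>t ^ 4 * ((m \<omega>)\<^sup>2 * v \<omega> / 4)\<bar> = \<bar>t\<bar> ^ 3 * (\<bar>t * m \<omega>\<bar> * (\<bar>m \<omega> * v \<omega>\<bar> / 4))"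
        by (simp add: abs_mult power_abs power2_eq_square power3_eq_cube power4_eq_xxxx)
      also have "\<dots> \<le> \<bar>t\<bar> ^ 3 * (1 * (U * V / 4))"
        using tm sm mv by (intro mult_left_mono mult_mono) auto
      finally show ?thesis by simp
    qed
    ultimately have "\<bar>R t \<omega>\<bar> \<le> \<bar>t\<bar> ^ 3 * U ^ 3 * 2 + \<bar>t\<bar> ^ 3 * (U * V / 2) + \<bar>t\<bar> ^ 3 * (U * V / 4)" by linarith
    also have "\<dots> = \<bar>t\<bar> ^ 3 * (2 * U ^ 3 + 3 / 4 * (U * V))" by (simp add: algebra_simps)
    also have "\<dots> \<le> \<bar>t\<bar> ^ 3 * B0" unfolding B0_def using m(3) v(3) by (intro mult_left_mono) auto
    finally show ?thesis by (simp add: mult_ac)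
  qed
  have GQ: "\<bar>G (\<lambda>\<omega>. exp (t * m \<omega>) * Q t \<omega>) \<omega> - (Q t \<omega> + \<rho> * t\<^sup>2 / 2)\<bar> \<le> B0 * \<bar>t\<bar> ^ 3"
    if t: "\<bar>t\<bar> \<le> t0" and w: "\<omega> \<in> S" for t \<omega>
  proof -
    have "(\<lambda>\<omega>. exp (t * m \<omega>) * Q t \<omega>) = (\<lambda>\<omega>. 1 + (t * m \<omega> + (t\<^sup>2 / 2 * ((m \<omega>)\<^sup>2 + v \<omega>) + R t \<omega>)))"
      by (simp add: R_def)
    then have "G (\<lambda>\<omega>. exp (t * m \<omega>) * Q t \<omega>) \<omega> = G (\<lambda>_. 1) \<omega> + (t * G m \<omega> + (t\<^sup>2 / 2 * (G (\<lambda>\<omega>. (m \<omega>)\<^sup>2) \<omega> + G v \<omega>) + G (R t) \<omega>))"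
      by (simp only: transfer_add transfer_cmult)
    \<comment> \<open>The Poisson equation for the square of m replaces the conditional variance,
      which varies with the future, by the constant \<rho>.\<close>
    also have "G (\<lambda>\<omega>. (m \<omega>)\<^sup>2) \<omega> + G v \<omega> = v \<omega> + \<rho>" using v(1)[OF w] by linarith
    finally have "G (\<lambda>\<omega>. exp (t * m \<omega>) * Q t \<omega>) \<omega> - (Q t \<omega> + \<rho> * t\<^sup>2 / 2) = G (R t) \<omega>"
      using g_sum[OF w] m(1)[OF w] by (simp add: Q_def algebra_simps)
    moreover have "(G ^^ Suc 0) (R t) \<omega> \<le> B0 * \<bar>t\<bar> ^ 3" by (rule Gn_le[OF _ w]) (use Rb[OF t] in \<open>auto simp: abs_le_iff\<close>)
    moreover have "- (B0 * \<bar>t\<bar> ^ 3) \<le> (G ^^ Suc 0) (R t) \<omega>" by (rule Gn_ge[OF _ w]) (use Rb[OF t] in \<open>force simp: abs_le_iff\<close>)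
    ultimately show ?thesis by (simp add: abs_le_iff)
  qed
  \<comment> \<open>s = 1 and s = -1 give the exponents of the upper and the lower bound, with the
    cubic error added or removed.\<close>
  define y where "y s t = \<rho> * t\<^sup>2 / 2 + s * (B * \<bar>t\<bar> ^ 3)" for s t :: real
  have up: "G (\<lambda>\<omega>. exp (t * m \<omega>) * Q t \<omega>) \<omega> \<le> exp (y 1 t) * Q t \<omega>"
    and lo: "exp (y (-1) t) * Q t \<omega> \<le> G (\<lambda>\<omega>. exp (t * m \<omega>) * Q t \<omega>) \<omega>"
    if t: "\<bar>t\<bar> \<le> t0" and w: "\<omega> \<in> S" for t \<omega>
  proof -
    note sm = small[OF t] and qb = Qb[OF t w] and gq = GQ[OF t w]
    let ?c = "\<bar>t\<bar> ^ 3"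
    have q: "1 / 2 \<le> Q t \<omega>" "Q t \<omega> \<le> 3 / 2" using qb by linarith+
    have "Q t \<omega> * (\<rho> * t\<^sup>2 / 2) - \<rho> * t\<^sup>2 / 2 = \<bar>t\<bar> * ?c * (\<rho> * v \<omega> / 4)"
      by (simp add: Q_def field_simps power2_eq_square power3_eq_cube power4_eq_xxxx)
    also have "\<bar>\<dots>\<bar> = \<bar>t\<bar> * (?c * (\<rho> * \<bar>v \<omega>\<bar> / 4))" using rho by (simp add: abs_mult)
    also have "\<dots> \<le> 1 * (?c * (\<rho> * V / 4))"
      using sm(1) v(2)[OF w] rho by (intro mult_mono mult_left_mono divide_right_mono) auto
    finally have d: "\<bar>Q t \<omega> * (\<rho> * t\<^sup>2 / 2) - \<rho> * t\<^sup>2 / 2\<bar> \<le> ?c * (\<rho> * V) / 4" by simp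
    have Bc: "4 * (B0 * ?c) + ?c * (\<rho> * V) + ?c \<le> B * ?c"
      unfolding B_def by (simp add: algebra_simps)
    have nn: "0 \<le> B0 * ?c" "0 \<le> ?c * (\<rho> * V)" "0 \<le> ?c" using B0 rho v(3) by auto
    have "Q t \<omega> * (1 + y 1 t) \<le> Q t \<omega> * exp (y 1 t)" using q by (intro mult_left_mono) auto
    moreover have "1 / 2 * (B * ?c) \<le> Q t \<omega> * (B * ?c)" using q B by (intro mult_right_mono) auto
    moreover have "Q t \<omega> * (1 + y 1 t) = Q t \<omega> + Q t \<omega> * (\<rho> * t\<^sup>2 / 2) + Q t \<omega> * (B * ?c)"
      unfolding y_def by (simp add: algebra_simps)
    moreover have "exp (y 1 t) * Q t \<omega> = Q t \<omega> * exp (y 1 t)" by (rule mult.commute)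
    ultimately show "G (\<lambda>\<omega>. exp (t * m \<omega>) * Q t \<omega>) \<omega> \<le> exp (y 1 t) * Q t \<omega>"
      using gq d Bc nn unfolding abs_le_iff by linarith
    have yabs: "\<bar>y (-1) t\<bar> \<le> t\<^sup>2 * (\<rho> / 2 + B)"
    proof -
      have "?c = \<bar>t\<bar> * t\<^sup>2" by (simp add: power2_eq_square power3_eq_cube power4_eq_xxxx)
      also have "\<dots> \<le> 1 * t\<^sup>2" using sm(1) by (intro mult_right_mono) auto
      finally have "B * ?c \<le> B * t\<^sup>2" using B by simp
      moreover have "0 \<le> \<rho> * t\<^sup>2" "0 \<le> B * ?c" using rho B by auto
      moreover have "t\<^sup>2 * (\<rho> / 2 + B) = \<rho> * t\<^sup>2 / 2 + B * t\<^sup>2" by (simp add: algebra_simps)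
      ultimately show ?thesis unfolding y_def abs_le_iff by linarith
    qed
    have "(y (-1) t)\<^sup>2 \<le> (t\<^sup>2 * (\<rho> / 2 + B))\<^sup>2" using yabs rho B by (simp add: abs_le_square_iff[symmetric])
    also have "\<dots> = ?c * (\<bar>t\<bar> * (\<rho> / 2 + B)\<^sup>2)" by (simp add: power_mult_distrib power3_eq_cube power4_eq_xxxx)
    also have "\<dots> \<le> ?c * (1 / 6)" using sm(4) by (intro mult_left_mono) auto
    finally have y2: "(y (-1) t)\<^sup>2 \<le> ?c / 6" by simp
    have "y (-1) t \<le> 1"
    proof (rule power2_le_imp_le)
      have "?c \<le> 1" using sm(1) by (intro power_le_one) auto
      then show "(y (-1) t)\<^sup>2 \<le> 1\<^sup>2" using y2 by simp
    qed simp
    have e2: "exp (y (-1) t) \<le> 1 + y (-1) t + (y (-1) t)\<^sup>2"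
      by (rule exp_le_quadratic) fact
    have "Q t \<omega> * exp (y (-1) t) \<le> Q t \<omega> * (1 + y (-1) t + (y (-1) t)\<^sup>2)"
      using e2 q by (intro mult_left_mono) auto
    moreover have "Q t \<omega> * (y (-1) t)\<^sup>2 \<le> 3 / 2 * (?c / 6)" using q y2 by (intro mult_mono) auto
    moreover have "1 / 2 * (B * ?c) \<le> Q t \<omega> * (B * ?c)" using q B by (intro mult_right_mono) auto
    moreover have "Q t \<omega> * (1 + y (-1) t + (y (-1) t)\<^sup>2) = Q t \<omega> + Q t \<omega> * (\<rho> * t\<^sup>2 / 2) - Q t \<omega> * (B * ?c) + Q t \<omega> * (y (-1) t)\<^sup>2"
      unfolding y_def by (simp add: algebra_simps)
    moreover have "exp (y (-1) t) * Q t \<omega> = Q t \<omega> * exp (y (-1) t)" by (rule mult.commute)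
    ultimately show "exp (y (-1) t) * Q t \<omega> \<le> G (\<lambda>\<omega>. exp (t * m \<omega>) * Q t \<omega>) \<omega>"
      using gq d Bc nn unfolding abs_le_iff by linarith
  qed
  have eqn: "(G ^^ Suc n) (\<lambda>\<omega>. exp (t * birkhoff m (Suc n) \<omega>) * Q t \<omega>) \<omega>
      = (G ^^ n) (\<lambda>\<omega>. G (\<lambda>\<omega>. exp (t * m \<omega>) * Q t \<omega>) \<omega> * exp (t * birkhoff m n \<omega>)) \<omega>" for n t \<omega>
  proof -
    have "(\<lambda>\<omega>. exp (t * birkhoff m (Suc n) \<omega>) * Q t \<omega>) = (\<lambda>\<omega>. (exp (t * m \<omega>) * Q t \<omega>) * (\<lambda>\<omega>. exp (t * birkhoff m n \<omega>)) (shift \<omega>))"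
      by (simp add: birkhoff_Suc ring_distribs exp_add mult_ac)
    then show ?thesis unfolding funpow_Suc_right o_apply
      using transfer_mult_shift[of K g "\<lambda>\<omega>. exp (t * m \<omega>) * Q t \<omega>" "\<lambda>\<omega>. exp (t * birkhoff m n \<omega>)"] by (simp only:)
  qed
  have UP: "(G ^^ n) (\<lambda>\<omega>. exp (t * birkhoff m n \<omega>) * Q t \<omega>) \<omega> \<le> exp (y 1 t) ^ n * Q t \<omega>"
    if t: "\<bar>t\<bar> \<le> t0" and w: "\<omega> \<in> S" for n t \<omega>
    using w
  proof (induction n arbitrary: \<omega>)
    case (Suc n)
    have "(G ^^ Suc n) (\<lambda>\<omega>. exp (t * birkhoff m (Suc n) \<omega>) * Q t \<omega>) \<omega>
       \<le> (G ^^ n) (\<lambda>\<omega>. exp (y 1 t) * (exp (t * birkhoff m n \<omega>) * Q t \<omega>)) \<omega>"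
      unfolding eqn
    proof (rule transfer_funpow_mono[OF g_nonneg _ Suc.prems])
      fix \<eta> assume e: "\<eta> \<in> S"
      show "G (\<lambda>\<omega>. exp (t * m \<omega>) * Q t \<omega>) \<eta> * exp (t * birkhoff m n \<eta>) \<le> exp (y 1 t) * (exp (t * birkhoff m n \<eta>) * Q t \<eta>)"
        using mult_right_mono[OF up[OF t e], of "exp (t * birkhoff m n \<eta>)"] by (simp add: mult_ac)
    qed
    also have "\<dots> \<le> exp (y 1 t) * (exp (y 1 t) ^ n * Q t \<omega>)"
      unfolding transfer_funpow_cmult by (intro mult_left_mono Suc) auto
    finally show ?case by (simp add: mult.assoc)
  qed (simp add: birkhoff_def)
  have LO: "exp (y (-1) t) ^ n * Q t \<omega> \<le> (G ^^ n) (\<lambda>\<omega>. exp (t * birkhoff m n \<omega>) * Q t \<omega>) \<omega>"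
    if t: "\<bar>t\<bar> \<le> t0" and w: "\<omega> \<in> S" for n t \<omega>
    using w
  proof (induction n arbitrary: \<omega>)
    case (Suc n)
    have "exp (y (-1) t) * (exp (y (-1) t) ^ n * Q t \<omega>) \<le> (G ^^ n) (\<lambda>\<omega>. exp (y (-1) t) * (exp (t * birkhoff m n \<omega>) * Q t \<omega>)) \<omega>"
      unfolding transfer_funpow_cmult by (intro mult_left_mono Suc) auto
    also have "\<dots> \<le> (G ^^ Suc n) (\<lambda>\<omega>. exp (t * birkhoff m (Suc n) \<omega>) * Q t \<omega>) \<omega>"
      unfolding eqn
    proof (rule transfer_funpow_mono[OF g_nonneg _ Suc.prems])
      fix \<eta> assume e: "\<eta> \<in> S"
      show "exp (y (-1) t) * (exp (t * birkhoff m n \<eta>) * Q t \<eta>) \<le> G (\<lambda>\<omega>. exp (t * m \<omega>) * Q t \<omega>) \<eta> * exp (t * birkhoff m n \<eta>)"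
        using mult_right_mono[OF lo[OF t e], of "exp (t * birkhoff m n \<eta>)"] by (simp add: mult_ac)
    qed
    finally show ?case by (simp add: mult.assoc)
  qed (simp add: birkhoff_def)
  have pw: "exp (y s t) ^ n = exp (n * (\<rho> * t\<^sup>2 / 2 + s * B * \<bar>t\<bar> ^ 3))" for s t n
    by (simp add: y_def exp_of_nat_mult[symmetric] mult.assoc)
  show ?thesis
  proof (rule that[of B t0])
    fix n t \<omega> assume w: "\<omega> \<in> S" and t: "\<bar>t\<bar> \<le> t0"
    let ?E = "(G ^^ n) (\<lambda>\<omega>. exp (t * birkhoff m n \<omega>)) \<omega>"
    \<comment> \<open>Q enters once under the iterate and once outside it; the ratio of its bounds
      3/2 and 1/2 is the factor 3 of the conclusion.\<close>
    have q: "1 / 2 \<le> Q t \<omega>" "Q t \<omega> \<le> 3 / 2" if "\<omega> \<in> S" for \<omega> using Qb[OF t that] by linarith+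
    have "1 / 2 * ?E = (G ^^ n) (\<lambda>\<omega>. 1 / 2 * exp (t * birkhoff m n \<omega>)) \<omega>" by (simp only: transfer_funpow_cmult)
    also have "\<dots> \<le> (G ^^ n) (\<lambda>\<omega>. exp (t * birkhoff m n \<omega>) * Q t \<omega>) \<omega>"
      using q by (intro transfer_funpow_mono[OF g_nonneg _ w]) (auto simp: field_simps)
    also have "\<dots> \<le> exp (y 1 t) ^ n * Q t \<omega>" by (rule UP[OF t w])
    also have "\<dots> \<le> exp (y 1 t) ^ n * (3 / 2)" using q[OF w] by (intro mult_left_mono) auto
    finally show "?E \<le> 3 * exp (n * (\<rho> * t\<^sup>2 / 2 + B * \<bar>t\<bar> ^ 3))" unfolding pw by simp
    have "exp (y (-1) t) ^ n * (1 / 2) \<le> exp (y (-1) t) ^ n * Q t \<omega>" using q[OF w] by (intro mult_left_mono) auto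
    also have "\<dots> \<le> (G ^^ n) (\<lambda>\<omega>. exp (t * birkhoff m n \<omega>) * Q t \<omega>) \<omega>" by (rule LO[OF t w])
    also have "\<dots> \<le> (G ^^ n) (\<lambda>\<omega>. 3 / 2 * exp (t * birkhoff m n \<omega>)) \<omega>"
      using q by (intro transfer_funpow_mono[OF g_nonneg _ w]) (auto simp: field_simps)
    also have "\<dots> = 3 / 2 * ?E" by (simp only: transfer_funpow_cmult)
    finally show "exp (n * (\<rho> * t\<^sup>2 / 2 - B * \<bar>t\<bar> ^ 3)) / 3 \<le> ?E" unfolding pw by simp
  qed (use B t0 in auto)
qed

end

section \<open>Invariance of the Gibbs measure under the normalized operator\<close>

locale gibbs_normalized = gibbs K \<alpha> \<mu> f P C + normalized K \<alpha> g b
  for K \<alpha> \<mu> f P C g b +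
  fixes A0 :: real
  assumes A0_pos: "0 < A0"
    and dominated: "\<And>n \<phi> \<omega>. (\<And>\<omega>. \<omega> \<in> S \<Longrightarrow> 0 \<le> \<phi> \<omega>) \<Longrightarrow> \<omega> \<in> S \<Longrightarrow>
        (transfer K q ^^ n) \<phi> \<omega> \<le> A0 * (transfer K g ^^ n) \<phi> \<omega>"
begin

text \<open>The Gibbs bounds transfer a variance estimate of order \<open>n\<close> from \<open>G\<close> to \<open>\<mu>\<close>; with
  invariance this forces \<open>\<mu>\<close> to have the same means as the limit functional of \<open>G\<close>.\<close>
lemma integral_eq_poisson_constant:
  assumes h: "hoelder \<phi>" "hoelder u" and eq: "\<And>\<omega>. \<omega> \<in> S \<Longrightarrow> G \<phi> \<omega> - c + G u \<omega> = u \<omega>"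
  shows "(\<integral>\<omega>. \<phi> \<omega> \<partial>\<mu>) = c"
proof -
  define m where "m = (\<lambda>\<omega>. \<phi> \<omega> - c + u \<omega> - u (shift \<omega>))"
  have Gm: "G m \<omega> = 0" if "\<omega> \<in> S" for \<omega>
    unfolding m_def using that eq[OF that] G_shift[OF that] G_const[OF that] by (simp add: transfer_add transfer_diff)
  have hm: "hoelder m" unfolding m_def
    by (rule hoelder_diff[OF hoelder_add[OF hoelder_diff[OF h(1) hoelder_const] h(2)] hoelder_shift[OF h(2)]])
  obtain U where U: "0 < U" "\<And>\<omega>. \<omega> \<in> S \<Longrightarrow> \<bar>m \<omega>\<bar> \<le> U" by (rule hoelder_bounded[OF hm]) blast
  obtain V where V: "0 < V" "\<And>\<omega>. \<omega> \<in> S \<Longrightarrow> \<bar>u \<omega>\<bar> \<le> V" by (rule hoelder_bounded[OF h(2)]) blast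
  obtain B where B: "0 < B" "\<And>n \<omega> \<eta>. \<omega> \<in> S \<Longrightarrow> \<eta> \<in> S \<Longrightarrow> agree n \<omega> \<eta> \<Longrightarrow> \<bar>birkhoff \<phi> n \<omega> - birkhoff \<phi> n \<eta>\<bar> \<le> B"
    by (rule birkhoff_distortion[OF h(1)]) blast
  define F where "F n \<omega> = (birkhoff \<phi> n \<omega> - n * c)\<^sup>2" for n \<omega>
  let ?o = "\<lambda>_::nat. 1::nat"
  have sq: "(x + y)\<^sup>2 \<le> 2 * x\<^sup>2 + 2 * y\<^sup>2" for x y :: real
    using sum_squares_bound[of x y] by (simp add: power2_sum)
  have hF: "hoelder (F n)" for n unfolding F_def by (intro hoelder_power hoelder_diff hoelder_birkhoff h hoelder_const)
  have bound: "(\<integral>\<omega>. F n \<omega> \<partial>\<mu>) \<le> 2 * C * A0 * (2 * (n * U\<^sup>2) + 8 * V\<^sup>2) + 2 * B\<^sup>2" for n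
  proof -
    \<comment> \<open>Replacing a sequence by its prefix continued with the base point costs a
      bounded amount by distortion, and turns the integral into a finite sum over words.\<close>
    have "(\<integral>\<omega>. F n \<omega> \<partial>\<mu>) \<le> (\<integral>\<omega>. 2 * F n (prepend (prefix_of n \<omega>) ?o) + 2 * B\<^sup>2 \<partial>\<mu>)"
    proof (rule integral_mono[OF hoelder_integrable[OF hF]])
      show "integrable \<mu> (\<lambda>\<omega>. 2 * F n (prepend (prefix_of n \<omega>) ?o) + 2 * B\<^sup>2)"
        by (rule integrable_prefix)
      fix \<omega> assume "\<omega> \<in> space \<mu>"
      then have w: "\<omega> \<in> S" by (simp add: space_mu)
      let ?e = "prepend (prefix_of n \<omega>) ?o"
      have "\<bar>birkhoff \<phi> n \<omega> - birkhoff \<phi> n ?e\<bar> \<le> B"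
        by (rule B(2)[OF w _ agree_prepend_prefix_of]) (use prepend_Sigma_K[OF prefix_of_words[OF w] base_point] in blast)
      then have "(birkhoff \<phi> n \<omega> - birkhoff \<phi> n ?e)\<^sup>2 \<le> B\<^sup>2" using B(1) by (simp add: abs_le_square_iff[symmetric])
      then show "F n \<omega> \<le> 2 * F n ?e + 2 * B\<^sup>2"
        using sq[of "birkhoff \<phi> n ?e - n * c" "birkhoff \<phi> n \<omega> - birkhoff \<phi> n ?e"] by (simp add: F_def)
    qed
    also have "\<dots> = (\<Sum>w\<in>words K n. (2 * F n (prepend w ?o) + 2 * B\<^sup>2) * prob (cylinder K w))"
      by (rule integral_prefix)
    also have "\<dots> = 2 * (\<Sum>w\<in>words K n. prob (cylinder K w) * F n (prepend w ?o)) + 2 * B\<^sup>2"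
    proof -
      have "(\<Sum>w\<in>words K n. 2 * B\<^sup>2 * prob (cylinder K w)) = 2 * B\<^sup>2"
        unfolding sum_distrib_left[symmetric] sum_cylinders by simp
      then show ?thesis by (simp add: ring_distribs sum.distrib sum_distrib_left mult_ac)
    qed
    \<comment> \<open>The Gibbs upper bound makes the sum an iterate of the operator with weight q
      at the base point; domination then passes to \<open>G\<close>, where the martingale square is
      at most linear in n.\<close>
    also have "(\<Sum>w\<in>words K n. prob (cylinder K w) * F n (prepend w ?o))
        \<le> (\<Sum>w\<in>words K n. C * exp (- real n * P + birkhoff f n (prepend w ?o)) * F n (prepend w ?o))"
    proof (intro sum_mono mult_right_mono)
      fix w assume w: "w \<in> words K n"
      show "prob (cylinder K w) \<le> C * exp (- real n * P + birkhoff f n (prepend w ?o))"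
        using gibbs_upper[OF prepend_Sigma_K[OF w base_point], of n] prefix_of_prepend[of w n] w by (simp add: words_def)
    qed (simp add: F_def)
    also have "\<dots> = C * (transfer K q ^^ n) (F n) ?o"
      unfolding transfer_funpow_words prod_q by (simp add: sum_distrib_left mult.assoc)
    also have "\<dots> \<le> C * (A0 * (G ^^ n) (F n) ?o)"
      using C_gt by (intro mult_left_mono dominated base_point) (auto simp: F_def)
    also have "(G ^^ n) (F n) ?o \<le> (G ^^ n) (\<lambda>\<omega>. 2 * (birkhoff m n \<omega>)\<^sup>2 + 8 * V\<^sup>2) ?o"
    proof (rule transfer_funpow_mono[OF g_nonneg _ base_point])
      fix \<omega> assume w: "\<omega> \<in> S"
      let ?d = "u ((shift ^^ n) \<omega>) - u \<omega>"
      have "\<bar>?d\<bar> \<le> 2 * V" using V(2)[OF w] V(2)[OF Sigma_K_shift_funpow[OF w, of n]] by linarith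
      then have "?d\<^sup>2 \<le> (2 * V)\<^sup>2" using V(1) by (subst abs_le_square_iff[symmetric]) simp
      moreover have "birkhoff \<phi> n \<omega> - n * c = birkhoff m n \<omega> + ?d" unfolding m_def birkhoff_coboundary by simp
      ultimately show "F n \<omega> \<le> 2 * (birkhoff m n \<omega>)\<^sup>2 + 8 * V\<^sup>2"
        using sq[of "birkhoff m n \<omega>" ?d] by (simp add: F_def power_mult_distrib)
    qed
    also have "\<dots> = 2 * (G ^^ n) (\<lambda>\<omega>. (birkhoff m n \<omega>)\<^sup>2) ?o + 8 * V\<^sup>2"
      using Gn_const[OF base_point, of n] by (simp add: transfer_funpow_add transfer_funpow_cmult)
    also have "\<dots> \<le> 2 * (n * U\<^sup>2) + 8 * V\<^sup>2"
      using Gn_martingale_square[OF base_point Gm U(2), of n] by simp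
    finally show ?thesis using C_gt A0_pos by (simp add: mult_ac)
  qed
  let ?I = "\<integral>\<omega>. \<phi> \<omega> \<partial>\<mu>"
  \<comment> \<open>If the mean differed from c, the same integral would grow quadratically in n,
    against the linear bound above.\<close>
  have jensen: "(n * (?I - c))\<^sup>2 \<le> (\<integral>\<omega>. F n \<omega> \<partial>\<mu>)" for n :: nat
  proof -
    let ?X = "\<lambda>\<omega>. birkhoff \<phi> n \<omega> - n * c"
    have hX: "hoelder ?X" by (intro hoelder_diff hoelder_birkhoff h hoelder_const)
    have E: "expectation ?X = n * (?I - c)"
      unfolding right_diff_distrib by (subst Bochner_Integration.integral_diff) (auto intro!: hoelder_integrable h hoelder_birkhoff simp: integral_birkhoff h prob_space)
    have "0 \<le> variance ?X" by (rule variance_positive)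
    moreover have "variance ?X = expectation (\<lambda>\<omega>. (?X \<omega>)\<^sup>2) - (expectation ?X)\<^sup>2"
      by (rule variance_eq) (intro hoelder_integrable hoelder_power hX)+
    ultimately have "(expectation ?X)\<^sup>2 \<le> expectation (\<lambda>\<omega>. (?X \<omega>)\<^sup>2)" by linarith
    then show ?thesis unfolding E by (simp add: F_def[abs_def])
  qed
  define a1 where "a1 = 4 * C * A0 * U\<^sup>2"
  define a2 where "a2 = 16 * C * A0 * V\<^sup>2 + 2 * B\<^sup>2"
  have "(?I - c)\<^sup>2 \<le> a1 / n + a2 / n ^ 2" if "0 < n" for n :: nat
  proof -
    have "n\<^sup>2 * (?I - c)\<^sup>2 \<le> a1 * n + a2"
    proof -
      have "n\<^sup>2 * (?I - c)\<^sup>2 = (n * (?I - c))\<^sup>2" by (simp add: power_mult_distrib)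
      moreover have "2 * C * A0 * (2 * (n * U\<^sup>2) + 8 * V\<^sup>2) + 2 * B\<^sup>2 = a1 * n + a2"
        by (simp add: a1_def a2_def algebra_simps)
      ultimately show ?thesis using order_trans[OF jensen[of n] bound[of n]] by linarith
    qed
    then show ?thesis using that by (simp add: field_simps power2_eq_square)
  qed
  moreover have "(\<lambda>n::nat. a1 / n + a2 / n ^ 2) \<longlonglongrightarrow> 0" by real_asymp
  ultimately have "(?I - c)\<^sup>2 \<le> 0"
    by (intro LIMSEQ_le_const[where x = 0]) (auto intro!: exI[of _ "Suc 0"])
  then show ?thesis by simp
qed

text \<open>If u solves the Poisson equation for \<phi>, then \<open>G u\<close> solves it for
  \<open>G \<phi>\<close> with the same constant, and that constant is the integral in both
  cases.\<close>

lemma integral_G: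
  assumes "hoelder \<phi>" shows "(\<integral>\<omega>. G \<phi> \<omega> \<partial>\<mu>) = (\<integral>\<omega>. \<phi> \<omega> \<partial>\<mu>)"
proof -
  obtain c u where u: "hoelder u" "\<And>\<omega>. \<omega> \<in> S \<Longrightarrow> G \<phi> \<omega> - c + G u \<omega> = u \<omega>"
    by (rule poisson_equation[OF assms]) blast
  have "G (G \<phi>) \<omega> - c + G (G u) \<omega> = G u \<omega>" if w: "\<omega> \<in> S" for \<omega>
  proof -
    have "G (\<lambda>\<omega>. G \<phi> \<omega> - c + G u \<omega>) \<omega> = G u \<omega>" by (rule transfer_cong[OF u(2) w])
    then show ?thesis using G_const[OF w] by (simp add: transfer_add transfer_diff)
  qed
  then have "(\<integral>\<omega>. G \<phi> \<omega> \<partial>\<mu>) = c" by (intro integral_eq_poisson_constant[of _ "G u"] hoelder_G assms u(1))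
  then show ?thesis using integral_eq_poisson_constant[OF assms u] by simp
qed

lemma integral_Gn: "hoelder \<phi> \<Longrightarrow> (\<integral>\<omega>. (G ^^ n) \<phi> \<omega> \<partial>\<mu>) = (\<integral>\<omega>. \<phi> \<omega> \<partial>\<mu>)"
  by (induction n) (auto simp: integral_G hoelder_Gn)

end

context symbolic begin

text \<open>Makes functions of finitely many symbols, indicators of block events included, available
  to the operator identities stated for Hoelder functions.\<close>

lemma hoelder_prefix: "hoelder (\<lambda>\<omega>. F (prefix_of n \<omega>))"
proof -
  define M where "M = Max ((\<lambda>w. \<bar>F w\<bar>) ` words K n)"
  have M: "\<bar>F (prefix_of n \<omega>)\<bar> \<le> M" if "\<omega> \<in> S" for \<omega>
    unfolding M_def using that by (intro Max_ge) auto
  have M0: "0 \<le> M" using M[OF base_point] by linarith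
  show ?thesis
  proof (rule hoelderI[of "2 * M / \<alpha> ^ n"])
    fix \<omega> \<eta> j assume H: "\<omega> \<in> S" "\<eta> \<in> S" "agree j \<omega> \<eta>"
    show "\<bar>F (prefix_of n \<omega>) - F (prefix_of n \<eta>)\<bar> \<le> 2 * M / \<alpha> ^ n * \<alpha> ^ j"
    proof (cases "n \<le> j")
      case True
      then have "prefix_of n \<omega> = prefix_of n \<eta>" using H(3) by (auto simp: prefix_of_eq_iff agree_def)
      then show ?thesis using M0 alpha_power by (simp add: less_imp_le)
    next
      case False
      have "\<bar>F (prefix_of n \<omega>) - F (prefix_of n \<eta>)\<bar> \<le> 2 * M" using M[OF H(1)] M[OF H(2)] by linarith
      also have "2 * M * \<alpha> ^ n \<le> 2 * M * \<alpha> ^ j" using False alpha M0 by (intro mult_left_mono power_decreasing) auto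
      then have "2 * M \<le> 2 * M / \<alpha> ^ n * \<alpha> ^ j" using alpha_power(1)[of n] by (simp add: field_simps)
      finally show ?thesis .
    qed
  qed (use M0 alpha_power in auto)
qed

end

section \<open>Entropy and the size of cylinders\<close>

context gibbs begin

text \<open>The value the entropy takes by the equality case of the variational principle;
  \<open>entropy_eq\<close> confirms it.\<close>

definition h where "h = P - (\<integral>\<omega>. f \<omega> \<partial>\<mu>)"

text \<open>Log-measure centred by the entropy, large for unusually heavy cylinders. Up to
  \<open>ln C\<close> it is the centred Birkhoff sum, but it depends only on the word.\<close>

definition info where "info w = ln (prob (cylinder K w)) + length w * h"

lemma ln_cylinder:
  assumes "\<omega> \<in> S"
  shows "\<bar>ln (prob (cylinder K (prefix_of n \<omega>))) - (birkhoff f n \<omega> - n * P)\<bar> \<le> ln C"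
proof -
  let ?p = "prob (cylinder K (prefix_of n \<omega>))" and ?e = "exp (- real n * P + birkhoff f n \<omega>)"
  have p: "0 < ?p" using cylinder_pos assms by blast
  have "ln ?p \<le> ln (C * ?e)" using gibbs_upper[OF assms, of n] p by (subst ln_le_cancel_iff) (use C_gt in auto)
  then have 1: "ln ?p \<le> ln C + (- real n * P + birkhoff f n \<omega>)" using C_gt by (simp add: ln_mult)
  have "ln (?e / C) \<le> ln ?p" using gibbs_lower[OF assms, of n] p by (subst ln_le_cancel_iff) (use C_gt in auto)
  then have 2: "(- real n * P + birkhoff f n \<omega>) - ln C \<le> ln ?p" using C_gt by (simp add: ln_div)
  show ?thesis using 1 2 by (auto simp: abs_le_iff)
qed

lemma info_birkhoff:
  assumes "\<omega> \<in> S"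
  shows "\<bar>info (prefix_of n \<omega>) - (birkhoff f n \<omega> - n * (\<integral>\<omega>. f \<omega> \<partial>\<mu>))\<bar> \<le> ln C"
  using ln_cylinder[OF assms, of n] by (simp add: info_def h_def algebra_simps)

lemma integral_ln_cylinder:
  "\<bar>(\<Sum>w\<in>words K n. prob (cylinder K w) * ln (prob (cylinder K w))) + n * h\<bar> \<le> ln C"
proof -
  let ?F = "\<lambda>\<omega>. ln (prob (cylinder K (prefix_of n \<omega>)))"
  have "(\<Sum>w\<in>words K n. prob (cylinder K w) * ln (prob (cylinder K w))) = (\<integral>\<omega>. ?F \<omega> \<partial>\<mu>)"
    by (subst integral_prefix) (simp add: mult.commute)
  moreover have "(\<integral>\<omega>. birkhoff f n \<omega> - n * P \<partial>\<mu>) = - (n * h)"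
    by (subst Bochner_Integration.integral_diff)
       (auto intro!: hoelder_integrable f_hoelder simp: integral_birkhoff f_hoelder prob_space h_def algebra_simps)
  moreover have "\<bar>(\<integral>\<omega>. ?F \<omega> \<partial>\<mu>) - (\<integral>\<omega>. birkhoff f n \<omega> - n * P \<partial>\<mu>)\<bar> \<le> ln C"
  proof -
    have i: "integrable \<mu> ?F" "integrable \<mu> (\<lambda>\<omega>. birkhoff f n \<omega> - n * P)"
      by (rule integrable_prefix) (intro hoelder_integrable hoelder_diff hoelder_birkhoff f_hoelder hoelder_const)
    have "\<bar>\<integral>\<omega>. ?F \<omega> - (birkhoff f n \<omega> - n * P) \<partial>\<mu>\<bar> \<le> (\<integral>\<omega>. \<bar>?F \<omega> - (birkhoff f n \<omega> - n * P)\<bar> \<partial>\<mu>)"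
      by (rule integral_abs_bound)
    also have "\<dots> \<le> (\<integral>\<omega>. ln C \<partial>\<mu>)"
      by (intro integral_mono integrable_abs Bochner_Integration.integrable_diff i) (auto simp: space_mu ln_cylinder)
    finally show ?thesis using Bochner_Integration.integral_diff[OF i] by (simp add: prob_space)
  qed
  ultimately show ?thesis by linarith
qed

lemma entropy_eq: "Defs.entropy K \<mu> = h"
  unfolding Defs.entropy_def
proof (rule limI)
  let ?s = "\<lambda>n. (\<Sum>w\<in>words K n. prob (cylinder K w) * ln (prob (cylinder K w)))"
  have "(\<lambda>n. - ?s n / real n - h) \<longlonglongrightarrow> 0"
  proof (rule Lim_null_comparison)
    show "(\<lambda>n. ln C / real n) \<longlonglongrightarrow> 0" by real_asymp
    show "\<forall>\<^sub>F n in sequentially. norm (- ?s n / real n - h) \<le> ln C / real n"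
      using eventually_gt_at_top[of 0]
    proof eventually_elim
      case (elim n)
      then have "- ?s n / real n - h = - (?s n + n * h) / real n" by (simp add: field_simps)
      then show ?case using integral_ln_cylinder[of n] by (simp add: divide_right_mono)
    qed
  qed
  then show "(\<lambda>n. - ?s n / real n) \<longlonglongrightarrow> h" by (simp add: LIM_zero_iff)
qed

text \<open>With two symbols available, a competing continuation of w takes at least the proportion
  c of its mass, by the quasi-Bernoulli property; each further symbol thus loses a factor 1 -
  c.\<close>

lemma cylinder_decay:
  assumes "2 \<le> K"
  obtains \<theta> where "0 < \<theta>" "\<theta> < 1" "\<And>n w. w \<in> words K n \<Longrightarrow> prob (cylinder K w) \<le> \<theta> ^ n"
proof -
  have sing: "[i] \<in> words K (Suc 0)" if "i \<in> {1..K}" for i using that by (auto simp: words_def)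
  define c where "c = Min ((\<lambda>i. prob (cylinder K [i])) ` {1..K}) / C ^ 3"
  have c: "0 < c" unfolding c_def using C_gt assms cylinder_pos[OF sing] by (subst zero_less_divide_iff) auto
  have ci: "c \<le> prob (cylinder K [i]) / C ^ 3" if "i \<in> {1..K}" for i
    unfolding c_def using that C_gt by (intro divide_right_mono Min_le) auto
  have step: "prob (cylinder K (w @ [i])) \<le> prob (cylinder K w) * (1 - c)"
    if w: "w \<in> words K n" and i: "i \<in> {1..K}" for w n i
  proof -
    obtain j where j: "j \<in> {1..K}" "j \<noteq> i"
    proof (cases "i = 1")
      case True then show ?thesis using that[of 2] assms by auto
    next
      case False then show ?thesis using that[of 1] assms by auto
    qed
    have sub: "cylinder K (w @ [k]) \<subseteq> cylinder K w" for k
      by (auto simp: cylinder_def nth_append less_Suc_eq)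
    have "cylinder K (w @ [i]) \<inter> cylinder K (w @ [j]) = {}"
      using j(2) by (auto simp: cylinder_def nth_append dest!: spec[of _ "length w"])
    then have "prob (cylinder K (w @ [i])) + prob (cylinder K (w @ [j])) = prob (cylinder K (w @ [i]) \<union> cylinder K (w @ [j]))"
      by (simp add: finite_measure_Union)
    also have "\<dots> \<le> prob (cylinder K w)" using sub by (intro finite_measure_mono) auto
    finally have 1: "prob (cylinder K (w @ [i])) + prob (cylinder K (w @ [j])) \<le> prob (cylinder K w)" .
    have "prob (cylinder K w) * c \<le> prob (cylinder K w) * (prob (cylinder K [j]) / C ^ 3)"
      by (intro mult_left_mono ci j) auto
    also have "\<dots> \<le> prob (cylinder K (w @ [j]))" using quasi_bernoulli(1)[OF w sing[OF j(1)]] by simp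
    finally show ?thesis using 1 by (simp add: algebra_simps)
  qed
  \<comment> \<open>The maximum with 1/2 keeps \<theta> positive, so that its logarithm can be
    taken.\<close>
  define \<theta> where "\<theta> = max (1 - c) (1 / 2)"
  have th: "0 < \<theta>" "\<theta> < 1" "1 - c \<le> \<theta>" using c by (auto simp: \<theta>_def)
  have "prob (cylinder K w) \<le> \<theta> ^ n" if "w \<in> words K n" for w n
    using that
  proof (induction n arbitrary: w)
    case (Suc n)
    then obtain v i where w: "w = v @ [i]" by (cases w rule: rev_cases) (auto simp: words_def)
    then have v: "v \<in> words K n" "i \<in> {1..K}" using Suc.prems by (auto simp: words_def)
    have "prob (cylinder K w) \<le> prob (cylinder K v) * (1 - c)" unfolding w by (rule step[OF v])
    also have "\<dots> \<le> prob (cylinder K v) * \<theta>" by (intro mult_left_mono th) simp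
    also have "\<dots> \<le> \<theta> ^ n * \<theta>" using Suc.IH[OF v(1)] th by (intro mult_right_mono) auto
    finally show ?case by (simp add: mult.commute)
  qed (simp add: prob_le_1)
  then show ?thesis using that th by blast
qed

text \<open>Averaging the exponential decay of cylinders bounds n h from below by - n ln \<theta> up
  to the fixed error \<open>ln C\<close>, which disappears after division by n.\<close>

lemma h_pos:
  assumes "2 \<le> K" shows "0 < h"
proof -
  obtain \<theta> where t: "0 < \<theta>" "\<theta> < 1" "\<And>n w. w \<in> words K n \<Longrightarrow> prob (cylinder K w) \<le> \<theta> ^ n"
    by (rule cylinder_decay[OF assms]) blast
  have "- ln \<theta> \<le> h + ln C / n" if "0 < n" for n :: nat
  proof -
    have "(\<Sum>w\<in>words K n. prob (cylinder K w) * ln (prob (cylinder K w))) \<le> (\<Sum>w\<in>words K n. prob (cylinder K w) * (n * ln \<theta>))"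
    proof (intro sum_mono mult_left_mono)
      fix w assume w: "w \<in> words K n"
      have "ln (prob (cylinder K w)) \<le> ln (\<theta> ^ n)" using t w cylinder_pos by (subst ln_le_cancel_iff) auto
      then show "ln (prob (cylinder K w)) \<le> n * ln \<theta>" using t by (simp add: ln_realpow)
    qed simp
    also have "\<dots> = n * ln \<theta>" by (simp add: sum_cylinders flip: sum_distrib_right)
    finally have "n * (- ln \<theta>) \<le> n * h + ln C" using integral_ln_cylinder[of n] by (auto simp: abs_le_iff)
    then show ?thesis using that by (simp add: field_simps)
  qed
  moreover have "(\<lambda>n::nat. ln C / n) \<longlonglongrightarrow> 0" by real_asymp
  from tendsto_add[OF tendsto_const[of h] this] have "(\<lambda>n::nat. h + ln C / n) \<longlonglongrightarrow> h" by simp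
  ultimately have "- ln \<theta> \<le> h" by (intro LIMSEQ_le_const) (auto intro!: exI[of _ "Suc 0"])
  moreover have "ln \<theta> < 0" using t by simp
  ultimately show ?thesis by linarith
qed

end

text \<open>For K \<le> 1 the sequence space has at most one point, so f is constant on it and the
  zero function serves as transfer function.\<close>

lemma not_cohomologous_imp_K_ge_2:
  assumes "\<not> cohomologous_to_constant K f" shows "2 \<le> K"
proof (rule ccontr)
  assume "\<not> 2 \<le> K"
  have eq: "\<omega> = (\<lambda>_. 1)" if "\<omega> \<in> Sigma_K K" for \<omega>
  proof
    fix n
    have "1 \<le> \<omega> n" "\<omega> n \<le> K" using that by (auto simp: Sigma_K_def)
    then show "\<omega> n = 1" using \<open>\<not> 2 \<le> K\<close> by linarith
  qed
  have "cohomologous_to_constant K f"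
    unfolding cohomologous_to_constant_def
  proof (rule exI[of _ "\<lambda>_. 0"], rule exI[of _ "f (\<lambda>_. 1)"], intro conjI ballI)
    show "continuous_on (Sigma_K K) (\<lambda>_. 0 :: real)" by (rule continuous_on_const)
    fix \<omega> assume "\<omega> \<in> Sigma_K K"
    from arg_cong[OF eq[OF this], of f] show "f \<omega> = 0 - 0 + f (\<lambda>_. 1)" unfolding diff_self add_0 .
  qed
  then show False using assms by simp
qed

lemma open_agree: "open {\<eta>. agree n \<omega> \<eta>}"
proof -
  have "{\<eta>. agree n \<omega> \<eta>} = (\<Inter>k\<in>{..<n}. (\<lambda>\<eta>. \<eta> k) -` {\<omega> k})" by (auto simp: agree_def)
  also have "open \<dots>"
    by (intro open_INT finite_lessThan ballI open_vimage continuous_on_product_coordinates Topological_Spaces.open_discrete)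
  finally show ?thesis .
qed

text \<open>Cohomology to a constant asks for a continuous function in the product topology, whereas
  the Poisson equation yields a Hoelder one.\<close>

lemma (in symbolic) hoelder_continuous_on:
  assumes "hoelder \<phi>" shows "continuous_on (S) \<phi>"
proof -
  obtain B where "hoelder_with B \<phi>" using assms(1) unfolding hoelder_def by blast
  note B = hoelder_withD[OF this]
  show ?thesis unfolding continuous_on_def
  proof (intro ballI tendstoI)
    fix \<omega> and e :: real assume w: "\<omega> \<in> S" and e: "0 < e"
    have lim: "(\<lambda>n. B * \<alpha> ^ n) \<longlonglongrightarrow> 0" using alpha by (intro tendsto_mult_right_zero LIMSEQ_power_zero) auto
    obtain n where n: "B * \<alpha> ^ n < e" using eventually_happens[OF order_tendstoD(2)[OF lim e]] by auto
    have "\<forall>\<^sub>F \<eta> in at \<omega> within S. \<eta> \<in> {\<eta>. agree n \<omega> \<eta>} \<and> \<eta> \<in> S"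
      by (intro eventually_conj topological_tendstoD[OF tendsto_ident_at open_agree]) (auto simp: eventually_at_filter)
    then show "\<forall>\<^sub>F \<eta> in at \<omega> within S. dist (\<phi> \<eta>) (\<phi> \<omega>) < e"
    proof eventually_elim
      case (elim \<eta>)
      then show ?case using B(2)[OF w, of \<eta> n] n by (simp add: dist_real_def abs_minus_commute)
    qed
  qed
qed

section \<open>Asymptotic variance and conditional estimates given the future\<close>

context gibbs_normalized begin

lemma integral_martingale_square:
  assumes "hoelder m" "\<And>\<omega>. \<omega> \<in> S \<Longrightarrow> G m \<omega> = 0"
  shows "(\<integral>\<omega>. (birkhoff m n \<omega>)\<^sup>2 \<partial>\<mu>) = n * (\<integral>\<omega>. (m \<omega>)\<^sup>2 \<partial>\<mu>)"
proof (induction n)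
  case (Suc n)
  have h: "hoelder (\<lambda>\<omega>. (birkhoff m n \<omega>)\<^sup>2)" "hoelder (\<lambda>\<omega>. (m \<omega>)\<^sup>2)" for n
    by (intro hoelder_power hoelder_birkhoff assms(1))+
  have "(\<integral>\<omega>. (birkhoff m (Suc n) \<omega>)\<^sup>2 \<partial>\<mu>) = (\<integral>\<omega>. G (\<lambda>\<omega>. (birkhoff m (Suc n) \<omega>)\<^sup>2) \<omega> \<partial>\<mu>)"
    by (rule integral_G[OF h(1), symmetric])
  also have "\<dots> = (\<integral>\<omega>. G (\<lambda>\<omega>. (m \<omega>)\<^sup>2) \<omega> + (birkhoff m n \<omega>)\<^sup>2 \<partial>\<mu>)"
    by (rule Bochner_Integration.integral_cong[OF refl])
       (use G_martingale_square[of _ m n] assms(2) space_mu in auto)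
  also have "\<dots> = (\<integral>\<omega>. G (\<lambda>\<omega>. (m \<omega>)\<^sup>2) \<omega> \<partial>\<mu>) + (\<integral>\<omega>. (birkhoff m n \<omega>)\<^sup>2 \<partial>\<mu>)"
    by (intro Bochner_Integration.integral_add hoelder_integrable hoelder_G h)
  finally show ?case using Suc integral_G[OF h(2)] by (simp add: algebra_simps)
qed (simp add: birkhoff_def)

text \<open>A bound on the n-th iterate of the indicator of E, uniform in the argument, is a lower
  bound for the conditional probability of E given any future. Invariance of the integral introduces
  the iterate, and pull-out moves the future event D outside it.\<close>

lemma conditional_bound:
  assumes p: "\<And>\<omega>. \<omega> \<in> S \<Longrightarrow> p \<le> (G ^^ n) (\<lambda>\<omega>. of_bool (E (prefix_of n \<omega>))) \<omega>"
  shows "prob {\<omega> \<in> S. \<not> E (prefix_of n \<omega>) \<and> D (prefix_of l ((shift ^^ n) \<omega>))}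
    \<le> (1 - p) * prob {\<omega> \<in> S. D (prefix_of l \<omega>)}"
proof -
  let ?a = "\<lambda>\<omega>. 1 - of_bool (E (prefix_of n \<omega>)) :: real" and ?b = "\<lambda>\<omega>. of_bool (D (prefix_of l \<omega>)) :: real"
  have ha: "hoelder ?a" and hb: "hoelder ?b" by (rule hoelder_prefix)+
  have hab: "hoelder (\<lambda>\<omega>. ?a \<omega> * ?b ((shift ^^ n) \<omega>))" by (intro hoelder_mult ha hoelder_shift_funpow hb)
  let ?A = "{\<omega> \<in> S. \<not> E (prefix_of n \<omega>) \<and> D (prefix_of l ((shift ^^ n) \<omega>))}"
  have "(shift ^^ n) -` {\<omega> \<in> S. D (prefix_of l \<omega>)} \<inter> space \<mu> \<in> sets \<mu>"
    by (rule measurable_sets[OF shift_funpow_measurable prefix_pred_sets])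
  then have "{\<omega> \<in> S. \<not> E (prefix_of n \<omega>)} \<inter> ((shift ^^ n) -` {\<omega> \<in> S. D (prefix_of l \<omega>)} \<inter> space \<mu>) \<in> sets \<mu>"
    by (rule sets.Int[OF prefix_pred_sets])
  also have "{\<omega> \<in> S. \<not> E (prefix_of n \<omega>)} \<inter> ((shift ^^ n) -` {\<omega> \<in> S. D (prefix_of l \<omega>)} \<inter> space \<mu>) = ?A"
    by (auto simp: space_mu Sigma_K_shift_funpow)
  finally have A: "?A \<in> sets \<mu>" .
  have "prob ?A = (\<integral>\<omega>. indicator ?A \<omega> \<partial>\<mu>)" using A by simp
  also have "\<dots> = (\<integral>\<omega>. ?a \<omega> * ?b ((shift ^^ n) \<omega>) \<partial>\<mu>)"
    by (rule Bochner_Integration.integral_cong) (auto simp: space_mu indicator_def)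
  also have "\<dots> = (\<integral>\<omega>. (G ^^ n) (\<lambda>\<omega>. ?a \<omega> * ?b ((shift ^^ n) \<omega>)) \<omega> \<partial>\<mu>)" by (rule integral_Gn[OF hab, symmetric])
  also have "\<dots> = (\<integral>\<omega>. (G ^^ n) ?a \<omega> * ?b \<omega> \<partial>\<mu>)"
    using transfer_funpow_mult_shift[of n K g ?a ?b] by (simp only:)
  also have "\<dots> \<le> (\<integral>\<omega>. (1 - p) * ?b \<omega> \<partial>\<mu>)"
  proof (rule integral_mono)
    fix \<omega> assume "\<omega> \<in> space \<mu>"
    then have w: "\<omega> \<in> S" by (simp add: space_mu)
    have "(G ^^ n) ?a \<omega> = 1 - (G ^^ n) (\<lambda>\<omega>. of_bool (E (prefix_of n \<omega>))) \<omega>"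
      using Gn_const[OF w] by (simp add: transfer_funpow_diff)
    then show "(G ^^ n) ?a \<omega> * ?b \<omega> \<le> (1 - p) * ?b \<omega>" using p[OF w] by (intro mult_right_mono) auto
  qed (intro hoelder_integrable hoelder_mult hoelder_Gn ha hb hoelder_const)+
  also have "\<dots> = (1 - p) * (\<integral>\<omega>. indicator {\<omega> \<in> S. D (prefix_of l \<omega>)} \<omega> \<partial>\<mu>)"
    unfolding Bochner_Integration.integral_mult_right_zero
    by (intro arg_cong2[where f = "(*)"] refl Bochner_Integration.integral_cong) (auto simp: space_mu indicator_def)
  finally show ?thesis by simp
qed

text \<open>\<open>info\<close> differs from the martingale sum by a bounded amount. The restriction
  that n times the cube of t is at most 1 turns the cubic error of the exponential moments into a
  constant, which leaves purely Gaussian bounds.\<close>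

lemma limit_theory:
  assumes nc: "\<not> cohomologous_to_constant K f"
  obtains A t0 where "1 \<le> A" "0 < t0" "0 < asymp_variance f \<mu>"
    "\<And>n t \<omega>. \<omega> \<in> S \<Longrightarrow> \<bar>t\<bar> \<le> t0 \<Longrightarrow> n * \<bar>t\<bar> ^ 3 \<le> 1 \<Longrightarrow>
      exp (n * asymp_variance f \<mu> * t\<^sup>2 / 2) / A \<le> (G ^^ n) (\<lambda>\<omega>. exp (t * info (prefix_of n \<omega>))) \<omega>"
    "\<And>n t \<omega>. \<omega> \<in> S \<Longrightarrow> \<bar>t\<bar> \<le> t0 \<Longrightarrow> n * \<bar>t\<bar> ^ 3 \<le> 1 \<Longrightarrow>
      (G ^^ n) (\<lambda>\<omega>. exp (t * info (prefix_of n \<omega>))) \<omega> \<le> A * exp (n * asymp_variance f \<mu> * t\<^sup>2 / 2)"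
proof -
  let ?c = "\<integral>\<omega>. f \<omega> \<partial>\<mu>"
  obtain c u where u: "hoelder u" and eq0: "\<And>\<omega>. \<omega> \<in> S \<Longrightarrow> G f \<omega> - c + G u \<omega> = u \<omega>"
    by (rule poisson_equation[OF f_hoelder]) blast
  have c: "c = ?c" using integral_eq_poisson_constant[OF f_hoelder u eq0] by simp
  define m where "m = (\<lambda>\<omega>. f \<omega> - ?c + u \<omega> - u (shift \<omega>))"
  have Gm: "G m \<omega> = 0" if "\<omega> \<in> S" for \<omega>
    unfolding m_def using that eq0[OF that] G_shift[OF that] G_const[OF that] c by (simp add: transfer_add transfer_diff)
  have hm: "hoelder m" unfolding m_def
    by (rule hoelder_diff[OF hoelder_add[OF hoelder_diff[OF f_hoelder hoelder_const] u] hoelder_shift[OF u]])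
  have hm2: "hoelder (\<lambda>\<omega>. (m \<omega>)\<^sup>2)" by (rule hoelder_power[OF hm])
  define \<rho> where "\<rho> = (\<integral>\<omega>. (m \<omega>)\<^sup>2 \<partial>\<mu>)"
  obtain c' v where v: "hoelder v" and eqv0: "\<And>\<omega>. \<omega> \<in> S \<Longrightarrow> G (\<lambda>\<omega>. (m \<omega>)\<^sup>2) \<omega> - c' + G v \<omega> = v \<omega>"
    by (rule poisson_equation[OF hm2]) blast
  have "c' = \<rho>" using integral_eq_poisson_constant[OF hm2 v eqv0] by (simp add: \<rho>_def)
  then have eqv: "\<And>\<omega>. \<omega> \<in> S \<Longrightarrow> G (\<lambda>\<omega>. (m \<omega>)\<^sup>2) \<omega> - \<rho> + G v \<omega> = v \<omega>" using eqv0 by simp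
  obtain U where U: "0 < U" "\<And>\<omega>. \<omega> \<in> S \<Longrightarrow> \<bar>m \<omega>\<bar> \<le> U" by (rule hoelder_bounded[OF hm]) blast
  obtain V where V: "0 < V" "\<And>\<omega>. \<omega> \<in> S \<Longrightarrow> \<bar>v \<omega>\<bar> \<le> V" by (rule hoelder_bounded[OF v]) blast
  obtain W where W: "0 < W" "\<And>\<omega>. \<omega> \<in> S \<Longrightarrow> \<bar>u \<omega>\<bar> \<le> W" by (rule hoelder_bounded[OF u]) blast
  have rho0: "0 \<le> \<rho>" unfolding \<rho>_def by simp
  have SM: "\<bar>birkhoff f n \<omega> - n * ?c - birkhoff m n \<omega>\<bar> \<le> 2 * W" if "\<omega> \<in> S" for n \<omega>
    using W(2)[OF that] W(2)[OF Sigma_K_shift_funpow[OF that, of n]] unfolding m_def birkhoff_coboundary by linarith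
  have rho_pos: "0 < \<rho>"
  proof (rule ccontr)
    assume "\<not> 0 < \<rho>"
    then have r0: "(\<integral>\<omega>. (m \<omega>)\<^sup>2 \<partial>\<mu>) = 0" using rho0 unfolding \<rho>_def by linarith
    \<comment> \<open>A vanishing integral gives m = 0 almost everywhere. Since cylinders have
      positive measure and m varies little on small ones, m vanishes at every point, as an exact
      coboundary requires.\<close>
    have m0: "m \<omega> = 0" if w: "\<omega> \<in> S" for \<omega>
    proof (rule ccontr)
      assume ne: "m \<omega> \<noteq> 0"
      obtain B where "hoelder_with B m" using hm unfolding hoelder_def by blast
      note B = hoelder_withD[OF this]
      have lim: "(\<lambda>n. B * \<alpha> ^ n) \<longlonglongrightarrow> 0" using alpha by (intro tendsto_mult_right_zero LIMSEQ_power_zero) auto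
      have "0 < \<bar>m \<omega>\<bar> / 2" using ne by simp
      from eventually_happens[OF order_tendstoD(2)[OF lim this]]
      obtain n where n: "B * \<alpha> ^ n < \<bar>m \<omega>\<bar> / 2" by auto
      let ?Z = "cylinder K (prefix_of n \<omega>)"
      have "(\<bar>m \<omega>\<bar> / 2)\<^sup>2 * prob ?Z = (\<integral>\<eta>. (\<bar>m \<omega>\<bar> / 2)\<^sup>2 * indicator ?Z \<eta> \<partial>\<mu>)" by simp
      also have "\<dots> \<le> (\<integral>\<eta>. (m \<eta>)\<^sup>2 \<partial>\<mu>)"
      proof (rule integral_mono[OF _ hoelder_integrable[OF hm2]])
        show "integrable \<mu> (\<lambda>\<eta>. (\<bar>m \<omega>\<bar> / 2)\<^sup>2 * indicator ?Z \<eta>)" by (simp add: emeasure_eq_measure)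
        fix \<eta> assume "\<eta> \<in> space \<mu>"
        show "(\<bar>m \<omega>\<bar> / 2)\<^sup>2 * indicator ?Z \<eta> \<le> (m \<eta>)\<^sup>2"
        proof (cases "\<eta> \<in> ?Z")
          case True
          then have "\<eta> \<in> S" "agree n \<omega> \<eta>"
            using cylinder_prefix_of[of "prefix_of n \<omega>" n \<eta> K] prefix_of_eq_iff[of n \<eta> \<omega>] by (auto intro: agree_sym)
          then have "\<bar>m \<omega> - m \<eta>\<bar> < \<bar>m \<omega>\<bar> / 2" using B(2)[OF w, of \<eta> n] n by linarith
          then have "\<bar>\<bar>m \<omega>\<bar> / 2\<bar> \<le> \<bar>m \<eta>\<bar>" by linarith
          then show ?thesis using True by (simp only: abs_le_square_iff) simp
        qed simp
      qed
      finally have "(\<bar>m \<omega>\<bar> / 2)\<^sup>2 * prob ?Z \<le> 0" using r0 by simp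
      moreover have "0 < (\<bar>m \<omega>\<bar> / 2)\<^sup>2 * prob ?Z"
        using ne cylinder_pos[OF prefix_of_words[OF w]] by (intro mult_pos_pos) auto
      ultimately show False by linarith
    qed
    have "f \<omega> = u (shift \<omega>) - u \<omega> + ?c" if "\<omega> \<in> S" for \<omega> using m0[OF that] by (simp add: m_def)
    then have "cohomologous_to_constant K f"
      unfolding cohomologous_to_constant_def using hoelder_continuous_on[OF u] by blast
    then show False using nc by simp
  qed
  have var: "asymp_variance f \<mu> = \<rho>"
    unfolding asymp_variance_def
  proof (rule limI)
    let ?S = "\<lambda>n \<omega>. birkhoff f n \<omega> - real n * ?c" and ?M = "birkhoff m"
    have iS: "integrable \<mu> (\<lambda>\<omega>. (?S n \<omega>)\<^sup>2)" for n
      by (intro hoelder_integrable hoelder_power hoelder_diff hoelder_birkhoff f_hoelder hoelder_const)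
    have iM: "integrable \<mu> (\<lambda>\<omega>. (?M n \<omega>)\<^sup>2)" for n
      by (intro hoelder_integrable hoelder_power hoelder_birkhoff hm)
    have key: "\<bar>(\<integral>\<omega>. (?S n \<omega>)\<^sup>2 \<partial>\<mu>) - n * \<rho>\<bar> \<le> sqrt n * \<rho> + (sqrt n * (4 * W\<^sup>2) + 4 * W\<^sup>2)" if n: "0 < n" for n
    proof -
      have pt: "\<bar>(?S n \<omega>)\<^sup>2 - (?M n \<omega>)\<^sup>2\<bar> \<le> (?M n \<omega>)\<^sup>2 / sqrt n + (sqrt n * (4 * W\<^sup>2) + 4 * W\<^sup>2)" if w: "\<omega> \<in> S" for \<omega>
      proof -
        let ?d = "?S n \<omega> - ?M n \<omega>" and ?M = "?M n \<omega>"
        have d: "?d\<^sup>2 \<le> (2 * W)\<^sup>2" using SM[OF w, of n] W(1) by (subst abs_le_square_iff[symmetric]) simp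
        have sn: "0 < sqrt n" using n by simp
        \<comment> \<open>Young's inequality with weight sqrt n for the cross term: the integral of
          the squared martingale divided by sqrt n and the bounded part times sqrt n are both of
          order sqrt n, negligible against n.\<close>
        have "0 \<le> (\<bar>?M\<bar> - sqrt n * \<bar>?d\<bar>)\<^sup>2" by simp
        then have "2 * (\<bar>?M\<bar> * \<bar>?d\<bar>) * sqrt n \<le> ?M\<^sup>2 + (sqrt n * \<bar>?d\<bar>)\<^sup>2" by (simp add: power2_diff algebra_simps)
        then have "2 * (\<bar>?M\<bar> * \<bar>?d\<bar>) \<le> (?M\<^sup>2 + (sqrt n * \<bar>?d\<bar>)\<^sup>2) / sqrt n" using sn by (simp add: pos_le_divide_eq)
        also have "\<dots> = ?M\<^sup>2 / sqrt n + sqrt n * ?d\<^sup>2" using sn by (simp add: power2_eq_square field_simps)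
        finally have 1: "2 * \<bar>?M * ?d\<bar> \<le> ?M\<^sup>2 / sqrt n + sqrt n * ?d\<^sup>2" by (simp add: abs_mult)
        have "sqrt n * ?d\<^sup>2 \<le> sqrt n * (2 * W)\<^sup>2" using d sn by (intro mult_left_mono) auto
        then have 2: "sqrt n * ?d\<^sup>2 \<le> sqrt n * (4 * W\<^sup>2)" by (simp add: power_mult_distrib)
        have "(?S n \<omega>)\<^sup>2 - ?M\<^sup>2 = 2 * (?M * ?d) + ?d\<^sup>2" by (simp add: power2_eq_square algebra_simps)
        moreover have "\<bar>2 * (?M * ?d) + ?d\<^sup>2\<bar> \<le> \<bar>2 * (?M * ?d)\<bar> + \<bar>?d\<^sup>2\<bar>" by (rule abs_triangle_ineq)
        ultimately have "\<bar>(?S n \<omega>)\<^sup>2 - ?M\<^sup>2\<bar> \<le> 2 * \<bar>?M * ?d\<bar> + ?d\<^sup>2" by simp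
        then show ?thesis using 1 2 d by (simp add: power_mult_distrib)
      qed
      have "\<bar>(\<integral>\<omega>. (?S n \<omega>)\<^sup>2 \<partial>\<mu>) - (\<integral>\<omega>. (?M n \<omega>)\<^sup>2 \<partial>\<mu>)\<bar> = \<bar>\<integral>\<omega>. (?S n \<omega>)\<^sup>2 - (?M n \<omega>)\<^sup>2 \<partial>\<mu>\<bar>"
        using Bochner_Integration.integral_diff[OF iS iM] by simp
      also have "\<dots> \<le> (\<integral>\<omega>. \<bar>(?S n \<omega>)\<^sup>2 - (?M n \<omega>)\<^sup>2\<bar> \<partial>\<mu>)" by (rule integral_abs_bound)
      also have "\<dots> \<le> (\<integral>\<omega>. (?M n \<omega>)\<^sup>2 / sqrt n + (sqrt n * (4 * W\<^sup>2) + 4 * W\<^sup>2) \<partial>\<mu>)"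
        by (rule integral_mono) (use iS iM pt space_mu in auto)
      also have "\<dots> = n * \<rho> / sqrt n + (sqrt n * (4 * W\<^sup>2) + 4 * W\<^sup>2)"
        using iM[of n] integral_martingale_square[OF hm Gm, of n] by (simp add: prob_space \<rho>_def)
      also have "n * \<rho> / sqrt n = sqrt n * \<rho>" using n by (simp add: field_simps)
      finally show ?thesis using integral_martingale_square[OF hm Gm, of n] by (simp add: \<rho>_def)
    qed
    have "(\<lambda>n. (\<integral>\<omega>. (?S n \<omega>)\<^sup>2 \<partial>\<mu>) / n - \<rho>) \<longlonglongrightarrow> 0"
    proof (rule Lim_null_comparison)
      show "(\<lambda>n. (sqrt n * \<rho> + (sqrt n * (4 * W\<^sup>2) + 4 * W\<^sup>2)) / real n) \<longlonglongrightarrow> 0" by real_asymp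
      show "\<forall>\<^sub>F n in sequentially. norm ((\<integral>\<omega>. (?S n \<omega>)\<^sup>2 \<partial>\<mu>) / n - \<rho>) \<le> (sqrt n * \<rho> + (sqrt n * (4 * W\<^sup>2) + 4 * W\<^sup>2)) / real n"
        using eventually_gt_at_top[of 0]
      proof eventually_elim
        case (elim n)
        have "(\<integral>\<omega>. (?S n \<omega>)\<^sup>2 \<partial>\<mu>) / n - \<rho> = ((\<integral>\<omega>. (?S n \<omega>)\<^sup>2 \<partial>\<mu>) - n * \<rho>) / n" using elim by (simp add: field_simps)
        then show ?case using divide_right_mono[OF key[OF elim], of "real n"] by simp
      qed
    qed
    then show "(\<lambda>n. (\<integral>\<omega>. (?S n \<omega>)\<^sup>2 \<partial>\<mu>) / real n) \<longlonglongrightarrow> \<rho>" by (simp add: LIM_zero_iff)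
  qed
  obtain B t0 where B: "0 < B" and t0: "0 < t0" and lo: "\<And>n t \<omega>. \<omega> \<in> S \<Longrightarrow> \<bar>t\<bar> \<le> t0 \<Longrightarrow>
      exp (n * (\<rho> * t\<^sup>2 / 2 - B * \<bar>t\<bar> ^ 3)) / 3 \<le> (G ^^ n) (\<lambda>\<omega>. exp (t * birkhoff m n \<omega>)) \<omega>"
    and up: "\<And>n t \<omega>. \<omega> \<in> S \<Longrightarrow> \<bar>t\<bar> \<le> t0 \<Longrightarrow>
      (G ^^ n) (\<lambda>\<omega>. exp (t * birkhoff m n \<omega>)) \<omega> \<le> 3 * exp (n * (\<rho> * t\<^sup>2 / 2 + B * \<bar>t\<bar> ^ 3))"
    using Gn_exp_martingale[OF Gm U(2,1) eqv V(2,1) rho0] by metis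
  define b' where "b' = ln C + 2 * W"
  \<comment> \<open>3 comes from the perturbed eigenfunction, exp B from the cubic error, and exp
    (t0 * b') from replacing the martingale sum by \<open>info\<close>.\<close>
  define A where "A = 3 * exp B * exp (t0 * b')"
  have XM: "\<bar>info (prefix_of n \<omega>) - birkhoff m n \<omega>\<bar> \<le> b'" if "\<omega> \<in> S" for n \<omega>
    using info_birkhoff[OF that, of n] SM[OF that, of n] by (simp add: b'_def)
  have b0: "0 \<le> b'" using XM[OF base_point] by (meson abs_ge_zero order_trans)
  show ?thesis
  proof (rule that[of A t0])
    have "1 \<le> exp B" "1 \<le> exp (t0 * b')" using B t0 b0 by auto
    then have "1 * 1 * 1 \<le> 3 * exp B * exp (t0 * b')" by (intro mult_mono) auto
    then show "1 \<le> A" by (simp add: A_def)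
    show "0 < asymp_variance f \<mu>" using rho_pos var by simp
    fix n t \<omega> assume w: "\<omega> \<in> S" and t: "\<bar>t\<bar> \<le> t0" and nt: "real n * \<bar>t\<bar> ^ 3 \<le> 1"
    have tX: "\<bar>t * info (prefix_of n \<eta>) - t * birkhoff m n \<eta>\<bar> \<le> t0 * b'" if "\<eta> \<in> S" for \<eta>
      unfolding right_diff_distrib[symmetric] abs_mult using XM[OF that] t t0 by (intro mult_mono) auto
    have nB: "n * (B * \<bar>t\<bar> ^ 3) \<le> B" using mult_left_mono[OF nt, of B] B by (simp add: mult_ac)
    let ?E = "(G ^^ n) (\<lambda>\<omega>. exp (t * info (prefix_of n \<omega>))) \<omega>"
    have "?E \<le> (G ^^ n) (\<lambda>\<omega>. exp (t0 * b') * exp (t * birkhoff m n \<omega>)) \<omega>"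
    proof (rule transfer_funpow_mono[OF g_nonneg _ w])
      fix \<eta> assume "\<eta> \<in> S"
      from tX[OF this] show "exp (t * info (prefix_of n \<eta>)) \<le> exp (t0 * b') * exp (t * birkhoff m n \<eta>)"
        unfolding exp_add[symmetric] by simp
    qed
    also have "\<dots> \<le> exp (t0 * b') * (3 * exp (n * (\<rho> * t\<^sup>2 / 2 + B * \<bar>t\<bar> ^ 3)))"
      unfolding transfer_funpow_cmult by (intro mult_left_mono up w t) simp
    also have "\<dots> \<le> exp (t0 * b') * (3 * exp (n * \<rho> * t\<^sup>2 / 2 + B))" using nB by (simp add: ring_distribs)
    also have "\<dots> = A * exp (n * \<rho> * t\<^sup>2 / 2)" by (simp add: A_def exp_add)
    finally show "?E \<le> A * exp (n * asymp_variance f \<mu> * t\<^sup>2 / 2)" unfolding var .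
    have "exp (n * \<rho> * t\<^sup>2 / 2) / A = exp (- (t0 * b')) * (exp (n * \<rho> * t\<^sup>2 / 2 - B) / 3)"
      by (simp only: A_def exp_diff exp_minus) (simp add: field_simps)
    also have "\<dots> \<le> exp (- (t0 * b')) * (exp (n * (\<rho> * t\<^sup>2 / 2 - B * \<bar>t\<bar> ^ 3)) / 3)"
      using nB by (simp add: ring_distribs)
    also have "\<dots> \<le> exp (- (t0 * b')) * (G ^^ n) (\<lambda>\<omega>. exp (t * birkhoff m n \<omega>)) \<omega>"
      by (intro mult_left_mono lo w t) simp
    also have "\<dots> = (G ^^ n) (\<lambda>\<omega>. exp (- (t0 * b')) * exp (t * birkhoff m n \<omega>)) \<omega>" by (simp only: transfer_funpow_cmult)
    also have "\<dots> \<le> ?E"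
    proof (rule transfer_funpow_mono[OF g_nonneg _ w])
      fix \<eta> assume "\<eta> \<in> S"
      from tX[OF this] show "exp (- (t0 * b')) * exp (t * birkhoff m n \<eta>) \<le> exp (t * info (prefix_of n \<eta>))"
        unfolding exp_add[symmetric] by simp
    qed
    finally show "exp (n * asymp_variance f \<mu> * t\<^sup>2 / 2) / A \<le> ?E" unfolding var .
  qed (rule t0)
qed

end

section \<open>The law of the iterated logarithm for cylinder measures\<close>

text \<open>Quantifies over all sequences of naturals and not only over the symbolic space, so the
  closure rules need no side conditions. A determined predicate is a function of the prefix and
  hence gives a measurable set.\<close>

definition determined :: "nat \<Rightarrow> ((nat \<Rightarrow> nat) \<Rightarrow> bool) \<Rightarrow> bool" where
  "determined n Q \<longleftrightarrow> (\<forall>\<omega> \<eta>. agree n \<omega> \<eta> \<longrightarrow> Q \<omega> = Q \<eta>)"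

lemma agree_imp_prefix_of_shift_eq:
  "agree n \<omega> \<eta> \<Longrightarrow> j + m \<le> n \<Longrightarrow> prefix_of m ((shift ^^ j) \<omega>) = prefix_of m ((shift ^^ j) \<eta>)"
  by (auto simp: prefix_of_eq_iff agree_def shift_funpow)

lemma determined_prefix_of_shift:
  "j + m \<le> n \<Longrightarrow> determined n (\<lambda>\<omega>. Q (prefix_of m ((shift ^^ j) \<omega>)))"
  unfolding determined_def by (metis agree_imp_prefix_of_shift_eq)

lemma determined_prefix_of: "m \<le> n \<Longrightarrow> determined n (\<lambda>\<omega>. Q (prefix_of m \<omega>))"
  using determined_prefix_of_shift[of 0 m n Q] by simp

lemma determined_conj: "determined n Q \<Longrightarrow> determined n R \<Longrightarrow> determined n (\<lambda>\<omega>. Q \<omega> \<and> R \<omega>)"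
  by (auto simp: determined_def)

lemma determined_not: "determined n Q \<Longrightarrow> determined n (\<lambda>\<omega>. \<not> Q \<omega>)"
  by (auto simp: determined_def)

lemma determined_ball: "(\<And>i. i \<in> I \<Longrightarrow> determined n (Q i)) \<Longrightarrow> determined n (\<lambda>\<omega>. \<forall>i\<in>I. Q i \<omega>)"
  by (auto simp: determined_def)

lemma determined_mono: "determined m Q \<Longrightarrow> m \<le> n \<Longrightarrow> determined n Q"
  unfolding determined_def agree_def by (meson less_le_trans)

lemma determined_shift: "determined m Q \<Longrightarrow> j + m \<le> n \<Longrightarrow> determined n (\<lambda>\<omega>. Q ((shift ^^ j) \<omega>))"
  unfolding determined_def agree_def shift_funpow by simp

lemma determined_eq: "determined n Q \<Longrightarrow> Q \<omega> = Q (prepend (prefix_of n \<omega>) (\<lambda>_. 1))"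
  unfolding determined_def using agree_prepend_prefix_of by blast

lemma (in invariant) determined_sets:
  assumes "determined n Q" shows "{\<omega> \<in> S. Q \<omega>} \<in> sets \<mu>"
  using prefix_pred_sets[of "\<lambda>w. Q (prepend w (\<lambda>_. 1))" n] determined_eq[OF assms] by simp

lemma (in invariant) measure_shift_determined:
  assumes "determined n Q"
  shows "prob {\<omega> \<in> S. Q ((shift ^^ j) \<omega>)} = prob {\<omega> \<in> S. Q \<omega>}"
proof -
  have "{\<omega> \<in> S. Q ((shift ^^ j) \<omega>)} = (shift ^^ j) -` {\<omega> \<in> S. Q \<omega>} \<inter> space \<mu>"
    by (auto simp: space_mu Sigma_K_shift_funpow)
  then show ?thesis using measure_shift_funpow[OF determined_sets[OF assms]] by simp
qed

text \<open>The cylinder inequality summed over all pairs of admissible words: the substitute for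
  independence of an event of the first m symbols and an event of the next n.\<close>

lemma (in gibbs) quasi_bernoulli_determined:
  assumes Q: "determined m Q" and R: "determined n R"
  shows "prob {\<omega> \<in> S. Q \<omega>} * prob {\<omega> \<in> S. R \<omega>} / C ^ 3
      \<le> prob {\<omega> \<in> S. Q \<omega> \<and> R ((shift ^^ m) \<omega>)}"
    and "prob {\<omega> \<in> S. Q \<omega> \<and> R ((shift ^^ m) \<omega>)}
      \<le> C ^ 3 * (prob {\<omega> \<in> S. Q \<omega>} * prob {\<omega> \<in> S. R \<omega>})"
proof -
  define Q' R' where "Q' w = Q (prepend w (\<lambda>_. 1))" and "R' w = R (prepend w (\<lambda>_. 1))" for w
  have q: "Q \<omega> = Q' (prefix_of m \<omega>)" and r: "R \<omega> = R' (prefix_of n \<omega>)" for \<omega>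
    unfolding Q'_def R'_def using determined_eq Q R by blast+
  let ?U = "{u \<in> words K m. Q' u}" and ?V = "{v \<in> words K n. R' v}"
  let ?p = "\<lambda>w. prob (cylinder K w)"
  have both: "prob {\<omega> \<in> S. Q \<omega> \<and> R ((shift ^^ m) \<omega>)} = (\<Sum>(u, v)\<in>?U \<times> ?V. ?p (u @ v))"
  proof -
    have "{\<omega> \<in> S. Q \<omega> \<and> R ((shift ^^ m) \<omega>)} =
      {\<omega> \<in> S. Q' (take m (prefix_of (m + n) \<omega>)) \<and> R' (drop m (prefix_of (m + n) \<omega>))}"
      by (simp add: q r prefix_of_add)
    also have "prob \<dots> = (\<Sum>w\<in>{w \<in> words K (m + n). Q' (take m w) \<and> R' (drop m w)}. ?p w)"
      by (rule measure_prefix)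
    also have "\<dots> = (\<Sum>x\<in>?U \<times> ?V. ?p (case x of (u, v) \<Rightarrow> u @ v))"
    proof (rule sum.reindex_bij_witness[of _ "\<lambda>(u, v). u @ v" "\<lambda>w. (take m w, drop m w)"])
      fix w assume "w \<in> {w \<in> words K (m + n). Q' (take m w) \<and> R' (drop m w)}"
      then show "(take m w, drop m w) \<in> ?U \<times> ?V"
        using set_take_subset[of m w] set_drop_subset[of m w] by (auto simp: words_def)
    qed (auto simp: words_def)
    finally show ?thesis by (simp add: case_prod_unfold)
  qed
  have prod: "prob {\<omega> \<in> S. Q \<omega>} * prob {\<omega> \<in> S. R \<omega>} = (\<Sum>(u, v)\<in>?U \<times> ?V. ?p u * ?p v)"
    unfolding q r measure_prefix by (simp add: sum_product sum.cartesian_product)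
  show "prob {\<omega> \<in> S. Q \<omega>} * prob {\<omega> \<in> S. R \<omega>} / C ^ 3
      \<le> prob {\<omega> \<in> S. Q \<omega> \<and> R ((shift ^^ m) \<omega>)}"
    unfolding both prod sum_divide_distrib by (intro sum_mono) (auto intro: quasi_bernoulli)
  show "prob {\<omega> \<in> S. Q \<omega> \<and> R ((shift ^^ m) \<omega>)}
      \<le> C ^ 3 * (prob {\<omega> \<in> S. Q \<omega>} * prob {\<omega> \<in> S. R \<omega>})"
    unfolding both prod sum_distrib_left by (intro sum_mono) (auto intro: quasi_bernoulli)
qed

section \<open>Tail probabilities and a maximal inequality\<close>

locale gibbs_clt = gibbs_normalized K \<alpha> \<mu> f P C g b A0 for K \<alpha> \<mu> f P C g b A0 +
  fixes A t0 \<rho> :: real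
  assumes K_ge_2: "2 \<le> K" and A_ge: "1 \<le> A" and t0_pos: "0 < t0" and rho_pos: "0 < \<rho>"
    and exp_lower: "\<And>n t \<omega>. \<omega> \<in> S \<Longrightarrow> \<bar>t\<bar> \<le> t0 \<Longrightarrow> n * \<bar>t\<bar> ^ 3 \<le> 1 \<Longrightarrow>
      exp (n * \<rho> * t\<^sup>2 / 2) / A \<le> (G ^^ n) (\<lambda>\<omega>. exp (t * info (prefix_of n \<omega>))) \<omega>"
    and exp_upper: "\<And>n t \<omega>. \<omega> \<in> S \<Longrightarrow> \<bar>t\<bar> \<le> t0 \<Longrightarrow> n * \<bar>t\<bar> ^ 3 \<le> 1 \<Longrightarrow>
      (G ^^ n) (\<lambda>\<omega>. exp (t * info (prefix_of n \<omega>))) \<omega> \<le> A * exp (n * \<rho> * t\<^sup>2 / 2)"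
begin

definition X where "X n \<omega> = info (prefix_of n \<omega>)"

text \<open>Sign and monotonicity are used from exp 1 on, where ln ln is nonnegative; hence the
  thresholds exp 1 in the estimates.\<close>

definition lil where "lil x = sqrt (2 * \<rho> * x * ln (ln x))"

lemma X_additive:
  assumes "\<omega> \<in> S"
  shows "\<bar>X (m + n) \<omega> - (X m \<omega> + X n ((shift ^^ m) \<omega>))\<bar> \<le> 3 * ln C"
proof -
  let ?u = "prefix_of m \<omega>" and ?v = "prefix_of n ((shift ^^ m) \<omega>)"
  let ?p = "\<lambda>w. prob (cylinder K w)"
  have w: "?u \<in> words K m" "?v \<in> words K n" using assms Sigma_K_shift_funpow by blast+
  note pos = cylinder_pos[OF w(1)] cylinder_pos[OF w(2)] cylinder_pos[OF words_append[OF w]]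
  have lnC: "ln (C ^ 3) = 3 * ln C" using C_gt by (simp add: ln_realpow)
  have "ln (?p ?u * ?p ?v / C ^ 3) \<le> ln (?p (?u @ ?v))"
    using quasi_bernoulli(1)[OF w] pos C_gt by (subst ln_le_cancel_iff) auto
  then have 1: "ln (?p ?u) + ln (?p ?v) - 3 * ln C \<le> ln (?p (?u @ ?v))"
    using pos C_gt by (simp add: ln_div ln_mult lnC)
  have "ln (?p (?u @ ?v)) \<le> ln (C ^ 3 * (?p ?u * ?p ?v))"
    using quasi_bernoulli(2)[OF w] pos C_gt by (subst ln_le_cancel_iff) auto
  then have 2: "ln (?p (?u @ ?v)) \<le> 3 * ln C + (ln (?p ?u) + ln (?p ?v))"
    using pos C_gt by (simp add: ln_mult lnC)
  have "X (m + n) \<omega> - (X m \<omega> + X n ((shift ^^ m) \<omega>)) = ln (?p (?u @ ?v)) - (ln (?p ?u) + ln (?p ?v))"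
    by (simp add: X_def info_def prefix_of_add algebra_simps)
  then show ?thesis using 1 2 by linarith
qed

lemma determined_X: "m \<le> n \<Longrightarrow> determined n (\<lambda>\<omega>. Q (X m \<omega>))"
  unfolding X_def by (rule determined_prefix_of)

text \<open>Markov's inequality for exp (t X): its integral equals that of its n-th iterate under
  \<open>G\<close>, where the uniform moment bound applies. As t may be negative, both tails are
  covered.\<close>

lemma chernoff:
  assumes "\<bar>t\<bar> \<le> t0" "n * \<bar>t\<bar> ^ 3 \<le> 1"
  shows "prob {\<omega> \<in> S. x \<le> t * X n \<omega>} \<le> A * exp (n * \<rho> * t\<^sup>2 / 2 - x)"
proof -
  have h: "hoelder (\<lambda>\<omega>. exp (t * X n \<omega>))" unfolding X_def by (rule hoelder_prefix)
  let ?Z = "{\<omega> \<in> S. x \<le> t * X n \<omega>}"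
  have Z: "?Z \<in> sets \<mu>" by (rule determined_sets[OF determined_X[OF order_refl]])
  have "prob ?Z = (\<integral>\<omega>. indicator ?Z \<omega> \<partial>\<mu>)"
    unfolding Bochner_Integration.integral_indicator sets.Int_space_eq2[OF Z] ..
  also have "\<dots> \<le> (\<integral>\<omega>. exp (- x) * exp (t * X n \<omega>) \<partial>\<mu>)"
  proof (rule integral_mono)
    show "integrable \<mu> (indicator ?Z :: _ \<Rightarrow> real)" by (rule integrable_real_indicator[OF Z]) (simp add: less_top[symmetric])
    show "integrable \<mu> (\<lambda>\<omega>. exp (- x) * exp (t * X n \<omega>))" by (intro hoelder_integrable hoelder_mult h hoelder_const)
    show "indicator ?Z \<omega> \<le> exp (- x) * exp (t * X n \<omega>)" for \<omega>
      by (simp add: indicator_def flip: exp_add)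
  qed
  also have "\<dots> = exp (- x) * (\<integral>\<omega>. (G ^^ n) (\<lambda>\<omega>. exp (t * X n \<omega>)) \<omega> \<partial>\<mu>)" using integral_Gn[OF h] by simp
  also have "\<dots> \<le> exp (- x) * (\<integral>\<omega>. A * exp (n * \<rho> * t\<^sup>2 / 2) \<partial>\<mu>)"
    using exp_upper[OF _ assms] space_mu
    by (intro mult_left_mono integral_mono hoelder_integrable hoelder_Gn h hoelder_const) (auto simp: X_def)
  also have "\<dots> = A * (exp (- x) * exp (n * \<rho> * t\<^sup>2 / 2))" by (simp add: prob_space)
  also have "exp (- x) * exp (n * \<rho> * t\<^sup>2 / 2) = exp (n * \<rho> * t\<^sup>2 / 2 - x)" by (simp flip: exp_add)
  finally show ?thesis .
qed

text \<open>The bracket is an exponential tilt corrected so as to be nonpositive outside \<open>[a0, a2]\<close>; this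
  turns bounds on exponential moments into a lower bound for a probability.\<close>
lemma exp_tilting:
  fixes x T0 T1 T2 a0 a2 :: real
  assumes "T0 \<le> T1" "T1 \<le> T2" "0 \<le> T1"
  shows "exp (- T1 * a2) * (exp (T1 * x) - exp ((T1 - T0) * a0) * exp (T0 * x) - exp (- (T2 - T1) * a2) * exp (T2 * x)) \<le> of_bool (a0 \<le> x)"
proof -
  consider "x < a0" | "a2 < x" | "a0 \<le> x" "x \<le> a2" by linarith
  then show ?thesis
  proof cases
    case 1
    have "(T1 - T0) * x \<le> (T1 - T0) * a0" using 1 assms by (intro mult_left_mono) auto
    then have "exp (T1 * x) \<le> exp ((T1 - T0) * a0) * exp (T0 * x)"
      unfolding exp_add[symmetric] by (simp add: algebra_simps)
    moreover have "0 \<le> exp (- (T2 - T1) * a2) * exp (T2 * x)" by simp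
    ultimately have "exp (T1 * x) - exp ((T1 - T0) * a0) * exp (T0 * x) - exp (- (T2 - T1) * a2) * exp (T2 * x) \<le> 0" by linarith
    then show ?thesis using 1 by (simp add: mult_nonneg_nonpos)
  next
    case 2
    have "(T2 - T1) * a2 \<le> (T2 - T1) * x" using 2 assms by (intro mult_left_mono) auto
    then have "exp (T1 * x) \<le> exp (- (T2 - T1) * a2) * exp (T2 * x)"
      unfolding exp_add[symmetric] by (simp add: algebra_simps)
    moreover have "0 \<le> exp ((T1 - T0) * a0) * exp (T0 * x)" by simp
    ultimately have "exp (T1 * x) - exp ((T1 - T0) * a0) * exp (T0 * x) - exp (- (T2 - T1) * a2) * exp (T2 * x) \<le> 0" by linarith
    then have "exp (- T1 * a2) * (exp (T1 * x) - exp ((T1 - T0) * a0) * exp (T0 * x) - exp (- (T2 - T1) * a2) * exp (T2 * x)) \<le> 0"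
      by (intro mult_nonneg_nonpos) auto
    then show ?thesis by (rule order_trans) simp
  next
    case 3
    have "0 \<le> exp ((T1 - T0) * a0) * exp (T0 * x)" "0 \<le> exp (- (T2 - T1) * a2) * exp (T2 * x)" by simp_all
    then have "exp (- T1 * a2) * (exp (T1 * x) - exp ((T1 - T0) * a0) * exp (T0 * x) - exp (- (T2 - T1) * a2) * exp (T2 * x))
      \<le> exp (- T1 * a2) * exp (T1 * x)" by (intro mult_left_mono) (linarith, simp)
    also have "\<dots> \<le> 1" unfolding exp_add[symmetric] using 3 assms(3) by (simp add: mult_left_mono)
    finally show ?thesis using 3 by simp
  qed
qed

text \<open>The tilt at parameter a + \<eta> concentrates X near a + \<eta> in units of s; the tilts
  at a and a + 2 \<eta> cut off what lies below a and above a + 2 \<eta>. Both corrections are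
  smaller than the main term by exp of minus \<eta> \<eta> l, which has to beat the constants
  A.\<close>

lemma moderate_deviation_lower:
  assumes w: "\<omega> \<in> S" and a: "0 < a" "0 < \<eta>" and l: "0 < l" "4 * A\<^sup>2 \<le> exp (\<eta>\<^sup>2 * l)" and n: "0 < n"
    and t: "(a + 2 * \<eta>) * sqrt (2 * l / (\<rho> * n)) \<le> t0" "n * ((a + 2 * \<eta>) * sqrt (2 * l / (\<rho> * n))) ^ 3 \<le> 1"
  shows "exp (- ((a + \<eta>) * (a + 3 * \<eta>)) * l) / (2 * A)
    \<le> (G ^^ n) (\<lambda>\<omega>. of_bool (a * sqrt (2 * \<rho> * n * l) \<le> X n \<omega>)) \<omega>"
proof -
  \<comment> \<open>Dual scales for parameter and deviation: \<tau> s = 2 l, and the Gaussian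
    exponent at c \<tau> is l times the square of c.\<close>
  define \<tau> where "\<tau> = sqrt (2 * l / (\<rho> * n))"
  define s where "s = sqrt (2 * \<rho> * n * l)"
  have tau: "0 \<le> \<tau>" unfolding \<tau>_def using l rho_pos n by simp
  have ts: "\<tau> * s = 2 * l"
  proof -
    have "(2 * l / (\<rho> * n)) * (2 * \<rho> * n * l) = (2 * l)\<^sup>2" using rho_pos n by (simp add: power2_eq_square)
    then have "\<tau> * s = sqrt ((2 * l)\<^sup>2)" unfolding \<tau>_def s_def real_sqrt_mult[symmetric] by (simp only:)
    then show ?thesis using l(1) by (simp only: real_sqrt_abs)
  qed
  have t2: "n * \<rho> * (c * \<tau>)\<^sup>2 / 2 = c\<^sup>2 * l" for c
    unfolding \<tau>_def using l rho_pos n by (simp add: power_mult_distrib)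
  define E where "E c = (G ^^ n) (\<lambda>\<omega>. exp ((c * \<tau>) * X n \<omega>)) \<omega>" for c
  have small: "\<bar>c * \<tau>\<bar> \<le> t0" "n * \<bar>c * \<tau>\<bar> ^ 3 \<le> 1" if c: "0 \<le> c" "c \<le> a + 2 * \<eta>" for c
  proof -
    have le: "\<bar>c * \<tau>\<bar> \<le> (a + 2 * \<eta>) * \<tau>" using c tau by (simp add: abs_mult mult_right_mono)
    then show "\<bar>c * \<tau>\<bar> \<le> t0" using t(1) by (simp add: \<tau>_def)
    have "n * \<bar>c * \<tau>\<bar> ^ 3 \<le> n * ((a + 2 * \<eta>) * \<tau>) ^ 3" by (intro mult_left_mono power_mono le) auto
    then show "n * \<bar>c * \<tau>\<bar> ^ 3 \<le> 1" using t(2) by (simp add: \<tau>_def)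
  qed
  have Elo: "exp (c\<^sup>2 * l) / A \<le> E c" and Eup: "E c \<le> A * exp (c\<^sup>2 * l)" if "0 \<le> c" "c \<le> a + 2 * \<eta>" for c
    using exp_lower[OF w small[OF that]] exp_upper[OF w small[OF that]] unfolding t2 by (simp_all add: E_def X_def)
  define e1 e2 e3 where "e1 = exp (- ((a + \<eta>) * \<tau>) * ((a + 2 * \<eta>) * s))"
    and "e2 = exp (((a + \<eta>) * \<tau> - a * \<tau>) * (a * s))"
    and "e3 = exp (- ((a + 2 * \<eta>) * \<tau> - (a + \<eta>) * \<tau>) * ((a + 2 * \<eta>) * s))"
  have "(G ^^ n) (\<lambda>\<omega>. e1 * (exp (((a + \<eta>) * \<tau>) * X n \<omega>) - e2 * exp ((a * \<tau>) * X n \<omega>) - e3 * exp (((a + 2 * \<eta>) * \<tau>) * X n \<omega>))) \<omega>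
     \<le> (G ^^ n) (\<lambda>\<omega>. of_bool (a * s \<le> X n \<omega>)) \<omega>"
    unfolding e1_def e2_def e3_def
    using a tau by (intro transfer_funpow_mono[OF g_nonneg exp_tilting w]) (auto intro!: mult_right_mono)
  also have "(G ^^ n) (\<lambda>\<omega>. e1 * (exp (((a + \<eta>) * \<tau>) * X n \<omega>) - e2 * exp ((a * \<tau>) * X n \<omega>) - e3 * exp (((a + 2 * \<eta>) * \<tau>) * X n \<omega>))) \<omega>
     = e1 * (E (a + \<eta>) - e2 * E a - e3 * E (a + 2 * \<eta>))"
    unfolding transfer_funpow_cmult transfer_funpow_diff E_def ..
  finally have main: "e1 * (E (a + \<eta>) - e2 * E a - e3 * E (a + 2 * \<eta>)) \<le> (G ^^ n) (\<lambda>\<omega>. of_bool (a * s \<le> X n \<omega>)) \<omega>" .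
  define F where "F = exp ((a + \<eta>)\<^sup>2 * l)"
  have "- ((a + \<eta>) * \<tau>) * ((a + 2 * \<eta>) * s) = - (2 * (a + \<eta>) * (a + 2 * \<eta>) * l)" using ts by algebra
  then have e1: "e1 = exp (- (2 * (a + \<eta>) * (a + 2 * \<eta>) * l))" unfolding e1_def by (simp only:)
  have "((a + \<eta>) * \<tau> - a * \<tau>) * (a * s) = 2 * \<eta> * a * l" using ts by algebra
  then have e2: "e2 = exp (2 * \<eta> * a * l)" unfolding e2_def by (simp only:)
  have "- ((a + 2 * \<eta>) * \<tau> - (a + \<eta>) * \<tau>) * ((a + 2 * \<eta>) * s) = - (2 * \<eta> * (a + 2 * \<eta>) * l)" using ts by algebra
  then have e3: "e3 = exp (- (2 * \<eta> * (a + 2 * \<eta>) * l))" unfolding e3_def by (simp only:)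
  have "e2 * E a \<le> e2 * (A * exp (a\<^sup>2 * l))" using Eup[of a] a by (intro mult_left_mono) (auto simp: e2)
  also have "\<dots> = A * (F * exp (- (\<eta>\<^sup>2 * l)))" unfolding e2 F_def
    by (simp add: exp_add[symmetric] algebra_simps power2_eq_square)
  finally have m1: "e2 * E a \<le> A * (F * exp (- (\<eta>\<^sup>2 * l)))" .
  have "e3 * E (a + 2 * \<eta>) \<le> e3 * (A * exp ((a + 2 * \<eta>)\<^sup>2 * l))" using Eup[of "a + 2 * \<eta>"] a by (intro mult_left_mono) (auto simp: e3)
  also have "\<dots> = A * (F * exp (- (\<eta>\<^sup>2 * l)))" unfolding e3 F_def
    by (simp add: exp_add[symmetric] algebra_simps power2_eq_square)
  finally have m2: "e3 * E (a + 2 * \<eta>) \<le> A * (F * exp (- (\<eta>\<^sup>2 * l)))" .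
  have F: "0 < F" by (simp add: F_def)
  \<comment> \<open>Each correction is now at most F / (4 A), against a main term of at least F / A;
    half of it remains.\<close>
  have "exp (- (\<eta>\<^sup>2 * l)) \<le> 1 / (4 * A\<^sup>2)" using l(2) A_ge by (simp add: exp_minus field_simps)
  then have "A * (F * exp (- (\<eta>\<^sup>2 * l))) \<le> A * (F * (1 / (4 * A\<^sup>2)))" using F A_ge by (intro mult_left_mono) auto
  also have "\<dots> = F / (4 * A)" using A_ge by (simp add: power2_eq_square)
  finally have m3: "A * (F * exp (- (\<eta>\<^sup>2 * l))) \<le> F / (4 * A)" .
  have "F / A - F / (4 * A) - F / (4 * A) = F / (2 * A)" using A_ge by (simp add: field_simps)
  then have "F / (2 * A) \<le> E (a + \<eta>) - e2 * E a - e3 * E (a + 2 * \<eta>)"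
    using Elo[of "a + \<eta>"] a m1 m2 m3 unfolding F_def[symmetric] by simp
  then have "e1 * (F / (2 * A)) \<le> e1 * (E (a + \<eta>) - e2 * E a - e3 * E (a + 2 * \<eta>))" by (intro mult_left_mono) (auto simp: e1)
  moreover have "e1 * (F / (2 * A)) = exp (- ((a + \<eta>) * (a + 3 * \<eta>)) * l) / (2 * A)"
  proof -
    \<comment> \<open>The exponent arises as 2 (a + \<eta>)(a + 2 \<eta>) minus the square of a +
      \<eta>, which is (a + \<eta>)(a + 3 \<eta>).\<close>
    have "e1 * F = exp (- ((a + \<eta>) * (a + 3 * \<eta>)) * l)"
      unfolding e1 F_def by (simp add: exp_add[symmetric] algebra_simps power2_eq_square)
    then show ?thesis by simp
  qed
  ultimately show ?thesis using main unfolding s_def by linarith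
qed

text \<open>Ottaviani's inequality, with independence replaced by the quasi-Bernoulli property.\<close>
lemma maximal_inequality:
  assumes half: "\<And>m. m \<le> n \<Longrightarrow> prob {\<omega> \<in> S. - c \<le> X m \<omega>} \<ge> 1 / 2"
  shows "prob {\<omega> \<in> S. \<exists>j\<le>n. x \<le> X j \<omega>} \<le> 2 * C ^ 3 * prob {\<omega> \<in> S. x - c - 3 * ln C \<le> X n \<omega>}"
proof -
  \<comment> \<open>\<open>T j\<close> says that level x is first reached at time j, and
    \<open>R j\<close>, read after j shifts, that the remaining increment is not below - c.\<close>
  define T where "T j = (\<lambda>\<omega>. (\<forall>i\<in>{..<j}. X i \<omega> < x) \<and> x \<le> X j \<omega>)" for j
  define R where "R j = (\<lambda>\<omega>. - c \<le> X (n - j) \<omega>)" for j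
  have dT: "determined j (T j)" for j
    unfolding T_def by (intro determined_conj determined_ball determined_X) auto
  have dR: "determined (n - j) (R j)" for j unfolding R_def by (rule determined_X) simp
  define V where "V j = {\<omega> \<in> S. T j \<omega> \<and> R j ((shift ^^ j) \<omega>)}" for j
  have V: "V j \<in> sets \<mu>" if "j \<le> n" for j
    unfolding V_def by (rule determined_sets[of n], intro determined_conj determined_mono[OF dT that] determined_shift[OF dR]) (use that in simp)
  \<comment> \<open>The two conditions read disjoint stretches of symbols, so the quasi-Bernoulli
    bound applies; the probability at least 1/2 of \<open>R j\<close> is the source of the factor
    2.\<close>
  have TV: "prob {\<omega> \<in> S. T j \<omega>} \<le> 2 * C ^ 3 * prob (V j)" for j
  proof -
    have "prob {\<omega> \<in> S. T j \<omega>} * (1 / 2) \<le> prob {\<omega> \<in> S. T j \<omega>} * prob {\<omega> \<in> S. R j \<omega>}"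
      unfolding R_def using half[of "n - j"] by (intro mult_left_mono) auto
    also have "\<dots> \<le> C ^ 3 * prob (V j)"
      using quasi_bernoulli_determined(1)[OF dT dR, of j j] C_gt unfolding V_def by (simp add: field_simps)
    finally show ?thesis by simp
  qed
  have "{\<omega> \<in> S. \<exists>j\<le>n. x \<le> X j \<omega>} = (\<Union>j\<in>{..n}. {\<omega> \<in> S. T j \<omega>})"
  proof (intro equalityI subsetI)
    fix \<omega> assume w: "\<omega> \<in> {\<omega> \<in> S. \<exists>j\<le>n. x \<le> X j \<omega>}"
    then obtain j where j: "j \<le> n" "x \<le> X j \<omega>" by auto
    define i where "i = (LEAST j. x \<le> X j \<omega>)"
    have "x \<le> X i \<omega>" unfolding i_def by (rule LeastI[of "\<lambda>j. x \<le> X j \<omega>", OF j(2)])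
    moreover have "X k \<omega> < x" if "k < i" for k using not_less_Least[OF that[unfolded i_def]] by simp
    moreover have "i \<le> n" using Least_le[of "\<lambda>j. x \<le> X j \<omega>" j] j unfolding i_def by linarith
    ultimately show "\<omega> \<in> (\<Union>j\<in>{..n}. {\<omega> \<in> S. T j \<omega>})" using w by (auto simp: T_def)
  qed (auto simp: T_def)
  then have "prob {\<omega> \<in> S. \<exists>j\<le>n. x \<le> X j \<omega>} \<le> (\<Sum>j\<le>n. prob {\<omega> \<in> S. T j \<omega>})"
    using finite_measure_subadditive_finite[of "{..n}" "\<lambda>j. {\<omega> \<in> S. T j \<omega>}"] determined_sets[OF dT] by auto
  also have "\<dots> \<le> (\<Sum>j\<le>n. 2 * C ^ 3 * prob (V j))" by (intro sum_mono TV)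
  also have "\<dots> = 2 * C ^ 3 * prob (\<Union>j\<in>{..n}. V j)"
  proof -
    have "disjoint_family_on V {..n}"
      unfolding disjoint_family_on_def
    proof (intro ballI impI)
      fix i j :: nat assume "i \<noteq> j"
      have "False" if "\<omega> \<in> V i" "\<omega> \<in> V j" for \<omega>
        using that \<open>i \<noteq> j\<close> unfolding V_def T_def by (cases i j rule: linorder_cases) force+
      then show "V i \<inter> V j = {}" by blast
    qed
    then show ?thesis
      using finite_measure_finite_Union[of "{..n}" V] V by (simp add: image_subset_iff sum_distrib_left)
  qed
  also have "\<dots> \<le> 2 * C ^ 3 * prob {\<omega> \<in> S. x - c - 3 * ln C \<le> X n \<omega>}"
  proof (intro mult_left_mono finite_measure_mono)
    show "(\<Union>j\<in>{..n}. V j) \<subseteq> {\<omega> \<in> S. x - c - 3 * ln C \<le> X n \<omega>}"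
    proof
      fix \<omega> assume "\<omega> \<in> (\<Union>j\<in>{..n}. V j)"
      then obtain j where j: "j \<le> n" "\<omega> \<in> S" "x \<le> X j \<omega>" "- c \<le> X (n - j) ((shift ^^ j) \<omega>)"
        by (auto simp: V_def T_def R_def)
      then show "\<omega> \<in> {\<omega> \<in> S. x - c - 3 * ln C \<le> X n \<omega>}"
        using X_additive[OF j(2), of j "n - j"] by (auto simp: abs_le_iff)
    qed
    show "{\<omega> \<in> S. x - c - 3 * ln C \<le> X n \<omega>} \<in> sets \<mu>"
      by (rule determined_sets[OF determined_X[OF order_refl]])
  qed (use C_gt in auto)
  finally show ?thesis .
qed

end

lemma (in gibbs_normalized) conditional_bound_determined:
  assumes R: "determined l R"
    and p: "\<And>\<omega>. \<omega> \<in> S \<Longrightarrow> p \<le> (G ^^ n) (\<lambda>\<omega>. of_bool (E (prefix_of n \<omega>))) \<omega>"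
  shows "prob {\<omega> \<in> S. \<not> E (prefix_of n \<omega>) \<and> R ((shift ^^ n) \<omega>)} \<le> (1 - p) * prob {\<omega> \<in> S. R \<omega>}"
  using conditional_bound[OF p, of "\<lambda>w. R (prepend w (\<lambda>_. 1))" l]
  unfolding determined_eq[OF R, symmetric] .

lemma powr_mult_not_summable:
  fixes c q :: real assumes "0 < c" "q \<le> 1"
  shows "\<not> summable (\<lambda>k. (real (Suc k) * c) powr (- q))"
proof
  assume "summable (\<lambda>k. (real (Suc k) * c) powr (- q))"
  then have "summable (\<lambda>k. c powr q * ((real (Suc k) * c) powr (- q)))" by (rule summable_mult)
  also have "(\<lambda>k. c powr q * ((real (Suc k) * c) powr (- q))) = (\<lambda>k. real (Suc k) powr (- q))"
  proof
    fix k
    have "(real (Suc k) * c) powr (- q) = real (Suc k) powr (- q) * c powr (- q)" by (rule powr_mult)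
    moreover have "c powr q * c powr (- q) = 1" using assms(1) by (simp flip: powr_add)
    ultimately show "c powr q * ((real (Suc k) * c) powr (- q)) = real (Suc k) powr (- q)"
      by (metis mult.assoc mult.commute mult.right_neutral)
  qed
  finally have "summable (\<lambda>k. real k powr (- q))" by (subst (asm) summable_Suc_iff)
  then show False using assms(2) by (simp add: summable_real_powr_iff)
qed

lemma powr_mult_summable:
  fixes c q :: real assumes "0 < c" "1 < q"
  shows "summable (\<lambda>k. (real k * c) powr (- q))"
proof -
  have "summable (\<lambda>k. c powr (- q) * real k powr (- q))"
    using assms by (intro summable_mult) (simp add: summable_real_powr_iff)
  then show ?thesis using assms by (simp add: powr_mult mult.commute)
qed

section \<open>The two halves of the law of the iterated logarithm\<close>

context gibbs_clt begin

lemma lil_mono: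
  assumes "exp 1 \<le> x" "x \<le> y" shows "lil x \<le> lil y" "0 \<le> lil x" "0 \<le> ln (ln x)" "ln (ln x) \<le> ln (ln y)"
proof -
  have x: "0 < x" using assms(1) exp_gt_zero[of "1::real"] by linarith
  have "ln (exp 1) \<le> ln x" using assms x by (subst ln_le_cancel_iff) auto
  then have l: "1 \<le> ln x" by simp
  then show l0: "0 \<le> ln (ln x)" by simp
  have "ln x \<le> ln y" using assms x by (subst ln_le_cancel_iff) auto
  then show ll: "ln (ln x) \<le> ln (ln y)" using l by (subst ln_le_cancel_iff) auto
  show "lil x \<le> lil y" unfolding lil_def
    using assms rho_pos x l0 ll by (intro real_sqrt_le_mono mult_mono) auto
  show "0 \<le> lil x" unfolding lil_def using x l0 rho_pos by simp
qed

text \<open>The parameter giving deviations of the size of \<open>lil n\<close> is eventually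
  admissible in the moment bounds: it tends to 0, and so does n times its cube.\<close>

lemma small_parameters:
  assumes "0 < s"
  shows "\<forall>\<^sub>F n::nat in sequentially. s * sqrt (2 * ln (ln n) / (\<rho> * n)) \<le> t0 \<and> n * (s * sqrt (2 * ln (ln n) / (\<rho> * n))) ^ 3 \<le> 1"
proof -
  have "((\<lambda>y::real. s * sqrt (2 * ln (ln y) / (\<rho> * y))) \<longlongrightarrow> 0) at_top"
    using assms rho_pos by real_asymp
  from order_tendstoD(2)[OF this t0_pos]
  have "\<forall>\<^sub>F y in at_top. s * sqrt (2 * ln (ln y) / (\<rho> * y)) < t0" .
  moreover have "((\<lambda>y::real. y * (s * sqrt (2 * ln (ln y) / (\<rho> * y))) ^ 3) \<longlongrightarrow> 0) at_top"
    using assms rho_pos by real_asymp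
  from order_tendstoD(2)[OF this zero_less_one]
  have "\<forall>\<^sub>F y in at_top. y * (s * sqrt (2 * ln (ln y) / (\<rho> * y))) ^ 3 < 1" .
  ultimately have "\<forall>\<^sub>F y in at_top. s * sqrt (2 * ln (ln y) / (\<rho> * y)) \<le> t0 \<and> y * (s * sqrt (2 * ln (ln y) / (\<rho> * y))) ^ 3 \<le> 1"
    by eventually_elim auto
  then show ?thesis using filterlim_real_sequentially by (rule eventually_compose_filterlim)
qed

text \<open>Chernoff's bound at the optimal parameter \<sigma> s \<tau>: the exponent is the square
  of s times l - 2 l = - l, which makes a power of ln n. The sign \<sigma> selects the tail.\<close>

lemma tail_bound:
  assumes s: "0 < s" and sgn: "\<bar>\<sigma>\<bar> = 1"
  shows "\<forall>\<^sub>F n in sequentially. prob {\<omega> \<in> S. s * lil n \<le> \<sigma> * X n \<omega>} \<le> A * ln n powr (- s\<^sup>2)"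
proof -
  have "\<forall>\<^sub>F n::nat in sequentially. exp 1 \<le> real n" by real_asymp
  then show ?thesis using small_parameters[OF s]
  proof eventually_elim
    case (elim n)
    define l where "l = ln (ln (real n))"
    define \<tau> where "\<tau> = sqrt (2 * l / (\<rho> * n))"
    have n: "0 < real n" using elim(1) exp_gt_zero[of "1::real"] by linarith
    have l: "0 \<le> l" unfolding l_def by (rule lil_mono(3)[OF elim(1) order_refl])
    have tau: "0 \<le> \<tau>" unfolding \<tau>_def using l n rho_pos by simp
    have "(2 * l / (\<rho> * n)) * (2 * \<rho> * n * l) = (2 * l)\<^sup>2" using rho_pos n by (simp add: power2_eq_square)
    then have "\<tau> * lil n = sqrt ((2 * l)\<^sup>2)" unfolding \<tau>_def lil_def l_def[symmetric] real_sqrt_mult[symmetric] by (simp only:)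
    then have tl: "\<tau> * lil n = 2 * l" using l by (simp only: real_sqrt_abs)
    have t: "\<bar>\<sigma> * s * \<tau>\<bar> = s * \<tau>" using sgn s tau by (simp add: abs_mult)
    have "prob {\<omega> \<in> S. s * lil n \<le> \<sigma> * X n \<omega>} \<le> prob {\<omega> \<in> S. 2 * s\<^sup>2 * l \<le> (\<sigma> * s * \<tau>) * X n \<omega>}"
    proof (rule finite_measure_mono)
      show "{\<omega> \<in> S. s * lil n \<le> \<sigma> * X n \<omega>} \<subseteq> {\<omega> \<in> S. 2 * s\<^sup>2 * l \<le> (\<sigma> * s * \<tau>) * X n \<omega>}"
      proof (safe)
        fix \<omega> assume "s * lil n \<le> \<sigma> * X n \<omega>"
        then have "(s * \<tau>) * (s * lil n) \<le> (s * \<tau>) * (\<sigma> * X n \<omega>)" using s tau by (intro mult_left_mono) auto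
        moreover have "(s * \<tau>) * (s * lil n) = 2 * s\<^sup>2 * l" using tl by algebra
        ultimately show "2 * s\<^sup>2 * l \<le> (\<sigma> * s * \<tau>) * X n \<omega>" by (simp add: mult_ac)
      qed
      show "{\<omega> \<in> S. 2 * s\<^sup>2 * l \<le> (\<sigma> * s * \<tau>) * X n \<omega>} \<in> sets \<mu>"
        by (rule determined_sets[OF determined_X[OF order_refl]])
    qed
    also have "\<dots> \<le> A * exp (n * \<rho> * (\<sigma> * s * \<tau>)\<^sup>2 / 2 - 2 * s\<^sup>2 * l)"
      by (rule chernoff) (use elim(2) t in \<open>simp_all add: \<tau>_def l_def\<close>)
    also have "n * \<rho> * (\<sigma> * s * \<tau>)\<^sup>2 / 2 = s\<^sup>2 * l"
    proof -
      have "\<sigma>\<^sup>2 = 1" using sgn by (metis abs_1 abs_power2 power2_abs power_one)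
      then show ?thesis unfolding \<tau>_def using l n rho_pos by (simp add: power_mult_distrib)
    qed
    also have "exp (s\<^sup>2 * l - 2 * s\<^sup>2 * l) = ln n powr (- s\<^sup>2)"
    proof -
      have "1 < real n" using elim(1) exp_gt_one[of 1] by linarith
      then have "ln (real n) \<noteq> 0" by simp
      then show ?thesis by (simp add: powr_def l_def)
    qed
    finally show ?case .
  qed
qed

text \<open>Supplies the hypothesis of the maximal inequality, uniformly over m \<le> n, at a level
  of order sqrt n, which is negligible against \<open>lil n\<close>.\<close>

lemma median_bound:
  obtains c where "0 < c" "\<forall>\<^sub>F n in sequentially. \<forall>m\<le>n. 1 / 2 \<le> prob {\<omega> \<in> S. - (c * sqrt n) \<le> X m \<omega>}"
proof -
  \<comment> \<open>Chernoff's bound at t = - 1 / sqrt n is at most A * exp (\<rho> / 2 - c), and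
    this c makes it equal to 1/2.\<close>
  define c where "c = \<rho> / 2 + ln (2 * A)"
  have c: "0 < c" unfolding c_def using rho_pos A_ge by (intro add_pos_pos) auto
  have "((\<lambda>y::real. 1 / sqrt y) \<longlongrightarrow> 0) at_top" by real_asymp
  from order_tendstoD(2)[OF this t0_pos]
  have "\<forall>\<^sub>F n in sequentially. 1 / sqrt (real n) < t0"
    using filterlim_real_sequentially by (rule eventually_compose_filterlim)
  then have "\<forall>\<^sub>F n in sequentially. \<forall>m\<le>n. 1 / 2 \<le> prob {\<omega> \<in> S. - (c * sqrt n) \<le> X m \<omega>}"
    using eventually_gt_at_top[of 0]
  proof eventually_elim
    case (elim n)
    show ?case
    proof (intro allI impI)
      fix m assume m: "m \<le> n"
      have sn: "1 \<le> sqrt n" "0 < sqrt n" using elim by auto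
      let ?t = "- (1 / sqrt n)"
      have cube: "real m * \<bar>?t\<bar> ^ 3 \<le> 1"
      proof -
        have "real m * \<bar>?t\<bar> ^ 3 \<le> real n * \<bar>?t\<bar> ^ 3" using m by (intro mult_right_mono) auto
        also have "real n * \<bar>?t\<bar> ^ 3 = 1 / sqrt n"
        proof -
          have "real n = sqrt n * sqrt n" by simp
          then show ?thesis using sn by (simp add: power3_eq_cube field_simps)
        qed
        also have "\<dots> \<le> 1" using sn by simp
        finally show ?thesis .
      qed
      let ?P = "{\<omega> \<in> S. c \<le> ?t * X m \<omega>}" and ?Q = "{\<omega> \<in> S. - (c * sqrt n) \<le> X m \<omega>}"
      have "prob ?P \<le> A * exp (m * \<rho> * ?t\<^sup>2 / 2 - c)"
        by (rule chernoff) (use elim cube sn in auto)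
      also have "\<dots> \<le> A * exp (\<rho> / 2 - c)"
      proof -
        have "m * \<rho> * ?t\<^sup>2 = (m / n) * \<rho>" using elim by (simp add: power_divide)
        also have "\<dots> \<le> 1 * \<rho>" using m elim rho_pos by (intro mult_right_mono) auto
        finally show ?thesis using A_ge by (intro mult_left_mono) auto
      qed
      also have "A * exp (\<rho> / 2 - c) = 1 / 2" unfolding c_def using A_ge by (simp add: exp_minus exp_add field_simps)
      finally have P: "prob ?P \<le> 1 / 2" .
      have sets: "?P \<in> sets \<mu>" "?Q \<in> sets \<mu>" by (rule determined_sets[OF determined_X[OF order_refl]])+
      have sub: "S \<subseteq> ?P \<union> ?Q"
      proof
        fix \<omega> assume w: "\<omega> \<in> S"
        have "c \<le> ?t * X m \<omega>" if "\<not> - (c * sqrt n) \<le> X m \<omega>"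
        proof -
          have "c * sqrt n \<le> - X m \<omega>" using that by linarith
          then have "c * sqrt n * (1 / sqrt n) \<le> - X m \<omega> * (1 / sqrt n)" using sn by (intro mult_right_mono) auto
          then show ?thesis using sn by simp
        qed
        then show "\<omega> \<in> ?P \<union> ?Q" using w by blast
      qed
      have "prob (space \<mu>) \<le> prob (?P \<union> ?Q)"
        unfolding space_mu by (rule finite_measure_mono[OF sub sets.Un[OF sets]])
      also have "\<dots> \<le> prob ?P + prob ?Q" by (rule measure_Un_le[OF sets])
      finally show "1 / 2 \<le> prob ?Q" using P prob_space by linarith
    qed
  qed
  then show ?thesis using that c by blast
qed

text \<open>Along times with ratio sqrt D, the level sqrt D * lil at the end of a stretch grows like
  D to the power 3/4 times lil at its beginning. This stays below D * lil with room for the errors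
  of order sqrt y of the maximal inequality.\<close>

lemma lil_gap:
  assumes D: "1 < D"
  shows "\<forall>\<^sub>F y in at_top. sqrt D * lil (sqrt D * y) \<le> D * lil (y - 1) - c0 * sqrt (sqrt D * y) - c3"
proof -
  define \<theta> where "\<theta> = sqrt D"
  have th: "1 < \<theta>" using D by (simp add: \<theta>_def)
  define r where "r y = ((y - 1) * ln (ln (y - 1))) / (y * ln (ln (\<theta> * y)))" for y :: real
  define e where "e y = (c0 * sqrt (\<theta> * y) + c3) / sqrt (y * ln (ln (\<theta> * y)))" for y :: real
  have "(r \<longlongrightarrow> 1) at_top" unfolding r_def using th by real_asymp
  moreover have "(e \<longlongrightarrow> 0) at_top" unfolding e_def using th by real_asymp
  ultimately have "((\<lambda>y. D * sqrt (2 * \<rho>) * sqrt (r y) - e y) \<longlongrightarrow> D * sqrt (2 * \<rho>) * sqrt 1 - 0) at_top"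
    by (intro tendsto_intros)
  moreover have "sqrt D * sqrt (2 * \<rho>) * sqrt \<theta> < D * sqrt (2 * \<rho>) * sqrt 1 - 0"
  proof -
    have "sqrt \<theta> * 1 < sqrt \<theta> * sqrt \<theta>" by (rule mult_strict_left_mono) (use th in auto)
    then have "sqrt \<theta> < \<theta>" using th by simp
    then have "sqrt D * sqrt \<theta> < sqrt D * \<theta>" using D by simp
    also have "sqrt D * \<theta> = D" unfolding \<theta>_def using D by simp
    finally have "sqrt D * sqrt \<theta> * sqrt (2 * \<rho>) < D * sqrt (2 * \<rho>)" using rho_pos by simp
    then show ?thesis by (simp add: mult_ac)
  qed
  ultimately have "\<forall>\<^sub>F y in at_top. sqrt D * sqrt (2 * \<rho>) * sqrt \<theta> < D * sqrt (2 * \<rho>) * sqrt (r y) - e y"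
    by (rule order_tendstoD(1))
  moreover have "\<forall>\<^sub>F y::real in at_top. exp 1 + 1 \<le> y" by real_asymp
  ultimately show ?thesis
  proof eventually_elim
    case (elim y)
    have y: "0 < y" "exp 1 \<le> y" using elim(2) exp_gt_zero[of "1::real"] by linarith+
    have y1: "exp 1 < \<theta> * y"
    proof -
      have "1 * y < \<theta> * y" using th y by (intro mult_strict_right_mono) auto
      then show ?thesis using y by linarith
    qed
    have L: "0 < ln (ln (\<theta> * y))"
    proof -
      have "ln (exp 1) < ln (\<theta> * y)" using y1 th y by (subst ln_less_cancel_iff) auto
      then show ?thesis by simp
    qed
    define z where "z = sqrt (y * ln (ln (\<theta> * y)))"
    have z: "0 < z" unfolding z_def using L y by simp
    have "(sqrt D * sqrt (2 * \<rho>) * sqrt \<theta>) * z \<le> (D * sqrt (2 * \<rho>) * sqrt (r y) - e y) * z"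
      using elim(1) z by (intro mult_right_mono) auto
    moreover have "(sqrt D * sqrt (2 * \<rho>) * sqrt \<theta>) * z = sqrt D * lil (\<theta> * y)"
      unfolding z_def lil_def by (simp add: real_sqrt_mult mult_ac)
    moreover have "sqrt (r y) * z = sqrt ((y - 1) * ln (ln (y - 1)))"
      unfolding r_def z_def real_sqrt_mult[symmetric] using L y by simp
    moreover have "e y * z = c0 * sqrt (\<theta> * y) + c3" unfolding e_def z_def[symmetric] using z by simp
    moreover have "sqrt (2 * \<rho>) * sqrt ((y - 1) * ln (ln (y - 1))) = lil (y - 1)"
      unfolding lil_def real_sqrt_mult[symmetric] by (simp add: mult.assoc)
    moreover have "(D * sqrt (2 * \<rho>) * sqrt (r y) - e y) * z = D * (sqrt (2 * \<rho>) * (sqrt (r y) * z)) - e y * z" by (simp add: algebra_simps)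
    ultimately have "sqrt D * lil (\<theta> * y) \<le> D * lil (y - 1) - (c0 * sqrt (\<theta> * y) + c3)" by (simp only:)
    then show ?case unfolding \<theta>_def by simp
  qed
qed

text \<open>Borel--Cantelli along geometric times with ratio sqrt (1 + \<delta>); the maximal
  inequality covers the times in between. The k-th tail is of order k to the power - (1 + \<delta>),
  hence summable.\<close>

lemma lil_upper:
  assumes "0 < \<delta>"
  shows "AE \<omega> in \<mu>. \<forall>\<^sub>F n in sequentially. X n \<omega> \<le> (1 + \<delta>) * lil n"
proof -
  define D where "D = 1 + \<delta>"
  define \<theta> where "\<theta> = sqrt D"
  have D: "1 < D" using assms by (simp add: D_def)
  have th: "1 < \<theta>" using D by (simp add: \<theta>_def)
  define y where "y k = \<theta> ^ k" for k :: nat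
  define N where "N k = nat \<lfloor>y (Suc k)\<rfloor>" for k
  have y0: "0 < y k" for k using th by (simp add: y_def)
  have N: "real (N k) \<le> \<theta> * y k" "\<theta> * y k - 1 < real (N k)" for k
  proof -
    have "real (N k) = of_int \<lfloor>y (Suc k)\<rfloor>" using y0[of "Suc k"] unfolding N_def by (simp add: less_imp_le)
    then show "real (N k) \<le> \<theta> * y k" "\<theta> * y k - 1 < real (N k)" unfolding y_def power_Suc by linarith+
  qed
  have ylim: "filterlim y at_top sequentially" unfolding y_def using th by real_asymp
  have Nlim: "filterlim N at_top sequentially"
  proof -
    have "filterlim (\<lambda>k. \<theta> * y k - 1) at_top sequentially" unfolding y_def using th by real_asymp
    then have "filterlim (\<lambda>k. real (N k)) at_top sequentially"
      by (rule filterlim_at_top_mono) (intro always_eventually allI less_imp_le N(2))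
    then show ?thesis by (simp add: filterlim_sequentially_iff_filterlim_real)
  qed
  obtain c0 where c0: "0 < c0" "\<forall>\<^sub>F n in sequentially. \<forall>m\<le>n. 1 / 2 \<le> prob {\<omega> \<in> S. - (c0 * sqrt n) \<le> X m \<omega>}"
    by (rule median_bound) blast
  define E where "E k = {\<omega> \<in> S. \<exists>j\<le>N k. D * lil (y k - 1) \<le> X j \<omega>}" for k
  have E: "E k \<in> sets \<mu>" for k
  proof -
    have "determined (N k) (\<lambda>\<omega>. \<not> (\<forall>j\<in>{..N k}. \<not> D * lil (y k - 1) \<le> X j \<omega>))"
      by (rule determined_not, rule determined_ball, rule determined_not, rule determined_X) simp
    from determined_sets[OF this]
    have "{\<omega> \<in> S. \<not> (\<forall>j\<in>{..N k}. \<not> D * lil (y k - 1) \<le> X j \<omega>)} \<in> sets \<mu>" .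
    also have "{\<omega> \<in> S. \<not> (\<forall>j\<in>{..N k}. \<not> D * lil (y k - 1) \<le> X j \<omega>)} = E k"
      unfolding E_def Ball_def atMost_iff by blast
    finally show ?thesis .
  qed
  have bound: "\<forall>\<^sub>F k in sequentially. prob (E k) \<le> 2 * C ^ 3 * A * (real k * ln \<theta>) powr (- D)"
  proof -
    have e1: "\<forall>\<^sub>F k in sequentially. \<forall>m\<le>N k. 1 / 2 \<le> prob {\<omega> \<in> S. - (c0 * sqrt (N k)) \<le> X m \<omega>}"
      by (rule eventually_compose_filterlim[OF c0(2) Nlim])
    have "0 < sqrt D" using D by simp
    from tail_bound[OF this, of 1]
    have e2: "\<forall>\<^sub>F k in sequentially. prob {\<omega> \<in> S. sqrt D * lil (N k) \<le> 1 * X (N k) \<omega>} \<le> A * ln (N k) powr (- (sqrt D)\<^sup>2)"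
      by (intro eventually_compose_filterlim[OF _ Nlim]) auto
    have e3: "\<forall>\<^sub>F k in sequentially. sqrt D * lil (\<theta> * y k) \<le> D * lil (y k - 1) - c0 * sqrt (\<theta> * y k) - 3 * ln C"
      unfolding \<theta>_def by (rule eventually_compose_filterlim[OF lil_gap[OF D] ylim])
    have e4: "\<forall>\<^sub>F k in sequentially. 1 \<le> (\<theta> - 1) * y k" unfolding y_def using th by real_asymp
    have e5: "\<forall>\<^sub>F k in sequentially. exp 1 \<le> real (N k)"
      by (rule eventually_compose_filterlim[OF _ Nlim]) real_asymp
    show ?thesis using e1 e2 e3 e4 e5 eventually_gt_at_top[of 0]
    proof eventually_elim
      case (elim k)
      have "prob (E k) \<le> 2 * C ^ 3 * prob {\<omega> \<in> S. D * lil (y k - 1) - c0 * sqrt (N k) - 3 * ln C \<le> X (N k) \<omega>}"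
        unfolding E_def by (rule maximal_inequality) (use elim(1) in auto)
      also have "\<dots> \<le> 2 * C ^ 3 * prob {\<omega> \<in> S. sqrt D * lil (N k) \<le> 1 * X (N k) \<omega>}"
      proof (intro mult_left_mono finite_measure_mono)
        have "sqrt D * lil (N k) \<le> sqrt D * lil (\<theta> * y k)"
          using D by (intro mult_left_mono lil_mono(1)[OF elim(5) N(1)]) auto
        moreover have "c0 * sqrt (N k) \<le> c0 * sqrt (\<theta> * y k)" using c0(1) N(1) by simp
        ultimately have "sqrt D * lil (N k) \<le> D * lil (y k - 1) - c0 * sqrt (N k) - 3 * ln C" using elim(3) by linarith
        then show "{\<omega> \<in> S. D * lil (y k - 1) - c0 * sqrt (N k) - 3 * ln C \<le> X (N k) \<omega>} \<subseteq> {\<omega> \<in> S. sqrt D * lil (N k) \<le> 1 * X (N k) \<omega>}" by auto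
        show "{\<omega> \<in> S. sqrt D * lil (N k) \<le> 1 * X (N k) \<omega>} \<in> sets \<mu>"
          by (rule determined_sets[OF determined_X[OF order_refl]])
      qed (use C_gt in auto)
      also have "\<dots> \<le> 2 * C ^ 3 * (A * ln (N k) powr (- (sqrt D)\<^sup>2))"
        using elim(2) C_gt by (intro mult_left_mono) auto
      also have "\<dots> \<le> 2 * C ^ 3 * (A * (real k * ln \<theta>) powr (- D))"
      proof (intro mult_left_mono)
        have "y k \<le> N k" using N(2)[of k] elim(4) by (simp add: algebra_simps)
        then have "ln (y k) \<le> ln (N k)" using y0[of k] by (subst ln_le_cancel_iff) auto
        then have "real k * ln \<theta> \<le> ln (N k)" using th by (simp add: y_def ln_realpow)
        moreover have "0 < real k * ln \<theta>" using th elim(6) by simp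
        ultimately have "ln (N k) powr (- D) \<le> (real k * ln \<theta>) powr (- D)" using D by (intro powr_mono2') auto
        then show "ln (N k) powr (- (sqrt D)\<^sup>2) \<le> (real k * ln \<theta>) powr (- D)" using D by simp
      qed (use C_gt A_ge in auto)
      finally show ?case by (simp add: mult.assoc)
    qed
  qed
  have "summable (\<lambda>k. prob (E k))"
  proof (rule summable_comparison_test_ev)
    show "\<forall>\<^sub>F k in sequentially. norm (prob (E k)) \<le> 2 * C ^ 3 * A * (real k * ln \<theta>) powr (- D)"
      using bound by eventually_elim simp
    show "summable (\<lambda>k. 2 * C ^ 3 * A * (real k * ln \<theta>) powr (- D))"
      using th D by (intro summable_mult powr_mult_summable) auto
  qed
  then have "AE \<omega> in \<mu>. \<forall>\<^sub>F k in sequentially. \<omega> \<in> space \<mu> - E k"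
    by (intro borel_cantelli_AE1 E) (auto simp: less_top[symmetric])
  then show ?thesis
  proof eventually_elim
    case (elim \<omega>)
    then obtain k0 where k0: "\<And>k. k0 \<le> k \<Longrightarrow> \<omega> \<in> S \<and> \<omega> \<notin> E k"
      unfolding eventually_sequentially space_mu by blast
    have "\<forall>\<^sub>F k in sequentially. exp 1 + 1 \<le> y k" unfolding y_def using th by real_asymp
    then obtain k1 where k1: "\<And>k. k1 \<le> k \<Longrightarrow> exp 1 + 1 \<le> y k" unfolding eventually_sequentially by blast
    have "X n \<omega> \<le> (1 + \<delta>) * lil n" if n: "y (max k0 k1) \<le> real n" for n
    proof -
      have ex: "\<exists>k. real n < y k" using real_arch_pow[OF th, of "real n"] by (simp add: y_def)
      define j where "j = (LEAST k. real n < y k)"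
      have j: "real n < y j" unfolding j_def by (rule LeastI_ex[OF ex])
      have "max k0 k1 < j"
      proof (rule ccontr)
        assume "\<not> max k0 k1 < j"
        then have "y j \<le> y (max k0 k1)" unfolding y_def using th by (intro power_increasing) auto
        then show False using j n by linarith
      qed
      then obtain k where k: "j = Suc k" "max k0 k1 \<le> k" by (cases j) auto
      have nk: "y k \<le> real n" using not_less_Least[of k "\<lambda>k. real n < y k"] k(1) unfolding j_def[symmetric] by simp
      have "n \<le> N k" using j unfolding k(1) N_def by linarith
      then have "X n \<omega> < D * lil (y k - 1)" using k0[of k] k(2) unfolding E_def by force
      also have "\<dots> \<le> D * lil n" using D nk k1[of k] k(2) by (intro mult_left_mono lil_mono(1)) auto
      finally show ?thesis by (simp add: D_def)
    qed
    then show ?case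
      by (intro eventually_mono[OF eventually_compose_filterlim[OF eventually_ge_at_top filterlim_real_sequentially]])
  qed
qed

text \<open>The block increments along \<open>p\<^sup>k\<close> are not independent, but \<open>G\<^sup>n\<close> controls the law of a block
  given all later symbols, so the second Borel--Cantelli argument runs backwards, from the last
  block to the first.\<close>
lemma lil_lower:
  assumes d: "0 < \<delta>" "\<delta> < 1"
  shows "AE \<omega> in \<mu>. \<exists>\<^sub>\<infinity>n. (1 - \<delta>) * lil n \<le> X n \<omega>"
proof -
  \<comment> \<open>a + 3 \<eta> = 1 - \<delta> / 16, so q \<le> 1: this is exactly what makes the
    probabilities of large block increments have a divergent sum.\<close>
  define a where "a = 1 - \<delta> / 4"
  define \<eta> where "\<eta> = \<delta> / 16"
  define q where "q = (a + \<eta>) * (a + 3 * \<eta>)"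
  have a: "0 < a" "a \<le> 1" "0 < \<eta>" using d by (auto simp: a_def \<eta>_def)
  have q: "q \<le> 1" unfolding q_def using d by (intro mult_le_one) (auto simp: a_def \<eta>_def)
  \<comment> \<open>The ratio p of the blocks will be the square of s, so \<open>lil\<close> at the
    start of a block is at most 1/s of \<open>lil\<close> at its end; s \<ge> 16 / \<delta> makes
    that share small.\<close>
  obtain s :: nat where s: "16 / \<delta> \<le> real s" using real_arch_simple by blast
  have "16 < 16 / \<delta>" using d by (simp add: field_simps)
  then have s16: "16 < real s" using s by linarith
  define p where "p = s\<^sup>2"
  have rp: "real p = (real s)\<^sup>2" by (simp add: p_def)
  have p2: "2 \<le> real p"
  proof -
    have "16 * 16 \<le> real s * real s" using s16 by (intro mult_mono) auto
    then show ?thesis by (simp add: rp power2_eq_square)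
  qed
  then have p2': "2 \<le> p" by simp
  define nk where "nk k = p ^ k" for k :: nat
  define m where "m k = nk (Suc k) - nk k" for k
  define l where "l k = ln (ln (real (nk (Suc k))))" for k
  have nkmono: "nk i \<le> nk j" if "i \<le> j" for i j unfolding nk_def using that p2' by (intro power_increasing) auto
  have nkm: "nk k + m k = nk (Suc k)" for k using nkmono[of k "Suc k"] by (simp add: m_def)
  have rnk: "real (nk k) = real (nk (Suc k)) / p" for k using p2 by (simp add: nk_def)
  have rm: "real (m k) = real (nk (Suc k)) * (1 - 1 / p)" for k
    using nkm[of k] rnk[of k] by (simp add: algebra_simps)
  have lnnk: "ln (real (nk (Suc k))) = real (Suc k) * ln p" for k
    using p2 unfolding nk_def of_nat_power by (subst ln_realpow) auto
  have nklim: "filterlim (\<lambda>k. nk (Suc k)) at_top sequentially"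
  proof -
    have "filterlim (\<lambda>k. real p ^ Suc k) at_top sequentially" using p2 by real_asymp
    then show ?thesis by (simp add: filterlim_sequentially_iff_filterlim_real nk_def)
  qed
  define E where "E k = (\<lambda>w. a * sqrt (2 * \<rho> * m k * l k) \<le> info w)" for k
  define pk where "pk k = exp (- q * l k) / (2 * A)" for k
  have "\<forall>\<^sub>F k in sequentially. \<forall>\<omega>\<in>S. pk k \<le> (G ^^ m k) (\<lambda>\<omega>. of_bool (E k (prefix_of (m k) \<omega>))) \<omega>"
  proof -
    \<comment> \<open>The block length \<open>m k\<close> is at least half of
      \<open>nk (Suc k)\<close>; the factor sqrt 2 allows the admissibility condition to be checked
      at \<open>nk (Suc k)\<close>.\<close>
    define s' where "s' = (a + 2 * \<eta>) * sqrt 2"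
    have s': "0 < s'" using a by (simp add: s'_def)
    have e1: "\<forall>\<^sub>F k in sequentially. s' * sqrt (2 * ln (ln (nk (Suc k))) / (\<rho> * nk (Suc k))) \<le> t0 \<and> nk (Suc k) * (s' * sqrt (2 * ln (ln (nk (Suc k))) / (\<rho> * nk (Suc k)))) ^ 3 \<le> 1"
      by (rule eventually_compose_filterlim[OF small_parameters[OF s'] nklim])
    have "\<forall>\<^sub>F n::nat in sequentially. 0 < ln (ln (real n))" by real_asymp
    then have e2: "\<forall>\<^sub>F k in sequentially. 0 < l k" unfolding l_def by (rule eventually_compose_filterlim[OF _ nklim])
    have "filterlim (\<lambda>n::nat. exp (\<eta>\<^sup>2 * ln (ln (real n)))) at_top sequentially" using a(3) by real_asymp
    then have "\<forall>\<^sub>F n::nat in sequentially. 4 * A\<^sup>2 \<le> exp (\<eta>\<^sup>2 * ln (ln (real n)))" by (simp add: filterlim_at_top)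
    then have e3: "\<forall>\<^sub>F k in sequentially. 4 * A\<^sup>2 \<le> exp (\<eta>\<^sup>2 * l k)" unfolding l_def by (rule eventually_compose_filterlim[OF _ nklim])
    show ?thesis using e1 e2 e3
    proof eventually_elim
      case (elim k)
      have Npos: "0 < real (nk (Suc k))" using p2 by (simp add: nk_def)
      have mN: "real (nk (Suc k)) / 2 \<le> real (m k)"
      proof -
        have "1 / 2 \<le> 1 - 1 / real p" using p2 by (simp add: field_simps)
        then have "real (nk (Suc k)) * (1 / 2) \<le> real (nk (Suc k)) * (1 - 1 / p)" by (intro mult_left_mono) auto
        then show ?thesis unfolding rm by simp
      qed
      then have mpos: "0 < real (m k)" using Npos by linarith
      have "2 * l k / (\<rho> * m k) \<le> 2 * (2 * l k / (\<rho> * nk (Suc k)))"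
      proof -
        have "2 * l k / (\<rho> * m k) \<le> 2 * l k / (\<rho> * (nk (Suc k) / 2))"
          using mN mpos Npos rho_pos elim(2) by (intro divide_left_mono mult_left_mono mult_pos_pos) auto
        then show ?thesis by simp
      qed
      then have "sqrt (2 * l k / (\<rho> * m k)) \<le> sqrt 2 * sqrt (2 * l k / (\<rho> * nk (Suc k)))"
        unfolding real_sqrt_mult[symmetric] by (rule real_sqrt_le_mono)
      then have "(a + 2 * \<eta>) * sqrt (2 * l k / (\<rho> * m k)) \<le> (a + 2 * \<eta>) * (sqrt 2 * sqrt (2 * l k / (\<rho> * nk (Suc k))))"
        using a by (intro mult_left_mono) auto
      also have "\<dots> = s' * sqrt (2 * l k / (\<rho> * nk (Suc k)))" by (simp add: s'_def)
      finally have le: "(a + 2 * \<eta>) * sqrt (2 * l k / (\<rho> * m k)) \<le> s' * sqrt (2 * l k / (\<rho> * nk (Suc k)))" .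
      have nn: "0 \<le> (a + 2 * \<eta>) * sqrt (2 * l k / (\<rho> * m k))" using a elim(2) rho_pos by (intro mult_nonneg_nonneg) auto
      have c1: "(a + 2 * \<eta>) * sqrt (2 * l k / (\<rho> * m k)) \<le> t0" using le elim(1) unfolding l_def by linarith
      have "real (m k) * ((a + 2 * \<eta>) * sqrt (2 * l k / (\<rho> * m k))) ^ 3 \<le> real (nk (Suc k)) * (s' * sqrt (2 * l k / (\<rho> * nk (Suc k)))) ^ 3"
      proof (rule mult_mono)
        show "((a + 2 * \<eta>) * sqrt (2 * l k / (\<rho> * m k))) ^ 3 \<le> (s' * sqrt (2 * l k / (\<rho> * nk (Suc k)))) ^ 3"
          by (rule power_mono[OF le nn])
        show "0 \<le> ((a + 2 * \<eta>) * sqrt (2 * l k / (\<rho> * m k))) ^ 3" by (rule zero_le_power[OF nn])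
      qed (simp_all add: m_def)
      then have c2: "real (m k) * ((a + 2 * \<eta>) * sqrt (2 * l k / (\<rho> * m k))) ^ 3 \<le> 1" using elim(1) unfolding l_def by linarith
      show ?case
      proof
        fix \<omega> assume w: "\<omega> \<in> S"
        show "pk k \<le> (G ^^ m k) (\<lambda>\<omega>. of_bool (E k (prefix_of (m k) \<omega>))) \<omega>"
          using moderate_deviation_lower[OF w a(1,3) elim(2,3) _ c1 c2] mpos
          unfolding pk_def q_def E_def X_def by simp
      qed
    qed
  qed
  then obtain k0 where k0: "\<And>k \<omega>. k0 \<le> k \<Longrightarrow> \<omega> \<in> S \<Longrightarrow> pk k \<le> (G ^^ m k) (\<lambda>\<omega>. of_bool (E k (prefix_of (m k) \<omega>))) \<omega>"
    unfolding eventually_sequentially by blast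
  \<comment> \<open>None of the d blocks from number k on has a large increment; positions are
    counted from the start of block k.\<close>
  define R where "R k d = (\<lambda>\<omega>. \<forall>j\<in>{k..<k + d}. \<not> E j (prefix_of (m j) ((shift ^^ (nk j - nk k)) \<omega>)))" for k d
  have detR: "determined (nk (k + d) - nk k) (R k d)" for k d
    unfolding R_def
  proof (intro determined_ball determined_not determined_prefix_of_shift)
    fix j assume j: "j \<in> {k..<k + d}"
    then have "nk (Suc j) \<le> nk (k + d)" "nk k \<le> nk j" by (auto intro: nkmono)
    then show "nk j - nk k + m j \<le> nk (k + d) - nk k" using nkm[of j] by linarith
  qed
  have pk0: "0 < pk k" for k using A_ge by (simp add: pk_def)
  have Rb: "prob {\<omega> \<in> S. R k d \<omega>} \<le> exp (- (\<Sum>j\<in>{k..<k + d}. pk j))" if "k0 \<le> k" for k d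
    using that
  proof (induction d arbitrary: k)
    case 0
    then show ?case using prob_le_1 by simp
  next
    case (Suc d)
    \<comment> \<open>After removal of block k the event reads only later symbols, so the
      conditional bound for block k given its future contributes the factor 1 - pk k.\<close>
    have eq: "R k (Suc d) \<omega> \<longleftrightarrow> \<not> E k (prefix_of (m k) \<omega>) \<and> R (Suc k) d ((shift ^^ m k) \<omega>)" for \<omega>
    proof -
      have "{k..<k + Suc d} = insert k {Suc k..<Suc k + d}" by auto
      moreover have "(shift ^^ (nk j - nk (Suc k))) ((shift ^^ m k) \<omega>) = (shift ^^ (nk j - nk k)) \<omega>" if "j \<in> {Suc k..<Suc k + d}" for j
      proof -
        have "nk (Suc k) \<le> nk j" using that by (intro nkmono) auto
        then have "nk j - nk k = (nk j - nk (Suc k)) + m k" using nkm[of k] by linarith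
        then show ?thesis by (simp add: funpow_add)
      qed
      ultimately show ?thesis unfolding R_def by simp
    qed
    have "prob {\<omega> \<in> S. R k (Suc d) \<omega>} \<le> (1 - pk k) * prob {\<omega> \<in> S. R (Suc k) d \<omega>}"
      unfolding eq by (rule conditional_bound_determined[OF detR k0[OF Suc.prems]])
    also have "\<dots> \<le> exp (- pk k) * exp (- (\<Sum>j\<in>{Suc k..<Suc k + d}. pk j))"
    proof (intro mult_mono Suc.IH)
      show "1 - pk k \<le> exp (- pk k)" using exp_ge_add_one_self[of "- pk k"] by simp
    qed (use Suc.prems in auto)
    also have "\<dots> = exp (- (\<Sum>j\<in>{k..<k + Suc d}. pk j))"
    proof -
      have "{k..<k + Suc d} = insert k {Suc k..<Suc k + d}" by auto
      then show ?thesis by (simp flip: exp_add)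
    qed
    finally show ?case .
  qed
  \<comment> \<open>\<open>pk k\<close> is a constant times a power - q of (k + 1) ln p, with q
    \<le> 1.\<close>
  have nsum: "\<not> summable pk"
  proof
    assume "summable pk"
    then have "summable (\<lambda>k. 2 * A * pk k)" by (rule summable_mult)
    also have "(\<lambda>k. 2 * A * pk k) = (\<lambda>k. (real (Suc k) * ln p) powr (- q))"
    proof
      fix k
      have "real (Suc k) * ln p \<noteq> 0" using p2 by simp
      then show "2 * A * pk k = (real (Suc k) * ln p) powr (- q)" using A_ge
        by (simp add: pk_def l_def lnnk powr_def del: of_nat_Suc)
    qed
    finally show False using powr_mult_not_summable[of "ln p" q] q p2 by simp
  qed
  have io: "AE \<omega> in \<mu>. \<forall>k\<ge>k0. \<exists>j\<ge>k. E j (prefix_of (m j) ((shift ^^ nk j) \<omega>))"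
  proof -
    have "AE \<omega> in \<mu>. k0 \<le> k \<longrightarrow> (\<exists>j\<ge>k. E j (prefix_of (m j) ((shift ^^ nk j) \<omega>)))" for k
    proof (cases "k0 \<le> k")
      case True
      define B where "B d = {\<omega> \<in> S. R k d ((shift ^^ nk k) \<omega>)}" for d
      have Bs: "B d \<in> sets \<mu>" for d unfolding B_def
        by (rule determined_sets[of "nk k + (nk (k + d) - nk k)"], rule determined_shift[OF detR]) simp
      have Bm: "prob (B d) \<le> exp (- (\<Sum>j\<in>{k..<k + d}. pk j))" for d
        unfolding B_def measure_shift_determined[OF detR] by (rule Rb[OF True])
      have "prob (\<Inter>d. B d) \<le> e" if e: "0 < e" for e
      proof -
        have "\<exists>d. - ln e \<le> (\<Sum>j\<in>{k..<k + d}. pk j)"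
        proof (rule ccontr)
          assume "\<not> ?thesis"
          then have H: "(\<Sum>j\<in>{k..<k + d}. pk j) \<le> - ln e" for d by (meson linear)
          have "summable (\<lambda>i. pk (i + k))"
          proof (rule bounded_imp_summable)
            fix d
            have "(\<Sum>i\<le>d. pk (i + k)) = (\<Sum>j\<in>{k..<k + Suc d}. pk j)"
              using sum.shift_bounds_nat_ivl[of pk 0 k "Suc d"] by (simp add: atLeast0LessThan lessThan_Suc_atMost add.commute)
            then show "(\<Sum>i\<le>d. pk (i + k)) \<le> - ln e" using H[of "Suc d"] by simp
          qed (use pk0 less_imp_le in blast)
          then show False using nsum by (simp add: summable_iff_shift)
        qed
        then obtain d where dd: "- ln e \<le> (\<Sum>j\<in>{k..<k + d}. pk j)" by blast
        have "prob (\<Inter>d. B d) \<le> prob (B d)" using Bs by (intro finite_measure_mono) auto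
        also have "\<dots> \<le> exp (- (\<Sum>j\<in>{k..<k + d}. pk j))" by (rule Bm)
        also have "\<dots> \<le> exp (ln e)" using dd by simp
        finally show ?thesis using e by simp
      qed
      then have "prob (\<Inter>d. B d) \<le> 0" using field_le_epsilon[of "prob (\<Inter>d. B d)" 0] by simp
      then have "(\<Inter>d. B d) \<in> null_sets \<mu>"
        using Bs by (intro null_setsI) (auto simp: emeasure_eq_measure measure_le_0_iff)
      from AE_not_in[OF this] show ?thesis
      proof (rule AE_mp, intro AE_I2 impI)
        fix \<omega> assume w: "\<omega> \<in> space \<mu>" "\<omega> \<notin> (\<Inter>d. B d)"
        then obtain d where "\<not> R k d ((shift ^^ nk k) \<omega>)" by (auto simp: B_def space_mu)
        then obtain j where j: "k \<le> j" "E j (prefix_of (m j) ((shift ^^ (nk j - nk k)) ((shift ^^ nk k) \<omega>)))"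
          unfolding R_def by auto
        have "nk j - nk k + nk k = nk j" using nkmono[OF j(1)] by simp
        then have "(shift ^^ (nk j - nk k)) ((shift ^^ nk k) \<omega>) = (shift ^^ nk j) \<omega>"
          by (metis comp_apply funpow_add)
        then show "\<exists>j\<ge>k. E j (prefix_of (m j) ((shift ^^ nk j) \<omega>))" using j by auto
      qed
    qed simp
    then show ?thesis by (simp add: AE_all_countable)
  qed
  \<comment> \<open>A large block increment might be cancelled by a very negative past. The lower
    tail at level 2 has exponent 4 in ln n and is summable along \<open>nk\<close>, which rules this
    out.\<close>
  define F where "F k = {\<omega> \<in> S. 2 * lil (nk (Suc k)) \<le> - 1 * X (nk (Suc k)) \<omega>}" for k
  have Fs: "F k \<in> sets \<mu>" for k unfolding F_def by (rule determined_sets[OF determined_X[OF order_refl]])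
  have "summable (\<lambda>k. prob (F k))"
  proof (rule summable_comparison_test_ev)
    have "\<forall>\<^sub>F k in sequentially. prob (F k) \<le> A * ln (nk (Suc k)) powr (- 2\<^sup>2)"
      unfolding F_def by (rule eventually_compose_filterlim[OF tail_bound nklim]) auto
    then show "\<forall>\<^sub>F k in sequentially. norm (prob (F k)) \<le> A * (real (Suc k) * ln p) powr (- 4)"
      unfolding lnnk by eventually_elim simp
    have "summable (\<lambda>k. (real k * ln p) powr (- 4))" using p2 by (intro powr_mult_summable) auto
    then show "summable (\<lambda>k. A * (real (Suc k) * ln p) powr (- 4))"
      by (intro summable_mult) (subst summable_Suc_iff)
  qed
  then have bc: "AE \<omega> in \<mu>. \<forall>\<^sub>F k in sequentially. \<omega> \<in> space \<mu> - F k"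
    by (intro borel_cantelli_AE1 Fs) (auto simp: less_top[symmetric])
  have lilinf: "\<forall>\<^sub>F k in sequentially. exp 1 \<le> real (nk k) \<and> 6 * ln C / \<delta> \<le> lil (nk (Suc k))"
  proof -
    have "filterlim (\<lambda>n::nat. sqrt (2 * \<rho> * real n * ln (ln (real n)))) at_top sequentially" using rho_pos by real_asymp
    then have "\<forall>\<^sub>F n::nat in sequentially. 6 * ln C / \<delta> \<le> lil n" unfolding lil_def by (simp add: filterlim_at_top)
    then have "\<forall>\<^sub>F k in sequentially. 6 * ln C / \<delta> \<le> lil (nk (Suc k))" by (rule eventually_compose_filterlim[OF _ nklim])
    moreover have "\<forall>\<^sub>F k in sequentially. exp 1 \<le> real p ^ k" using p2 by real_asymp
    ultimately show ?thesis by eventually_elim (simp add: nk_def)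
  qed
  then obtain k1 where k1: "\<And>k. k1 \<le> k \<Longrightarrow> exp 1 \<le> real (nk k)" "\<And>k. k1 \<le> k \<Longrightarrow> 6 * ln C / \<delta> \<le> lil (nk (Suc k))"
    unfolding eventually_sequentially by blast
  show ?thesis using io bc AE_space
  proof eventually_elim
    case (elim \<omega>)
    then obtain k2 where k2: "\<And>k. k2 \<le> k \<Longrightarrow> \<omega> \<notin> F k" unfolding eventually_sequentially by blast
    have w: "\<omega> \<in> S" using elim(3) by (simp add: space_mu)
    show ?case unfolding INFM_nat_le
    proof
      fix M
      \<comment> \<open>The successor makes j = Suc i, so that \<open>F i\<close> concerns the time
        \<open>nk j\<close> at which block j starts.\<close>
      let ?k = "Suc (max (max M k0) (max k1 k2))"
      have "k0 \<le> ?k" by simp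
      with elim(1) obtain j where j: "?k \<le> j" "E j (prefix_of (m j) ((shift ^^ nk j) \<omega>))" by blast
      obtain i where i: "j = Suc i" using j(1) by (cases j) auto
      have ji: "k2 \<le> i" "k1 \<le> j" "M \<le> j" using j(1) i by auto
      let ?N = "real (nk (Suc j))" and ?L = "lil (nk (Suc j))"
      have ej: "exp 1 \<le> real (nk j)" by (rule k1(1)[OF ji(2)])
      have le: "real (nk j) \<le> ?N" using nkmono[of j "Suc j"] by simp
      have L0: "0 \<le> ?L" using lil_mono(2)[OF order_trans[OF ej le] order_refl] .
      have "- X (nk j) \<omega> < 2 * lil (nk j)" using k2[OF ji(1)] w unfolding F_def i by auto
      moreover have "lil (nk j) \<le> ?L / s"
      proof -
        have "lil (nk j) \<le> sqrt (2 * \<rho> * real (nk j) * ln (ln ?N))" unfolding lil_def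
          using lil_mono(4)[OF ej le] rho_pos by (intro real_sqrt_le_mono mult_left_mono) auto
        also have "2 * \<rho> * real (nk j) * ln (ln ?N) = (2 * \<rho> * ?N * ln (ln ?N)) / (real s)\<^sup>2"
          unfolding rnk[of j] rp by simp
        also have "sqrt \<dots> = ?L / s" unfolding lil_def real_sqrt_divide by simp
        finally show ?thesis .
      qed
      moreover have "a * (1 - 1 / p) * ?L \<le> X (m j) ((shift ^^ nk j) \<omega>)"
      proof -
        have p1: "0 \<le> 1 - 1 / real p" "1 - 1 / real p \<le> 1" using p2 by auto
        have "(1 - 1 / real p)\<^sup>2 \<le> 1 - 1 / real p" using p1 unfolding power2_eq_square by (intro mult_left_le) auto
        then have "1 - 1 / real p \<le> sqrt (1 - 1 / real p)" by (rule real_le_rsqrt)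
        then have "(1 - 1 / real p) * ?L \<le> sqrt (1 - 1 / real p) * ?L" using L0 by (intro mult_right_mono) auto
        also have "\<dots> = sqrt (2 * \<rho> * m j * l j)"
          unfolding lil_def l_def rm real_sqrt_mult[symmetric] by (simp add: mult_ac)
        finally have "a * ((1 - 1 / real p) * ?L) \<le> a * sqrt (2 * \<rho> * m j * l j)" using a by (intro mult_left_mono) auto
        also have "\<dots> \<le> X (m j) ((shift ^^ nk j) \<omega>)" using j(2) unfolding E_def X_def .
        finally show ?thesis by (simp add: mult.assoc)
      qed
      moreover have "\<bar>X (nk (Suc j)) \<omega> - (X (nk j) \<omega> + X (m j) ((shift ^^ nk j) \<omega>))\<bar> \<le> 3 * ln C"
        using X_additive[OF w, of "nk j" "m j"] unfolding nkm .
      \<comment> \<open>The losses are \<delta> / 4 from a, at most \<delta> / 16 from 1 / p and at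
        most \<delta> / 8 from the past, together less than \<delta> / 2; the other half absorbs 3
        ln C.\<close>
      moreover have "(1 - \<delta> / 2) * ?L \<le> a * (1 - 1 / p) * ?L - 2 * (?L / s)"
      proof -
        have s1: "1 / real s \<le> \<delta> / 16" using s s16 d by (simp add: field_simps)
        have "1 / real p \<le> 1 / real s" unfolding rp power2_eq_square using s16 by (intro divide_left_mono) auto
        then have p1: "1 / real p \<le> \<delta> / 16" using s1 by linarith
        have "a * (1 / real p) \<le> 1 * (1 / real p)" using a by (intro mult_right_mono) auto
        then have "1 - \<delta> / 2 \<le> a * (1 - 1 / p) - 2 * (1 / s)" using p1 s1 d by (simp add: a_def right_diff_distrib)
        then have "(1 - \<delta> / 2) * ?L \<le> (a * (1 - 1 / p) - 2 * (1 / s)) * ?L" using L0 by (intro mult_right_mono)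
        then show ?thesis by (simp add: algebra_simps)
      qed
      moreover have "3 * ln C \<le> \<delta> / 2 * ?L" using k1(2)[OF ji(2)] d by (simp add: field_simps)
      moreover have "(1 - \<delta>) * ?L = (1 - \<delta> / 2) * ?L - \<delta> / 2 * ?L" by (simp add: algebra_simps)
      ultimately have "(1 - \<delta>) * ?L \<le> X (nk (Suc j)) \<omega>" by (simp add: abs_le_iff)
      moreover have "M \<le> nk (Suc j)"
      proof -
        have "M \<le> Suc j" using ji by simp
        also have "Suc j < nk (Suc j)" unfolding nk_def using p2' by (intro power_gt_expt) auto
        finally show ?thesis by simp
      qed
      ultimately show "\<exists>n\<ge>M. (1 - \<delta>) * lil n \<le> X n \<omega>" by blast
    qed
  qed
qed

end

section \<open>Recurrence of symbol blocks\<close>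

text \<open>The shift by 2 keeps the logarithm positive from n = 0 on, so the terms decrease
  throughout, as Cauchy condensation requires.\<close>

lemma summable_inverse_log_square: "summable (\<lambda>n::nat. 1 / ((real n + 2) * (ln (real n + 2))\<^sup>2))"
proof (subst condensation_test)
  fix m :: nat
  show "1 / ((real (Suc m) + 2) * (ln (real (Suc m) + 2))\<^sup>2) \<le> 1 / ((real m + 2) * (ln (real m + 2))\<^sup>2)"
  proof (rule divide_left_mono)
    have "0 < ln (real m + 2)" "ln (real m + 2) \<le> ln (real (Suc m) + 2)" by auto
    then have "(ln (real m + 2))\<^sup>2 \<le> (ln (real (Suc m) + 2))\<^sup>2" by (intro power_mono) auto
    then show "(real m + 2) * (ln (real m + 2))\<^sup>2 \<le> (real (Suc m) + 2) * (ln (real (Suc m) + 2))\<^sup>2"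
      by (rule mult_mono[rotated]) auto
    have "0 < ln (real (Suc m) + 2)" by simp
    then show "0 < (real (Suc m) + 2) * (ln (real (Suc m) + 2))\<^sup>2 * ((real m + 2) * (ln (real m + 2))\<^sup>2)"
      using \<open>0 < ln (real m + 2)\<close> by simp
  qed simp
next
  have "summable (\<lambda>n. 1 / (ln 2)\<^sup>2 * (real n powr - 2))"
    by (intro summable_mult) (simp add: summable_real_powr_iff)
  moreover have "\<forall>\<^sub>F n in sequentially. norm (2 ^ n * (1 / ((real (2 ^ n) + 2) * (ln (real (2 ^ n) + 2))\<^sup>2))) \<le> 1 / (ln 2)\<^sup>2 * (real n powr - 2)"
    using eventually_gt_at_top[of 0]
  proof eventually_elim
    case (elim n)
    define T where "T = (2::real) ^ n"
    have T: "0 < T" "real (2 ^ n) = T" by (simp_all add: T_def)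
    have "ln T \<le> ln (T + 2)" using T(1) by (subst ln_le_cancel_iff) auto
    then have l: "real n * ln 2 \<le> ln (T + 2)" by (simp add: T_def ln_realpow)
    have "T * (1 / ((T + 2) * (ln (T + 2))\<^sup>2)) = (T / (T + 2)) * (1 / (ln (T + 2))\<^sup>2)" by simp
    also have "\<dots> \<le> 1 * (1 / (real n * ln 2)\<^sup>2)"
    proof (rule mult_mono)
      have p: "0 < real n * ln 2" using elim by simp
      then have "(real n * ln 2)\<^sup>2 \<le> (ln (T + 2))\<^sup>2" using l by (intro power_mono) auto
      moreover have lp: "0 < ln (T + 2)" using p l by linarith
      have "0 < (ln (T + 2))\<^sup>2 * (real n * ln 2)\<^sup>2" by (rule mult_pos_pos[OF zero_less_power[OF lp] zero_less_power[OF p]])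
      ultimately show "1 / (ln (T + 2))\<^sup>2 \<le> 1 / (real n * ln 2)\<^sup>2" by (intro divide_left_mono) auto
    qed (use T in auto)
    also have "\<dots> = 1 / (ln 2)\<^sup>2 * (real n powr - 2)"
      using elim by (simp add: powr_minus power_mult_distrib divide_inverse powr_numeral)
    finally have "T * (1 / ((T + 2) * (ln (T + 2))\<^sup>2)) \<le> 1 / (ln 2)\<^sup>2 * (real n powr - 2)" .
    moreover have "0 \<le> T * (1 / ((T + 2) * (ln (T + 2))\<^sup>2))" using T by simp
    ultimately show ?case unfolding T(2) T_def[symmetric] real_norm_def by (simp only: abs_of_nonneg)
  qed
  ultimately show "summable (\<lambda>n. 2 ^ n * (1 / ((real (2 ^ n) + 2) * (ln (real (2 ^ n) + 2))\<^sup>2)))"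
    by (rule summable_comparison_test_ev[rotated])
qed auto

lemma logc_nonneg: "0 \<le> logc x"
  by (simp add: logc_def)

lemma logc_mono: "x \<le> y \<Longrightarrow> logc x \<le> logc y"
  by (auto simp: logc_def)

lemma powr_three_halves: "0 < h \<Longrightarrow> h powr (3 / 2) = h * sqrt (h::real)"
proof -
  assume h: "0 < h"
  have "h powr (3 / 2) = h powr (1 + 1 / 2)" by simp
  also have "\<dots> = h * sqrt h" using h unfolding powr_add by (simp add: powr_half_sqrt)
  finally show ?thesis .
qed

context gibbs_clt begin

lemma h_positive: "0 < h"
  by (rule h_pos[OF K_ge_2])

lemma cylinder_info:
  assumes "w \<in> words K k" shows "prob (cylinder K w) = exp (info w - k * h)"
  using cylinder_pos[OF assms] assms by (simp add: info_def words_def)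

lemma measure_prefix_eq:
  assumes "w \<in> words K k" shows "prob {\<omega> \<in> S. prefix_of k \<omega> = w} = prob (cylinder K w)"
proof -
  have "{\<omega> \<in> S. prefix_of k \<omega> = w} = cylinder K w"
    using cylinder_prefix_of[of w k] assms by (auto simp: words_def)
  then show ?thesis by simp
qed

text \<open>Since k \<le> n, the two occurrences of the block do not overlap. Quasi-Bernoulli bounds
  the pair by the square of the cylinder measure; one factor is at most exp (B - k h), and the other
  sums to 1.\<close>

lemma match_upper:
  assumes "k \<le> n"
  shows "prob {\<omega> \<in> S. agree k ((shift ^^ n) \<omega>) \<omega> \<and> X k \<omega> \<le> B} \<le> C ^ 3 * exp (B - k * h)"
proof -
  let ?W = "{w \<in> words K k. info w \<le> B}"
  let ?Z = "\<lambda>w. {\<omega> \<in> S. prefix_of k \<omega> = w \<and> prefix_of k ((shift ^^ n) \<omega>) = w}"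
  have Z: "?Z w \<in> sets \<mu>" for w
  proof (rule determined_sets[of "n + k"], rule determined_conj)
    show "determined (n + k) (\<lambda>\<omega>. prefix_of k \<omega> = w)" by (rule determined_prefix_of) simp
    show "determined (n + k) (\<lambda>\<omega>. prefix_of k ((shift ^^ n) \<omega>) = w)" by (rule determined_prefix_of_shift) simp
  qed
  have "{\<omega> \<in> S. agree k ((shift ^^ n) \<omega>) \<omega> \<and> X k \<omega> \<le> B} \<subseteq> (\<Union>w\<in>?W. ?Z w)"
    by (auto simp: prefix_of_eq_iff X_def)
  then have "prob {\<omega> \<in> S. agree k ((shift ^^ n) \<omega>) \<omega> \<and> X k \<omega> \<le> B} \<le> prob (\<Union>w\<in>?W. ?Z w)"
    by (rule finite_measure_mono) (intro sets.finite_UN Z, simp)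
  also have "\<dots> \<le> (\<Sum>w\<in>?W. prob (?Z w))"
    by (rule finite_measure_subadditive_finite) (use Z in auto)
  also have "\<dots> \<le> (\<Sum>w\<in>?W. C ^ 3 * exp (B - k * h) * prob (cylinder K w))"
  proof (rule sum_mono)
    fix w assume w: "w \<in> ?W"
    have "prob (?Z w) \<le> C ^ 3 * (prob {\<omega> \<in> S. prefix_of k \<omega> = w} * prob {\<omega> \<in> S. prefix_of k \<omega> = w})"
      by (rule quasi_bernoulli_determined(2)[OF determined_prefix_of[OF assms] determined_prefix_of[OF order_refl]])
    also have "\<dots> = C ^ 3 * prob (cylinder K w) * prob (cylinder K w)"
      using measure_prefix_eq[of w k] w by simp
    also have "\<dots> \<le> C ^ 3 * exp (B - k * h) * prob (cylinder K w)"
      using cylinder_info[of w k] w C_gt by (intro mult_right_mono mult_left_mono) auto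
    finally show "prob (?Z w) \<le> C ^ 3 * exp (B - k * h) * prob (cylinder K w)" .
  qed
  also have "\<dots> \<le> C ^ 3 * exp (B - k * h) * (\<Sum>w\<in>words K k. prob (cylinder K w))"
    unfolding sum_distrib_left[symmetric] using C_gt by (intro mult_left_mono sum_mono2) auto
  finally show ?thesis by (simp add: sum_cylinders)
qed

lemma determined_no_return:
  "determined (Suc M * k) (\<lambda>\<omega>. \<forall>j\<in>{1..M}. prefix_of k ((shift ^^ (j * k)) \<omega>) \<noteq> w)"
proof (rule determined_ball, rule determined_prefix_of_shift)
  fix j assume "j \<in> {1..M}"
  then have "Suc j * k \<le> Suc M * k" by (intro mult_right_mono) auto
  then show "j * k + k \<le> Suc M * k" by simp
qed

text \<open>Only starting positions that are multiples of k are inspected, so the blocks are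
  disjoint and each failure contributes a factor 1 - p / C ^ 3.\<close>

lemma no_match_word:
  assumes w: "w \<in> words K k"
  shows "prob {\<omega> \<in> S. prefix_of k \<omega> = w \<and> (\<forall>j\<in>{1..M}. prefix_of k ((shift ^^ (j * k)) \<omega>) \<noteq> w)}
    \<le> prob (cylinder K w) * (1 - prob (cylinder K w) / C ^ 3) ^ M"
proof (induction M)
  case 0
  then show ?case using measure_prefix_eq[OF w] by simp
next
  case (Suc M)
  define Q where "Q M = (\<lambda>\<omega>. prefix_of k \<omega> = w \<and> (\<forall>j\<in>{1..M}. prefix_of k ((shift ^^ (j * k)) \<omega>) \<noteq> w))" for M
  have dQ: "determined (Suc M * k) (Q M)"
    unfolding Q_def
  proof (rule determined_conj)
    show "determined (Suc M * k) (\<lambda>\<omega>. prefix_of k \<omega> = w)" by (rule determined_prefix_of) simp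
    show "determined (Suc M * k) (\<lambda>\<omega>. \<forall>j\<in>{1..M}. prefix_of k ((shift ^^ (j * k)) \<omega>) \<noteq> w)"
      by (rule determined_no_return)
  qed
  let ?p = "prob (cylinder K w)"
  let ?V = "{\<omega> \<in> S. Q M \<omega> \<and> prefix_of k ((shift ^^ (Suc M * k)) \<omega>) = w}"
  have V: "?V \<in> sets \<mu>"
    by (rule determined_sets[of "Suc M * k + k"], rule determined_conj[OF determined_mono[OF dQ] determined_prefix_of_shift]) auto
  have QM: "{\<omega> \<in> S. Q M \<omega>} \<in> sets \<mu>" by (rule determined_sets[OF dQ])
  have "prob {\<omega> \<in> S. Q M \<omega>} * ?p / C ^ 3 \<le> prob ?V"
    using quasi_bernoulli_determined(1)[OF dQ determined_prefix_of[OF order_refl[of k], where Q = "\<lambda>v. v = w"]]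
    unfolding measure_prefix_eq[OF w] .
  moreover have "prob {\<omega> \<in> S. Q (Suc M) \<omega>} = prob {\<omega> \<in> S. Q M \<omega>} - prob ?V"
  proof -
    have eq: "{\<omega> \<in> S. Q (Suc M) \<omega>} = {\<omega> \<in> S. Q M \<omega>} - ?V"
      unfolding Q_def by (auto simp: atLeastAtMostSuc_conv)
    have "?V \<subseteq> {\<omega> \<in> S. Q M \<omega>}" by blast
    then show ?thesis unfolding eq by (rule finite_measure_Diff[OF QM V])
  qed
  ultimately have "prob {\<omega> \<in> S. Q (Suc M) \<omega>} \<le> prob {\<omega> \<in> S. Q M \<omega>} * (1 - ?p / C ^ 3)"
    by (simp add: algebra_simps)
  also have "\<dots> \<le> (?p * (1 - ?p / C ^ 3) ^ M) * (1 - ?p / C ^ 3)"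
  proof (intro mult_right_mono)
    show "prob {\<omega> \<in> S. Q M \<omega>} \<le> ?p * (1 - ?p / C ^ 3) ^ M" using Suc.IH by (simp add: Q_def)
    have "1 \<le> C ^ 3" using C_gt by (intro one_le_power) simp
    then have "?p / C ^ 3 \<le> 1 / 1" using prob_le_1[of "cylinder K w"] by (intro frac_le) auto
    then show "0 \<le> 1 - ?p / C ^ 3" by simp
  qed
  finally show ?case by (simp add: Q_def mult_ac)
qed

text \<open>Large \<open>X\<close> means that the cylinder has mass at least exp (B - k h); the
  power of 1 - p / C ^ 3 is then bounded by an exponential, uniformly over these words.\<close>

lemma no_match:
  "prob {\<omega> \<in> S. B \<le> X k \<omega> \<and> (\<forall>j\<in>{1..M}. \<not> agree k ((shift ^^ (j * k)) \<omega>) \<omega>)}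
    \<le> exp (- (M * exp (B - k * h) / C ^ 3))"
proof -
  let ?W = "{w \<in> words K k. B \<le> info w}"
  let ?Z = "\<lambda>w. {\<omega> \<in> S. prefix_of k \<omega> = w \<and> (\<forall>j\<in>{1..M}. prefix_of k ((shift ^^ (j * k)) \<omega>) \<noteq> w)}"
  have Z: "?Z w \<in> sets \<mu>" for w
  proof (rule determined_sets[of "Suc M * k"], rule determined_conj)
    show "determined (Suc M * k) (\<lambda>\<omega>. prefix_of k \<omega> = w)" by (rule determined_prefix_of) simp
    show "determined (Suc M * k) (\<lambda>\<omega>. \<forall>j\<in>{1..M}. prefix_of k ((shift ^^ (j * k)) \<omega>) \<noteq> w)"
      by (rule determined_no_return)
  qed
  have "{\<omega> \<in> S. B \<le> X k \<omega> \<and> (\<forall>j\<in>{1..M}. \<not> agree k ((shift ^^ (j * k)) \<omega>) \<omega>)} \<subseteq> (\<Union>w\<in>?W. ?Z w)"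
    by (auto simp: prefix_of_eq_iff X_def)
  then have "prob {\<omega> \<in> S. B \<le> X k \<omega> \<and> (\<forall>j\<in>{1..M}. \<not> agree k ((shift ^^ (j * k)) \<omega>) \<omega>)} \<le> prob (\<Union>w\<in>?W. ?Z w)"
    by (rule finite_measure_mono) (intro sets.finite_UN Z, simp)
  also have "\<dots> \<le> (\<Sum>w\<in>?W. prob (?Z w))"
    by (rule finite_measure_subadditive_finite) (use Z in auto)
  also have "\<dots> \<le> (\<Sum>w\<in>?W. exp (- (M * exp (B - k * h) / C ^ 3)) * prob (cylinder K w))"
  proof (rule sum_mono)
    fix w assume w: "w \<in> ?W"
    let ?p = "prob (cylinder K w)"
    have C3: "1 \<le> C ^ 3" using C_gt by (intro one_le_power) simp
    have le1: "?p / C ^ 3 \<le> 1 / 1" using C3 prob_le_1[of "cylinder K w"] by (intro frac_le) auto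
    have pB: "exp (B - k * h) \<le> ?p" using cylinder_info[of w k] w by simp
    have "prob (?Z w) \<le> ?p * (1 - ?p / C ^ 3) ^ M" by (rule no_match_word) (use w in simp)
    also have "\<dots> \<le> ?p * exp (- (?p / C ^ 3)) ^ M"
      using exp_ge_add_one_self[of "- (?p / C ^ 3)"] le1 by (intro mult_left_mono power_mono) auto
    also have "exp (- (?p / C ^ 3)) ^ M = exp (- (M * (?p / C ^ 3)))" by (simp add: exp_of_nat_mult[symmetric])
    also have "?p * exp (- (M * (?p / C ^ 3))) \<le> ?p * exp (- (M * exp (B - k * h) / C ^ 3))"
    proof -
      have "M * exp (B - k * h) / C ^ 3 \<le> M * ?p / C ^ 3"
        using C_gt by (intro divide_right_mono mult_left_mono pB) auto
      then show ?thesis by (intro mult_left_mono) auto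
    qed
    finally show "prob (?Z w) \<le> exp (- (M * exp (B - k * h) / C ^ 3)) * ?p" by (simp add: mult.commute)
  qed
  also have "\<dots> \<le> exp (- (M * exp (B - k * h) / C ^ 3)) * (\<Sum>w\<in>words K k. prob (cylinder K w))"
    unfolding sum_distrib_left[symmetric] by (intro mult_left_mono sum_mono2) auto
  finally show ?thesis by (simp add: sum_cylinders)
qed

lemma determined_agree_shift: "n + k \<le> l \<Longrightarrow> determined l (\<lambda>\<omega>. agree k ((shift ^^ n) \<omega>) \<omega>)"
  by (auto simp: determined_def agree_def shift_funpow)

text \<open>Here L stands for ln n. Divided by sqrt (L ln ln L), the comparison is between h
  \<kappa> = (1 + \<epsilon>) sqrt (2 \<rho> / h) and (1 + \<delta>) sqrt (2 \<rho> / h); the terms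
  c and 3 ln L are of lower order.\<close>

lemma rate_gap_upper:
  fixes \<epsilon> \<delta> c :: real
  assumes "0 \<le> \<delta>" "\<delta> < \<epsilon>"
  defines "\<kappa> \<equiv> (1 + \<epsilon>) / h powr (3 / 2) * sqrt (2 * \<rho>)"
  shows "\<forall>\<^sub>F L in at_top. L + 3 * ln L \<le> h * (L / h + \<kappa> * sqrt (L * ln (ln L)) - c) - (1 + \<delta>) * lil (L / h + \<kappa> * sqrt (L * ln (ln L)) + 1)"
proof -
  note h = h_positive
  define hh where "hh = h"
  have hh: "0 < hh" using h by (simp add: hh_def)
  have k: "0 < \<kappa>" unfolding \<kappa>_def using assms rho_pos h by simp
  define r where "r L = ((L / hh + \<kappa> * sqrt (L * ln (ln L)) + 1) * ln (ln (L / hh + \<kappa> * sqrt (L * ln (ln L)) + 1))) / (L * ln (ln L))" for L :: real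
  define e where "e L = (hh * c + 3 * ln L) / sqrt (L * ln (ln L))" for L :: real
  have "(r \<longlongrightarrow> inverse hh) at_top" unfolding r_def using hh k by real_asymp
  then have "(r \<longlongrightarrow> 1 / hh) at_top" by (simp add: inverse_eq_divide)
  moreover have "(e \<longlongrightarrow> 0) at_top" unfolding e_def by real_asymp
  ultimately have "((\<lambda>L. hh * \<kappa> - (1 + \<delta>) * (sqrt (2 * \<rho>) * sqrt (r L)) - e L) \<longlongrightarrow> hh * \<kappa> - (1 + \<delta>) * (sqrt (2 * \<rho>) * sqrt (1 / hh)) - 0) at_top"
    by (intro tendsto_intros)
  moreover have "0 < hh * \<kappa> - (1 + \<delta>) * (sqrt (2 * \<rho>) * sqrt (1 / hh)) - 0"
  proof -
    have "hh * \<kappa> = (1 + \<epsilon>) * (sqrt (2 * \<rho>) * sqrt (1 / hh))"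
      unfolding \<kappa>_def hh_def powr_three_halves[OF h] using h by (simp add: real_sqrt_divide)
    moreover have "(1 + \<delta>) * (sqrt (2 * \<rho>) * sqrt (1 / hh)) < (1 + \<epsilon>) * (sqrt (2 * \<rho>) * sqrt (1 / hh))"
      using assms hh rho_pos by (intro mult_strict_right_mono) auto
    ultimately show ?thesis by simp
  qed
  ultimately have "\<forall>\<^sub>F L in at_top. 0 < hh * \<kappa> - (1 + \<delta>) * (sqrt (2 * \<rho>) * sqrt (r L)) - e L" by (rule order_tendstoD(1))
  moreover have "\<forall>\<^sub>F L::real in at_top. 0 < L * ln (ln L)" by real_asymp
  ultimately show ?thesis
  proof eventually_elim
    case (elim L)
    define z where "z = sqrt (L * ln (ln L))"
    have z: "0 < z" using elim(2) by (simp add: z_def)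
    have rz: "sqrt (2 * \<rho>) * sqrt (r L) * z = lil (L / hh + \<kappa> * z + 1)"
    proof -
      let ?y = "L / hh + \<kappa> * z + 1"
      have "L * ln (ln L) \<noteq> 0" using elim(2) by linarith
      then have "r L * (L * ln (ln L)) = ?y * ln (ln ?y)" unfolding r_def z_def by (metis nonzero_eq_divide_eq)
      then have "sqrt (2 * \<rho>) * sqrt (r L) * z = sqrt (2 * \<rho> * (?y * ln (ln ?y)))"
        unfolding z_def mult.assoc[of "2 * \<rho>" "r L"] real_sqrt_mult[symmetric]
        by (simp only: mult.assoc)
      then show ?thesis by (simp only: lil_def mult.assoc)
    qed
    have ez: "e L * z = hh * c + 3 * ln L" unfolding e_def z_def[symmetric] using z by simp
    have "0 \<le> (hh * \<kappa> - (1 + \<delta>) * (sqrt (2 * \<rho>) * sqrt (r L)) - e L) * z" using elim(1) z by simp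
    also have "\<dots> = hh * \<kappa> * z - (1 + \<delta>) * (sqrt (2 * \<rho>) * sqrt (r L) * z) - e L * z" by (simp add: algebra_simps)
    also have "\<dots> = hh * \<kappa> * z - (1 + \<delta>) * lil (L / hh + \<kappa> * z + 1) - (hh * c + 3 * ln L)" unfolding rz ez ..
    finally have "L + 3 * ln L \<le> (L + hh * \<kappa> * z - hh * c) - (1 + \<delta>) * lil (L / hh + \<kappa> * z + 1)" by linarith
    moreover have "L + hh * \<kappa> * z - hh * c = hh * (L / hh + \<kappa> * z - c)" using hh by (simp add: field_simps)
    ultimately show ?case unfolding hh_def z_def by simp
  qed
qed

text \<open>The upper law of the iterated logarithm, taken along the lengths \<open>k n\<close>,
  discards too heavy cylinders; for the remaining ones the matching probabilities are summable in n.
  The constant c leaves room for passing between symbols and distance.\<close>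

theorem recurrence_upper:
  fixes c \<epsilon> :: real
  assumes eps: "0 < \<epsilon>" and c: "0 \<le> c"
  shows "AE \<omega> in \<mu>. \<forall>\<^sub>F n in sequentially. \<not> agree (nat \<lceil>psi_plus h \<rho> \<epsilon> n - c\<rceil>) ((shift ^^ n) \<omega>) \<omega>"
proof -
  define k where "k n = nat \<lceil>psi_plus h \<rho> \<epsilon> n - c\<rceil>" for n :: nat
  define \<delta> where "\<delta> = \<epsilon> / 2"
  have d: "0 < \<delta>" "\<delta> < \<epsilon>" using eps by (auto simp: \<delta>_def)
  define \<kappa> where "\<kappa> = (1 + \<epsilon>) / h powr (3 / 2) * sqrt (2 * \<rho>)"
  have kap: "0 < \<kappa>" unfolding \<kappa>_def using eps rho_pos h_positive by simp
  define \<Psi> where "\<Psi> L = L / h + \<kappa> * sqrt (L * ln (ln L))" for L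
  have lnlim: "filterlim (\<lambda>n::nat. ln (real n)) at_top sequentially" by real_asymp
  have psi: "\<forall>\<^sub>F n::nat in sequentially. psi_plus h \<rho> \<epsilon> n = \<Psi> (ln n)"
  proof -
    have "\<forall>\<^sub>F n::nat in sequentially. 1 < real n \<and> 1 < ln (real n) \<and> 1 < ln (ln (real n))"
      by (intro eventually_conj) real_asymp+
    then show ?thesis
    proof eventually_elim
      case (elim n)
      have "sqrt (2 * \<rho> * ln n * ln (ln (ln n))) = sqrt (2 * \<rho>) * sqrt (ln n * ln (ln (ln n)))"
        unfolding real_sqrt_mult[symmetric] by (simp add: mult.assoc)
      then show ?case using elim by (simp add: psi_plus_def logc_def \<Psi>_def \<kappa>_def)
    qed
  qed
  have bound: "\<forall>\<^sub>F n in sequentially. k n \<le> n \<and> (1 + \<delta>) * lil (k n) - k n * h \<le> - (ln n + 3 * ln (ln n))"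
  proof -
    define hh where "hh = h"
    have hh: "0 < hh" using h_positive by (simp add: hh_def)
    have "\<forall>\<^sub>F n::nat in sequentially. ln n / hh + \<kappa> * sqrt (ln n * ln (ln (ln n))) + 1 \<le> real n" using hh kap by real_asymp
    then have e1: "\<forall>\<^sub>F n::nat in sequentially. \<Psi> (ln n) + 1 \<le> real n" by (simp add: \<Psi>_def hh_def)
    have "\<forall>\<^sub>F n::nat in sequentially. exp 1 + c \<le> ln n / hh + \<kappa> * sqrt (ln n * ln (ln (ln n)))" using hh kap by real_asymp
    then have e2: "\<forall>\<^sub>F n::nat in sequentially. exp 1 + c \<le> \<Psi> (ln n)" by (simp add: \<Psi>_def hh_def)
    have e3: "\<forall>\<^sub>F n::nat in sequentially. ln n + 3 * ln (ln n) \<le> h * (\<Psi> (ln n) - c) - (1 + \<delta>) * lil (\<Psi> (ln n) + 1)"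
      unfolding \<Psi>_def \<kappa>_def by (rule eventually_compose_filterlim[OF rate_gap_upper[OF less_imp_le[OF d(1)] d(2), of c] lnlim])
    show ?thesis using psi e1 e2 e3
    proof eventually_elim
      case (elim n)
      have pos: "0 < \<Psi> (ln n) - c" using elim(3) exp_gt_zero[of "1::real"] by linarith
      have kr: "\<Psi> (ln n) - c \<le> real (k n)" "real (k n) \<le> \<Psi> (ln n) + 1"
        unfolding k_def elim(1) using pos c by linarith+
      have ek: "exp 1 \<le> real (k n)" using elim(3) kr by linarith
      have "(1 + \<delta>) * lil (k n) \<le> (1 + \<delta>) * lil (\<Psi> (ln n) + 1)"
        using d by (intro mult_left_mono lil_mono(1)[OF ek kr(2)]) auto
      moreover have "h * (\<Psi> (ln n) - c) \<le> h * real (k n)" using kr h_positive by (intro mult_left_mono) auto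
      ultimately have "(1 + \<delta>) * lil (k n) - k n * h \<le> - (ln n + 3 * ln (ln n))" using elim(4) by (simp add: mult.commute)
      moreover have "k n \<le> n" using kr(2) elim(2) by linarith
      ultimately show ?case by blast
    qed
  qed
  define B where "B n = {\<omega> \<in> S. agree (k n) ((shift ^^ n) \<omega>) \<omega> \<and> X (k n) \<omega> \<le> (1 + \<delta>) * lil (k n)}" for n
  have Bs: "B n \<in> sets \<mu>" for n
    unfolding B_def
  proof (rule determined_sets[of "n + k n"], rule determined_conj)
    show "determined (n + k n) (\<lambda>\<omega>. agree (k n) ((shift ^^ n) \<omega>) \<omega>)" by (rule determined_agree_shift) simp
    show "determined (n + k n) (\<lambda>\<omega>. X (k n) \<omega> \<le> (1 + \<delta>) * lil (k n))" by (rule determined_X) simp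
  qed
  have "summable (\<lambda>n. prob (B n))"
  proof (rule summable_comparison_test_ev)
    \<comment> \<open>The left side is 1 / n times the inverse cube of ln n: the summand 3 ln ln n
      was reserved for this comparison with a convergent series.\<close>
    have "\<forall>\<^sub>F n::nat in sequentially. exp (- (ln n + 3 * ln (ln n))) \<le> 1 / ((real n + 2) * (ln (real n + 2))\<^sup>2)" by real_asymp
    then show "\<forall>\<^sub>F n in sequentially. norm (prob (B n)) \<le> C ^ 3 * (1 / ((real n + 2) * (ln (real n + 2))\<^sup>2))"
      using bound
    proof eventually_elim
      case (elim n)
      have "prob (B n) \<le> C ^ 3 * exp ((1 + \<delta>) * lil (k n) - k n * h)"
        unfolding B_def by (rule match_upper) (use elim in simp)
      also have "\<dots> \<le> C ^ 3 * exp (- (ln n + 3 * ln (ln n)))" using elim C_gt by (intro mult_left_mono) auto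
      also have "\<dots> \<le> C ^ 3 * (1 / ((real n + 2) * (ln (real n + 2))\<^sup>2))" using elim C_gt by (intro mult_left_mono) auto
      finally show ?case by simp
    qed
    show "summable (\<lambda>n. C ^ 3 * (1 / ((real n + 2) * (ln (real n + 2))\<^sup>2)))"
      by (rule summable_mult[OF summable_inverse_log_square])
  qed
  then have bc: "AE \<omega> in \<mu>. \<forall>\<^sub>F n in sequentially. \<omega> \<in> space \<mu> - B n"
    by (intro borel_cantelli_AE1 Bs) (auto simp: less_top[symmetric])
  have klim: "filterlim k at_top sequentially"
  proof -
    define hh where "hh = h"
    have hh: "0 < hh" using h_positive by (simp add: hh_def)
    have "filterlim (\<lambda>n::nat. ln n / hh + \<kappa> * sqrt (ln n * ln (ln (ln n))) - c) at_top sequentially" using hh kap by real_asymp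
    then have "filterlim (\<lambda>n::nat. \<Psi> (ln n) - c) at_top sequentially" by (simp add: \<Psi>_def hh_def)
    moreover have "\<forall>\<^sub>F n in sequentially. \<Psi> (ln (real n)) - c \<le> real (k n)"
      using psi by eventually_elim (simp only: k_def, linarith)
    ultimately have "filterlim (\<lambda>n. real (k n)) at_top sequentially" by (rule filterlim_at_top_mono)
    then show ?thesis by (simp add: filterlim_sequentially_iff_filterlim_real)
  qed
  show ?thesis using bc lil_upper[OF d(1)] AE_space
  proof eventually_elim
    case (elim \<omega>)
    have "\<forall>\<^sub>F n in sequentially. X (k n) \<omega> \<le> (1 + \<delta>) * lil (k n)"
      by (rule eventually_compose_filterlim[OF elim(2) klim])
    with elim(1) show ?case
      by eventually_elim (auto simp: B_def k_def[symmetric] space_mu)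
  qed
qed

text \<open>Here x is the block length. The summand ln x is present because return times are
  multiples j * k; the leading comparison is between 1 - 2 \<delta> and 1 - \<epsilon>, both
  multiplied by sqrt (2 \<rho>) / h.\<close>

lemma rate_gap_lower:
  fixes \<epsilon> \<delta> c :: real
  assumes "2 * \<delta> < \<epsilon>" "\<epsilon> < 1"
  defines "\<kappa> \<equiv> (1 - \<epsilon>) / h powr (3 / 2) * sqrt (2 * \<rho>)"
  shows "\<forall>\<^sub>F x in at_top. (h * x - (1 - 2 * \<delta>) * lil x + ln x) / h + \<kappa> * sqrt (h * x * ln (ln (h * x))) \<le> x - c"
proof -
  define hh where "hh = h"
  have hh: "0 < hh" using h_positive by (simp add: hh_def)
  have k: "0 < \<kappa>" unfolding \<kappa>_def using assms rho_pos h_positive by simp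
  define r where "r x = (hh * x * ln (ln (hh * x))) / (x * ln (ln x))" for x :: real
  define e where "e x = (ln x / hh + c) / sqrt (x * ln (ln x))" for x :: real
  have "(r \<longlongrightarrow> hh) at_top" unfolding r_def using hh by real_asymp
  moreover have "(e \<longlongrightarrow> 0) at_top" unfolding e_def using hh by real_asymp
  ultimately have "((\<lambda>x. (1 - 2 * \<delta>) * sqrt (2 * \<rho>) / hh - \<kappa> * sqrt (r x) - e x) \<longlongrightarrow> (1 - 2 * \<delta>) * sqrt (2 * \<rho>) / hh - \<kappa> * sqrt hh - 0) at_top"
    by (intro tendsto_intros)
  moreover have "0 < (1 - 2 * \<delta>) * sqrt (2 * \<rho>) / hh - \<kappa> * sqrt hh - 0"
  proof -
    have "\<kappa> * sqrt hh = (1 - \<epsilon>) * (sqrt (2 * \<rho>) / hh)"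
      unfolding \<kappa>_def hh_def powr_three_halves[OF h_positive] using h_positive by simp
    moreover have "(1 - \<epsilon>) * (sqrt (2 * \<rho>) / hh) < (1 - 2 * \<delta>) * (sqrt (2 * \<rho>) / hh)"
      using assms hh rho_pos by (intro mult_strict_right_mono) auto
    ultimately show ?thesis by simp
  qed
  ultimately have "\<forall>\<^sub>F x in at_top. 0 < (1 - 2 * \<delta>) * sqrt (2 * \<rho>) / hh - \<kappa> * sqrt (r x) - e x" by (rule order_tendstoD(1))
  moreover have "\<forall>\<^sub>F x::real in at_top. 0 < x * ln (ln x)" by real_asymp
  ultimately show ?thesis
  proof eventually_elim
    case (elim x)
    define z where "z = sqrt (x * ln (ln x))"
    have z: "0 < z" using elim(2) by (simp add: z_def)
    have lz: "sqrt (2 * \<rho>) * z = lil x" unfolding lil_def z_def real_sqrt_mult[symmetric] by (simp add: mult.assoc)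
    have rz: "sqrt (r x) * z = sqrt (hh * x * ln (ln (hh * x)))"
    proof -
      have "x * ln (ln x) \<noteq> 0" using elim(2) by linarith
      then have "r x * (x * ln (ln x)) = hh * x * ln (ln (hh * x))" unfolding r_def by (metis nonzero_eq_divide_eq)
      then show ?thesis unfolding z_def real_sqrt_mult[symmetric] by (simp only:)
    qed
    have ez: "e x * z = ln x / hh + c" unfolding e_def z_def[symmetric] using z by simp
    have "0 \<le> ((1 - 2 * \<delta>) * sqrt (2 * \<rho>) / hh - \<kappa> * sqrt (r x) - e x) * z" using elim(1) z by simp
    also have "\<dots> = (1 - 2 * \<delta>) * (sqrt (2 * \<rho>) * z) / hh - \<kappa> * (sqrt (r x) * z) - e x * z" by (simp add: algebra_simps)
    also have "\<dots> = (1 - 2 * \<delta>) * lil x / hh - \<kappa> * sqrt (hh * x * ln (ln (hh * x))) - (ln x / hh + c)" unfolding lz rz ez ..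
    finally have "ln x / hh - (1 - 2 * \<delta>) * lil x / hh + \<kappa> * sqrt (hh * x * ln (ln (hh * x))) \<le> - c" by linarith
    moreover have "(hh * x - (1 - 2 * \<delta>) * lil x + ln x) / hh = x + (ln x / hh - (1 - 2 * \<delta>) * lil x / hh)"
      using hh by (simp add: field_simps)
    ultimately show ?case unfolding hh_def by linarith
  qed
qed

text \<open>At infinitely many lengths k the cylinder is heavy. The number of trials exceeds its
  inverse mass by the factor exp (\<delta> * lil k), so failure of all trials has a summable
  probability; every successful time is small enough for \<open>psi_minus\<close> to ask for at most
  k symbols.\<close>

lemma recurrence_lower_aux:
  fixes c \<epsilon> :: real
  assumes eps: "0 < \<epsilon>" "\<epsilon> < 1"
  shows "AE \<omega> in \<mu>. \<exists>\<^sub>\<infinity>n. agree (nat \<lceil>psi_minus h \<rho> \<epsilon> n + c\<rceil>) ((shift ^^ n) \<omega>) \<omega>"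
proof -
  define \<delta> where "\<delta> = \<epsilon> / 4"
  have d: "0 < \<delta>" "\<delta> < 1" "2 * \<delta> < \<epsilon>" "0 < 1 - 2 * \<delta>" using eps by (auto simp: \<delta>_def)
  define \<kappa> where "\<kappa> = (1 - \<epsilon>) / h powr (3 / 2) * sqrt (2 * \<rho>)"
  have kap: "0 < \<kappa>" unfolding \<kappa>_def using eps rho_pos h_positive by simp
  \<comment> \<open>Heavy means \<open>X k\<close> at least (1 - \<delta>) * lil k; using 1 - 2
    \<delta> for the number of trials leaves the surplus \<delta> * lil k in the exponent.\<close>
  define M where "M k = nat \<lfloor>exp (h * k - (1 - 2 * \<delta>) * lil k)\<rfloor>" for k :: nat
  have hpos: "0 < h" by (rule h_positive)
  define hh where "hh = h"
  have hh: "0 < hh" using hpos by (simp add: hh_def)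
  define B where "B k = {\<omega> \<in> S. (1 - \<delta>) * lil k \<le> X k \<omega> \<and> (\<forall>j\<in>{1..M k}. \<not> agree k ((shift ^^ (j * k)) \<omega>) \<omega>)}" for k
  have Bs: "B k \<in> sets \<mu>" for k
    unfolding B_def
  proof (rule determined_sets[of "Suc (M k) * k"], rule determined_conj)
    show "determined (Suc (M k) * k) (\<lambda>\<omega>. (1 - \<delta>) * lil k \<le> X k \<omega>)" by (rule determined_X) simp
    show "determined (Suc (M k) * k) (\<lambda>\<omega>. \<forall>j\<in>{1..M k}. \<not> agree k ((shift ^^ (j * k)) \<omega>) \<omega>)"
    proof (rule determined_ball, rule determined_not, rule determined_agree_shift)
      fix j assume "j \<in> {1..M k}"
      then have "Suc j * k \<le> Suc (M k) * k" by (intro mult_right_mono) auto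
      then show "j * k + k \<le> Suc (M k) * k" by simp
    qed
  qed
  have "summable (\<lambda>k. prob (B k))"
  proof (rule summable_comparison_test_ev)
    have e1: "\<forall>\<^sub>F k::nat in sequentially. 0 \<le> h * k - (1 - 2 * \<delta>) * lil k"
    proof -
      have "\<forall>\<^sub>F k::nat in sequentially. 0 \<le> hh * k - (1 - 2 * \<delta>) * sqrt (2 * \<rho> * real k * ln (ln (real k)))"
        using hh rho_pos d by real_asymp
      then show ?thesis by (simp add: lil_def hh_def)
    qed
    have e2: "\<forall>\<^sub>F k::nat in sequentially. exp (- (exp (\<delta> * lil k) / (2 * C ^ 3))) \<le> 1 / real k ^ 2"
    proof -
      have "0 < 2 * C ^ 3" using C_gt by simp
      then have "\<forall>\<^sub>F k::nat in sequentially. exp (- (exp (\<delta> * sqrt (2 * \<rho> * real k * ln (ln (real k)))) / (2 * C ^ 3))) \<le> 1 / real k ^ 2"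
        using rho_pos d C_gt by real_asymp
      then show ?thesis by (simp add: lil_def)
    qed
    show "\<forall>\<^sub>F k in sequentially. norm (prob (B k)) \<le> 1 / real k ^ 2"
      using e1 e2
    proof eventually_elim
      case (elim k)
      let ?E = "exp (h * k - (1 - 2 * \<delta>) * lil k)"
      \<comment> \<open>Since the real bound is at least 1, rounding it down loses at most half of
        it, the source of the 2 in 2 * C ^ 3.\<close>
      have E1: "1 \<le> ?E" using elim(1) by simp
      have "real (M k) = of_int \<lfloor>?E\<rfloor>" unfolding M_def by simp
      moreover have "1 \<le> \<lfloor>?E\<rfloor>" using E1 by (simp only: le_floor_iff of_int_1)
      then have "1 \<le> (of_int \<lfloor>?E\<rfloor> :: real)" by (simp only: of_int_1_le_iff)
      moreover have "?E - 1 < of_int \<lfloor>?E\<rfloor>" by linarith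
      ultimately have M: "?E / 2 \<le> M k" by linarith
      have "prob (B k) \<le> exp (- (M k * exp ((1 - \<delta>) * lil k - k * h) / C ^ 3))"
        unfolding B_def by (rule no_match)
      also have "\<dots> \<le> exp (- (exp (\<delta> * lil k) / (2 * C ^ 3)))"
      proof -
        have "exp (\<delta> * lil k) / 2 = ?E / 2 * exp ((1 - \<delta>) * lil k - k * h)"
          by (simp add: exp_add[symmetric] algebra_simps)
        also have "\<dots> \<le> M k * exp ((1 - \<delta>) * lil k - k * h)" using M by (intro mult_right_mono) auto
        finally have "exp (\<delta> * lil k) / 2 / C ^ 3 \<le> M k * exp ((1 - \<delta>) * lil k - k * h) / C ^ 3"
          using C_gt by (intro divide_right_mono) auto
        then show ?thesis by simp
      qed
      also have "\<dots> \<le> 1 / real k ^ 2" by (rule elim(2))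
      finally show ?case by simp
    qed
    show "summable (\<lambda>k. 1 / real k ^ 2)" using inverse_power_summable[of 2] by (simp add: inverse_eq_divide)
  qed
  then have bc: "AE \<omega> in \<mu>. \<forall>\<^sub>F k in sequentially. \<omega> \<in> space \<mu> - B k"
    by (intro borel_cantelli_AE1 Bs) (auto simp: less_top[symmetric])
  have key: "\<forall>\<^sub>F k::nat in sequentially. \<forall>j\<in>{1..M k}. nat \<lceil>psi_minus h \<rho> \<epsilon> (j * k) + c\<rceil> \<le> k"
  proof -
    have e1: "\<forall>\<^sub>F k::nat in sequentially. (h * k - (1 - 2 * \<delta>) * lil k + ln k) / h + \<kappa> * sqrt (h * k * ln (ln (h * k))) \<le> k - c"
      unfolding \<kappa>_def by (rule eventually_compose_filterlim[OF rate_gap_lower[OF d(3) eps(2)] filterlim_real_sequentially])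
    have e2: "\<forall>\<^sub>F k::nat in sequentially. 0 < k \<and> 0 \<le> h * k - (1 - 2 * \<delta>) * lil k + ln k \<and> h * k - (1 - 2 * \<delta>) * lil k + ln k \<le> h * k \<and> 1 < h * k \<and> 1 < ln (h * k)"
    proof -
      have "\<forall>\<^sub>F k::nat in sequentially. 0 \<le> hh * k - (1 - 2 * \<delta>) * sqrt (2 * \<rho> * real k * ln (ln (real k))) + ln k"
        using hh rho_pos d by real_asymp
      moreover have "\<forall>\<^sub>F k::nat in sequentially. hh * k - (1 - 2 * \<delta>) * sqrt (2 * \<rho> * real k * ln (ln (real k))) + ln k \<le> hh * k"
        using hh rho_pos d by real_asymp
      moreover have "\<forall>\<^sub>F k::nat in sequentially. 1 < hh * k" using hh by real_asymp
      moreover have "\<forall>\<^sub>F k::nat in sequentially. 1 < ln (hh * k)" using hh by real_asymp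
      ultimately show ?thesis using eventually_gt_at_top[of 0] by eventually_elim (simp add: lil_def hh_def)
    qed
    show ?thesis using e1 e2
    proof eventually_elim
      case (elim k)
      let ?L = "h * k - (1 - 2 * \<delta>) * lil k + ln k"
      show ?case
      proof
        fix j assume j: "j \<in> {1..M k}"
        have "real (M k) \<le> exp (h * k - (1 - 2 * \<delta>) * lil k)" unfolding M_def by (rule of_nat_floor) simp
        then have "real (j * k) \<le> exp (h * k - (1 - 2 * \<delta>) * lil k) * exp (ln k)"
          using j elim(2) unfolding of_nat_mult by (intro mult_mono) auto
        then have jk: "real (j * k) \<le> exp ?L" by (simp add: exp_add)
        have ljk: "logc (real (j * k)) \<le> ?L"
        proof (cases "real (j * k) \<le> 1")
          case True then show ?thesis using elim(2) by (simp add: logc_def)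
        next
          case False
          then have "ln (real (j * k)) \<le> ln (exp ?L)" using jk by (subst ln_le_cancel_iff) auto
          then show ?thesis using False by (simp add: logc_def)
        qed
        then have ljk': "logc (real (j * k)) \<le> h * k" using elim(2) by linarith
        have ll: "logc (logc (logc (real (j * k)))) \<le> ln (ln (h * k))"
          using logc_mono[OF logc_mono[OF ljk']] elim(2) by (simp add: logc_def)
        have "psi_minus h \<rho> \<epsilon> (j * k) = logc (real (j * k)) / h + \<kappa> * sqrt (logc (real (j * k)) * logc (logc (logc (real (j * k)))))"
          unfolding psi_minus_def \<kappa>_def by (simp add: mult.assoc real_sqrt_mult)
        also have "\<dots> \<le> ?L / h + \<kappa> * sqrt (h * k * ln (ln (h * k)))"
          using ljk ljk' ll hpos kap logc_nonneg
          by (intro add_mono divide_right_mono mult_left_mono real_sqrt_le_mono mult_mono) (auto intro: order_trans[OF logc_nonneg])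
        also have "\<dots> \<le> k - c" by (rule elim(1))
        finally show "nat \<lceil>psi_minus h \<rho> \<epsilon> (j * k) + c\<rceil> \<le> k" by linarith
      qed
    qed
  qed
  then obtain k1 where k1: "\<And>k j. k1 \<le> k \<Longrightarrow> j \<in> {1..M k} \<Longrightarrow> nat \<lceil>psi_minus h \<rho> \<epsilon> (j * k) + c\<rceil> \<le> k"
    unfolding eventually_sequentially by blast
  show ?thesis using bc lil_lower[OF d(1,2)] AE_space
  proof eventually_elim
    case (elim \<omega>)
    then obtain k2 where k2: "\<And>k. k2 \<le> k \<Longrightarrow> \<omega> \<notin> B k" unfolding eventually_sequentially by blast
    show ?case unfolding INFM_nat_le
    proof
      fix m
      obtain k where k: "max m (max k1 k2) \<le> k" "(1 - \<delta>) * lil k \<le> X k \<omega>"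
        using elim(2) unfolding INFM_nat_le by blast
      then obtain j where j: "j \<in> {1..M k}" "agree k ((shift ^^ (j * k)) \<omega>) \<omega>"
        using k2[of k] elim(3) unfolding B_def space_mu by auto
      have "nat \<lceil>psi_minus h \<rho> \<epsilon> (j * k) + c\<rceil> \<le> k" using k1[OF _ j(1)] k(1) by simp
      then have "agree (nat \<lceil>psi_minus h \<rho> \<epsilon> (j * k) + c\<rceil>) ((shift ^^ (j * k)) \<omega>) \<omega>"
        using j(2) unfolding agree_def by (meson less_le_trans)
      moreover have "m \<le> j * k"
      proof -
        have "1 * k \<le> j * k" using j(1) by (intro mult_right_mono) auto
        then show ?thesis using k(1) by linarith
      qed
      ultimately show "\<exists>n\<ge>m. agree (nat \<lceil>psi_minus h \<rho> \<epsilon> n + c\<rceil>) ((shift ^^ n) \<omega>) \<omega>" by blast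
    qed
  qed
qed

theorem recurrence_lower:
  fixes c \<epsilon> :: real
  assumes eps: "0 < \<epsilon>"
  shows "AE \<omega> in \<mu>. \<exists>\<^sub>\<infinity>n. agree (nat \<lceil>psi_minus h \<rho> \<epsilon> n + c\<rceil>) ((shift ^^ n) \<omega>) \<omega>"
proof -
  \<comment> \<open>\<open>psi_minus\<close> decreases in \<epsilon>, so a smaller \<epsilon> gives
    a stronger statement; staying below 1 keeps the correction term positive.\<close>
  define \<epsilon>' where "\<epsilon>' = min \<epsilon> (1 / 2)"
  have e: "0 < \<epsilon>'" "\<epsilon>' < 1" "\<epsilon>' \<le> \<epsilon>" using eps by (auto simp: \<epsilon>'_def)
  have le: "psi_minus h \<rho> \<epsilon> n \<le> psi_minus h \<rho> \<epsilon>' n" for n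
    unfolding psi_minus_def using e rho_pos logc_nonneg
    by (intro add_left_mono mult_right_mono divide_right_mono) auto
  show ?thesis using recurrence_lower_aux[OF e(1,2), of c]
  proof eventually_elim
    case (elim \<omega>)
    then show ?case
    proof (rule INFM_mono)
      fix n assume "agree (nat \<lceil>psi_minus h \<rho> \<epsilon>' n + c\<rceil>) ((shift ^^ n) \<omega>) \<omega>"
      moreover have "nat \<lceil>psi_minus h \<rho> \<epsilon> n + c\<rceil> \<le> nat \<lceil>psi_minus h \<rho> \<epsilon>' n + c\<rceil>"
        using le[of n] by (intro nat_mono ceiling_mono) simp
      ultimately show "agree (nat \<lceil>psi_minus h \<rho> \<epsilon> n + c\<rceil>) ((shift ^^ n) \<omega>) \<omega>"
        unfolding agree_def by (meson less_le_trans)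
    qed
  qed
qed

end

section \<open>The coding of the attractor\<close>

lemma compose_word_0 [simp]: "compose_word \<phi> 0 \<omega> x = x"
  by (simp add: compose_word_def)

lemma compose_word_Suc: "compose_word \<phi> (Suc n) \<omega> x = \<phi> (\<omega> 0) (compose_word \<phi> n (shift \<omega>) x)"
proof -
  have "[0..<Suc n] = 0 # map Suc [0..<n]" by (simp add: upt_conv_Cons map_Suc_upt del: upt_Suc)
  then show ?thesis by (simp add: compose_word_def foldr_map o_def shift_def del: upt_Suc)
qed

lemma compose_word_Suc_last: "compose_word \<phi> (Suc n) \<omega> x = compose_word \<phi> n \<omega> (\<phi> (\<omega> n) x)"
proof (induction n arbitrary: \<omega>)
  case 0
  then show ?case by (simp add: compose_word_Suc)
next
  case (Suc n)
  have "compose_word \<phi> (Suc (Suc n)) \<omega> x = \<phi> (\<omega> 0) (compose_word \<phi> (Suc n) (shift \<omega>) x)" by (rule compose_word_Suc)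
  also have "\<dots> = \<phi> (\<omega> 0) (compose_word \<phi> n (shift \<omega>) (\<phi> (\<omega> (Suc n)) x))"
    unfolding Suc.IH by (simp add: shift_def)
  also have "\<dots> = compose_word \<phi> (Suc n) \<omega> (\<phi> (\<omega> (Suc n)) x)" by (rule compose_word_Suc[symmetric])
  finally show ?case .
qed

lemma compose_word_cong: "agree n \<omega> \<eta> \<Longrightarrow> compose_word \<phi> n \<omega> x = compose_word \<phi> n \<eta> x"
proof (induction n arbitrary: \<omega> \<eta>)
  case (Suc n) then show ?case unfolding compose_word_Suc agree_Suc_iff by metis
qed simp

locale separated_ifs =
  fixes K :: nat and r :: real and \<phi> :: "nat \<Rightarrow> 'a::euclidean_space \<Rightarrow> 'a" and X :: "'a set"
  assumes ifs: "homogeneous_IFS K r \<phi>" and self_similar: "self_similar_set K \<phi> X"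
    and separation: "strong_separation K \<phi> X"
begin

abbreviation "\<pi> \<equiv> coding_map \<phi>"
abbreviation "T \<equiv> expanding_map K \<phi> X"

lemma r: "0 < r" "r < 1"
  using ifs by (auto simp: homogeneous_IFS_def)

lemma similar: "i \<in> {1..K} \<Longrightarrow> norm (\<phi> i x - \<phi> i y) = r * norm (x - y)"
  using ifs by (auto simp: homogeneous_IFS_def similarity_def)

lemma X: "X \<noteq> {}" "compact X" "X = (\<Union>i\<in>{1..K}. \<phi> i ` X)"
  using self_similar by (simp_all add: self_similar_set_def)

lemma maps_X: "i \<in> {1..K} \<Longrightarrow> x \<in> X \<Longrightarrow> \<phi> i x \<in> X"
  using X(3) by blast

lemma diameter:
  obtains R where "0 < R" "\<And>x y. x \<in> X \<Longrightarrow> y \<in> X \<Longrightarrow> norm (x - y) \<le> R"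
proof -
  obtain B where B: "0 < B" "\<And>x. x \<in> X \<Longrightarrow> norm x \<le> B"
    using compact_imp_bounded[OF X(2)] unfolding bounded_pos by blast
  have "norm (x - y) \<le> 2 * B" if "x \<in> X" "y \<in> X" for x y
    using norm_triangle_ineq4[of x y] B(2)[OF that(1)] B(2)[OF that(2)] by linarith
  then show ?thesis using that[of "2 * B"] B(1) by simp
qed

lemma continuous_phi: "i \<in> {1..K} \<Longrightarrow> continuous_on A (\<phi> i)"
proof -
  assume i: "i \<in> {1..K}"
  have "r-lipschitz_on A (\<phi> i)"
    by (rule lipschitz_onI) (use r i similar in \<open>auto simp: dist_norm\<close>)
  then show ?thesis by (rule lipschitz_on_continuous_on)
qed

lemma gap:
  obtains \<Delta> where "0 < \<Delta>" "\<And>i j x y. i \<in> {1..K} \<Longrightarrow> j \<in> {1..K} \<Longrightarrow> i \<noteq> j \<Longrightarrow> x \<in> X \<Longrightarrow> y \<in> X \<Longrightarrow> \<Delta> \<le> norm (\<phi> i x - \<phi> j y)"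
proof -
  have "\<exists>d>0. \<forall>x\<in>X. \<forall>y\<in>X. d \<le> norm (\<phi> i x - \<phi> j y)" if "i \<in> {1..K}" "j \<in> {1..K}" "i \<noteq> j" for i j
  proof -
    have "compact (\<phi> i ` X)" "compact (\<phi> j ` X)"
      using that by (auto intro!: compact_continuous_image continuous_phi X(2))
    moreover have "\<phi> i ` X \<inter> \<phi> j ` X = {}" using separation that by (auto simp: strong_separation_def)
    ultimately have "\<exists>d>0. \<forall>x\<in>\<phi> i ` X. \<forall>y\<in>\<phi> j ` X. d \<le> dist x y"
      by (intro separate_compact_closed compact_imp_closed)
    then show ?thesis by (auto simp: dist_norm)
  qed
  then obtain d where d: "\<And>i j. i \<in> {1..K} \<Longrightarrow> j \<in> {1..K} \<Longrightarrow> i \<noteq> j \<Longrightarrow> 0 < d i j"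
    "\<And>i j x y. i \<in> {1..K} \<Longrightarrow> j \<in> {1..K} \<Longrightarrow> i \<noteq> j \<Longrightarrow> x \<in> X \<Longrightarrow> y \<in> X \<Longrightarrow> d i j \<le> norm (\<phi> i x - \<phi> j y)"
    by metis
  define P where "P = {(i, j). i \<in> {1..K} \<and> j \<in> {1..K} \<and> i \<noteq> j}"
  have fin: "finite P" by (rule finite_subset[of _ "{1..K} \<times> {1..K}"]) (auto simp: P_def)
  \<comment> \<open>The inserted 1 keeps the minimum meaningful when there is no pair of distinct
    symbols.\<close>
  define \<Delta> where "\<Delta> = Min (insert 1 ((\<lambda>(i, j). d i j) ` P))"
  have "0 < \<Delta>" unfolding \<Delta>_def using fin d(1) by (subst Min_gr_iff) (auto simp: P_def)
  moreover have "\<Delta> \<le> norm (\<phi> i x - \<phi> j y)" if H: "i \<in> {1..K}" "j \<in> {1..K}" "i \<noteq> j" "x \<in> X" "y \<in> X" for i j x y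
  proof -
    have "\<Delta> \<le> d i j" unfolding \<Delta>_def using fin H by (intro Min_le) (force simp: P_def)+
    also have "\<dots> \<le> norm (\<phi> i x - \<phi> j y)" by (rule d(2)[OF H])
    finally show ?thesis .
  qed
  ultimately show ?thesis using that by blast
qed

lemma Sigma_K_at: "\<omega> \<in> Sigma_K K \<Longrightarrow> \<omega> n \<in> {1..K}"
  by (simp add: Sigma_K_def)

lemma compose_word_similar:
  "\<omega> \<in> Sigma_K K \<Longrightarrow> norm (compose_word \<phi> n \<omega> x - compose_word \<phi> n \<omega> y) = r ^ n * norm (x - y)"
proof (induction n arbitrary: \<omega>)
  case (Suc n)
  then show ?case using similar[OF Sigma_K_at[OF Suc.prems, of 0]] Sigma_K_shift[OF Suc.prems]
    by (simp add: compose_word_Suc)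
qed simp

lemma compose_word_in_X: "\<omega> \<in> Sigma_K K \<Longrightarrow> x \<in> X \<Longrightarrow> compose_word \<phi> n \<omega> x \<in> X"
proof (induction n arbitrary: \<omega>)
  case (Suc n)
  then show ?case using maps_X[OF Sigma_K_at[OF Suc.prems(1), of 0]] Sigma_K_shift[OF Suc.prems(1)]
    by (simp add: compose_word_Suc)
qed simp

text \<open>Appending a symbol at the inner end moves the point by at most B times r ^ n, so the
  increments are summable.\<close>

lemma coding_map_limit_0:
  assumes w: "\<omega> \<in> Sigma_K K" shows "(\<lambda>n. compose_word \<phi> n \<omega> 0) \<longlonglongrightarrow> \<pi> \<omega>"
proof -
  let ?f = "\<lambda>n. compose_word \<phi> n \<omega> 0"
  define B where "B = Max ((\<lambda>i. norm (\<phi> i 0)) ` {1..K})"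
  have B: "norm (\<phi> (\<omega> n) 0) \<le> B" for n unfolding B_def using Sigma_K_at[OF w] by (intro Max_ge) auto
  have "summable (\<lambda>n. ?f (Suc n) - ?f n)"
  proof (rule summable_comparison_test')
    show "summable (\<lambda>n. r ^ n * B)" using r by (intro summable_mult2 summable_geometric) auto
    show "norm (?f (Suc n) - ?f n) \<le> r ^ n * B" for n
      unfolding compose_word_Suc_last compose_word_similar[OF w] using B[of n] r by (intro mult_left_mono) auto
  qed
  then have "(\<lambda>n. \<Sum>k<n. ?f (Suc k) - ?f k) \<longlonglongrightarrow> (\<Sum>k. ?f (Suc k) - ?f k)" by (rule summable_LIMSEQ)
  then have "(\<lambda>n. ?f n - ?f 0) \<longlonglongrightarrow> (\<Sum>k. ?f (Suc k) - ?f k)" unfolding sum_lessThan_telescope[of ?f] .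
  then have "convergent ?f" unfolding convergent_def by auto
  then show ?thesis unfolding coding_map_def by (rule convergent_LIMSEQ_iff[THEN iffD1])
qed

text \<open>The starting point is forgotten at rate r ^ n. Starting in X shows that the limit lies
  in X, even if 0 does not.\<close>

lemma coding_map_limit:
  assumes w: "\<omega> \<in> Sigma_K K" shows "(\<lambda>n. compose_word \<phi> n \<omega> x) \<longlonglongrightarrow> \<pi> \<omega>"
proof -
  have "(\<lambda>n. compose_word \<phi> n \<omega> x - compose_word \<phi> n \<omega> 0) \<longlonglongrightarrow> 0"
  proof (rule Lim_null_comparison)
    show "\<forall>\<^sub>F n in sequentially. norm (compose_word \<phi> n \<omega> x - compose_word \<phi> n \<omega> 0) \<le> r ^ n * norm x"
      using compose_word_similar[OF w] by simp
    show "(\<lambda>n. r ^ n * norm x) \<longlonglongrightarrow> 0" using r by (intro tendsto_mult_left_zero LIMSEQ_power_zero) auto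
  qed
  from tendsto_add[OF this coding_map_limit_0[OF w]] show ?thesis by simp
qed

lemma coding_map_in_X: assumes "\<omega> \<in> Sigma_K K" shows "\<pi> \<omega> \<in> X"
proof -
  obtain x where "x \<in> X" using X(1) by blast
  then show ?thesis
    using closed_sequentially[OF compact_imp_closed[OF X(2)] _ coding_map_limit[OF assms, of x]]
      compose_word_in_X[OF assms] by blast
qed

lemma coding_map_shift: assumes w: "\<omega> \<in> Sigma_K K" shows "\<pi> \<omega> = \<phi> (\<omega> 0) (\<pi> (shift \<omega>))"
proof (rule LIMSEQ_unique)
  show "(\<lambda>n. compose_word \<phi> (Suc n) \<omega> 0) \<longlonglongrightarrow> \<pi> \<omega>" using coding_map_limit[OF w] by (rule LIMSEQ_Suc)
  show "(\<lambda>n. compose_word \<phi> (Suc n) \<omega> 0) \<longlonglongrightarrow> \<phi> (\<omega> 0) (\<pi> (shift \<omega>))"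
    unfolding compose_word_Suc
    using continuous_on_tendsto_compose[OF continuous_phi[OF Sigma_K_at[OF w]] coding_map_limit[OF Sigma_K_shift[OF w]], of UNIV] by simp
qed

lemma coding_map_compose_word:
  "\<omega> \<in> Sigma_K K \<Longrightarrow> \<pi> \<omega> = compose_word \<phi> n \<omega> (\<pi> ((shift ^^ n) \<omega>))"
proof (induction n)
  case (Suc n)
  have s: "(shift ^^ n) \<omega> \<in> Sigma_K K" by (rule Sigma_K_shift_funpow[OF Suc.prems])
  have "\<pi> ((shift ^^ n) \<omega>) = \<phi> (\<omega> n) (\<pi> ((shift ^^ Suc n) \<omega>))"
    using coding_map_shift[OF s] by (simp add: shift_funpow)
  then show ?case using Suc by (simp add: compose_word_Suc_last)
qed simp

lemma coding_map_dist:
  assumes "\<omega> \<in> Sigma_K K" "\<eta> \<in> Sigma_K K" "agree n \<omega> \<eta>"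
  shows "norm (\<pi> \<omega> - \<pi> \<eta>) = r ^ n * norm (\<pi> ((shift ^^ n) \<omega>) - \<pi> ((shift ^^ n) \<eta>))"
proof -
  have "\<pi> \<eta> = compose_word \<phi> n \<omega> (\<pi> ((shift ^^ n) \<eta>))"
    by (rule trans[OF coding_map_compose_word[OF assms(2)] compose_word_cong[OF assms(3), symmetric]])
  then have "norm (\<pi> \<omega> - \<pi> \<eta>) = norm (compose_word \<phi> n \<omega> (\<pi> ((shift ^^ n) \<omega>)) - compose_word \<phi> n \<omega> (\<pi> ((shift ^^ n) \<eta>)))"
    using coding_map_compose_word[OF assms(1), of n] by (simp only:)
  then show ?thesis unfolding compose_word_similar[OF assms(1)] .
qed

text \<open>Removing the common prefix up to the first disagreement, at an index k \<le> m, leaves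
  points in different first-level pieces, at distance at least \<Delta>; the prefix scales this by r
  ^ k.\<close>

lemma coding_map_dist_lower:
  assumes "\<omega> \<in> Sigma_K K" "\<eta> \<in> Sigma_K K" "\<not> agree (Suc m) \<omega> \<eta>"
    and gap: "\<And>i j x y. i \<in> {1..K} \<Longrightarrow> j \<in> {1..K} \<Longrightarrow> i \<noteq> j \<Longrightarrow> x \<in> X \<Longrightarrow> y \<in> X \<Longrightarrow> \<Delta> \<le> norm (\<phi> i x - \<phi> j y)"
    and "0 \<le> \<Delta>"
  shows "r ^ m * \<Delta> \<le> norm (\<pi> \<omega> - \<pi> \<eta>)"
proof -
  define k where "k = (LEAST k. \<omega> k \<noteq> \<eta> k)"
  obtain l where l: "l \<le> m" "\<omega> l \<noteq> \<eta> l" using assms(3) by (auto simp: agree_def less_Suc_eq_le)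
  have k: "\<omega> k \<noteq> \<eta> k" unfolding k_def by (rule LeastI[of "\<lambda>k. \<omega> k \<noteq> \<eta> k", OF l(2)])
  have km: "k \<le> m" using Least_le[of "\<lambda>k. \<omega> k \<noteq> \<eta> k", OF l(2)] l(1) unfolding k_def by linarith
  have ag: "agree k \<omega> \<eta>" unfolding agree_def k_def using not_less_Least by blast
  have s: "(shift ^^ k) \<omega> \<in> Sigma_K K" "(shift ^^ k) \<eta> \<in> Sigma_K K" using assms by (auto intro: Sigma_K_shift_funpow)
  have "\<Delta> \<le> norm (\<pi> ((shift ^^ k) \<omega>) - \<pi> ((shift ^^ k) \<eta>))"
    unfolding coding_map_shift[OF s(1)] coding_map_shift[OF s(2)]
    by (rule gap) (use s k Sigma_K_at[OF assms(1)] Sigma_K_at[OF assms(2)] coding_map_in_X Sigma_K_shift in \<open>auto simp: shift_funpow\<close>)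
  then have "r ^ k * \<Delta> \<le> norm (\<pi> \<omega> - \<pi> \<eta>)"
    unfolding coding_map_dist[OF assms(1,2) ag] using r by (intro mult_left_mono) auto
  moreover have "r ^ m * \<Delta> \<le> r ^ k * \<Delta>" using km r assms(5) by (intro mult_right_mono power_decreasing) auto
  ultimately show ?thesis by linarith
qed

lemma expanding_map_phi:
  assumes "i \<in> {1..K}" "x \<in> X" shows "T (\<phi> i x) = x"
  unfolding expanding_map_def
proof (rule the_equality)
  fix y assume "y \<in> X \<and> (\<exists>j\<in>{1..K}. \<phi> i x = \<phi> j y)"
  then obtain j where j: "y \<in> X" "j \<in> {1..K}" "\<phi> i x = \<phi> j y" by blast
  then have "i = j" using separation assms unfolding strong_separation_def by blast
  then have "r * norm (x - y) = 0" using similar[OF assms(1), of x y] j(3) by simp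
  then show "y = x" using r by simp
qed (use assms in blast)

lemma expanding_map_coding: "\<omega> \<in> Sigma_K K \<Longrightarrow> T (\<pi> \<omega>) = \<pi> (shift \<omega>)"
  using expanding_map_phi[OF Sigma_K_at[of \<omega> 0] coding_map_in_X[OF Sigma_K_shift]] coding_map_shift by simp

lemma expanding_map_funpow_coding: "\<omega> \<in> Sigma_K K \<Longrightarrow> (T ^^ n) (\<pi> \<omega>) = \<pi> ((shift ^^ n) \<omega>)"
  by (induction n) (auto simp: expanding_map_coding Sigma_K_shift_funpow)

lemma expanding_map_in_X: "x \<in> X \<Longrightarrow> T x \<in> X"
proof -
  assume "x \<in> X"
  then obtain i y where "i \<in> {1..K}" "y \<in> X" "x = \<phi> i y" using X(3) by blast
  then show ?thesis using expanding_map_phi by simp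
qed

text \<open>X is a finite union of closed pieces, on each of which the map expands by exactly 1 / r.
  Continuity provides the Borel measurability of the recurrence sets.\<close>

lemma continuous_expanding_map: "continuous_on X T"
proof -
  have "continuous_on (\<Union>i\<in>{1..K}. \<phi> i ` X) T"
  proof (rule continuous_on_closed_Union)
    fix i assume i: "i \<in> {1..K}"
    show "closed (\<phi> i ` X)" by (intro compact_imp_closed compact_continuous_image continuous_phi i X(2))
    have "(1 / r)-lipschitz_on (\<phi> i ` X) T"
    proof (rule lipschitz_onI)
      fix x y assume "x \<in> \<phi> i ` X" "y \<in> \<phi> i ` X"
      then show "dist (T x) (T y) \<le> 1 / r * dist x y"
        using expanding_map_phi[OF i] similar[OF i] r by (auto simp: dist_norm)
    qed (use r in simp)
    then show "continuous_on (\<phi> i ` X) T" by (rule lipschitz_on_continuous_on)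
  qed simp
  then show ?thesis using X(3) by simp
qed

lemma continuous_expanding_map_funpow: "continuous_on X (T ^^ n)" "x \<in> X \<Longrightarrow> (T ^^ n) x \<in> X"
proof (induction n arbitrary: x)
  case (Suc n)
  { case 1
    have "continuous_on X (T \<circ> (T ^^ n))"
      by (rule continuous_on_compose[OF Suc.IH(1)])
         (rule continuous_on_subset[OF continuous_expanding_map], use Suc.IH(2) in blast)
    then show ?case by simp
  next
    case 2 then show ?case using Suc.IH(2) expanding_map_in_X by simp }
qed (auto simp: continuous_on_id)

text \<open>A limit superior of sets that are closed in the ambient space, because X is compact and
  the iterates are continuous on it.\<close>

lemma recurrence_set_borel: "recurrence_set K r \<phi> X \<psi> \<in> sets borel"
proof -
  let ?A = "\<lambda>n. X \<inter> (\<lambda>x. norm ((T ^^ n) x - x)) -` {..r powr \<psi> n}"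
  have "closed (?A n)" for n
    by (rule continuous_closed_preimage)
       (intro continuous_on_norm continuous_on_diff continuous_expanding_map_funpow(1) continuous_on_id compact_imp_closed[OF X(2)] closed_atMost)+
  then have A: "?A n \<in> sets borel" for n by simp
  have "recurrence_set K r \<phi> X \<psi> = (\<Inter>m. \<Union>n\<in>{m..}. ?A n)"
    unfolding recurrence_set_def INFM_nat_le by fastforce
  also have "\<dots> \<in> sets borel" using A by (intro sets.countable_INT'' sets.countable_UN') auto
  finally show ?thesis .
qed

lemma coding_in_recurrence_set_iff:
  "\<omega> \<in> Sigma_K K \<Longrightarrow> \<pi> \<omega> \<in> recurrence_set K r \<phi> X \<psi> \<longleftrightarrow> (\<exists>\<^sub>\<infinity>n. norm (\<pi> ((shift ^^ n) \<omega>) - \<pi> \<omega>) \<le> r powr \<psi> n)"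
  by (simp add: recurrence_set_def coding_map_in_X expanding_map_funpow_coding)

text \<open>The gap \<Delta> between pieces is worth finitely many symbols: c is chosen with r ^ c <
  \<Delta>, so a too early disagreement contradicts the distance.\<close>

lemma agreement_necessary:
  obtains c where "0 \<le> c" "\<And>\<omega> n s. \<omega> \<in> Sigma_K K \<Longrightarrow> norm (\<pi> ((shift ^^ n) \<omega>) - \<pi> \<omega>) \<le> r powr s \<Longrightarrow>
    agree (nat \<lceil>s - c\<rceil>) ((shift ^^ n) \<omega>) \<omega>"
proof -
  obtain \<Delta> where D: "0 < \<Delta>" "\<And>i j x y. i \<in> {1..K} \<Longrightarrow> j \<in> {1..K} \<Longrightarrow> i \<noteq> j \<Longrightarrow> x \<in> X \<Longrightarrow> y \<in> X \<Longrightarrow> \<Delta> \<le> norm (\<phi> i x - \<phi> j y)"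
    by (rule gap) blast
  obtain c :: nat where c: "r ^ c < \<Delta>" using real_arch_pow_inv[OF D(1) r(2)] by blast
  show ?thesis
  proof (rule that[of "real c"])
    fix \<omega> n s assume w: "\<omega> \<in> Sigma_K K" and le: "norm (\<pi> ((shift ^^ n) \<omega>) - \<pi> \<omega>) \<le> r powr s"
    show "agree (nat \<lceil>s - real c\<rceil>) ((shift ^^ n) \<omega>) \<omega>"
    proof (rule ccontr)
      assume na: "\<not> agree (nat \<lceil>s - real c\<rceil>) ((shift ^^ n) \<omega>) \<omega>"
      then obtain m where m: "nat \<lceil>s - real c\<rceil> = Suc m" by (cases "nat \<lceil>s - real c\<rceil>") auto
      have "r ^ m * \<Delta> \<le> norm (\<pi> ((shift ^^ n) \<omega>) - \<pi> \<omega>)"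
        by (rule coding_map_dist_lower[OF Sigma_K_shift_funpow[OF w] w na[unfolded m] D(2) less_imp_le[OF D(1)]])
      also have "\<dots> \<le> r powr s" by (rule le)
      also have "\<dots> \<le> r powr (real m + real c)"
      proof (rule powr_mono')
        \<comment> \<open>A ceiling equal to Suc m means s - c > m, and the lower distance bound for
          disagreement within Suc m symbols has exponent m.\<close>
        show "real m + real c \<le> s" using m by linarith
      qed (use r in auto)
      also have "\<dots> = r ^ m * r ^ c" using r by (simp add: powr_add powr_realpow)
      finally have "r ^ m * \<Delta> \<le> r ^ m * r ^ c" .
      then show False using c r by simp
    qed
  qed simp
qed

text \<open>Here c is chosen with r ^ c * R < 1, so that c additional symbols compensate for the
  diameter bound R of X.\<close>

lemma agreement_sufficient:
  obtains c where "\<And>\<omega> n s. \<omega> \<in> Sigma_K K \<Longrightarrow> agree (nat \<lceil>s + c\<rceil>) ((shift ^^ n) \<omega>) \<omega> \<Longrightarrow>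
    norm (\<pi> ((shift ^^ n) \<omega>) - \<pi> \<omega>) \<le> r powr s"
proof -
  obtain R where R: "0 < R" "\<And>x y. x \<in> X \<Longrightarrow> y \<in> X \<Longrightarrow> norm (x - y) \<le> R" by (rule diameter) blast
  obtain c :: nat where c: "r ^ c < 1 / R" using real_arch_pow_inv[OF _ r(2), of "1 / R"] R(1) by auto
  show ?thesis
  proof (rule that[of "real c"])
    fix \<omega> n s assume w: "\<omega> \<in> Sigma_K K" and ag: "agree (nat \<lceil>s + real c\<rceil>) ((shift ^^ n) \<omega>) \<omega>"
    let ?k = "nat \<lceil>s + real c\<rceil>"
    have sn: "(shift ^^ n) \<omega> \<in> Sigma_K K" by (rule Sigma_K_shift_funpow[OF w])
    have "norm (\<pi> ((shift ^^ n) \<omega>) - \<pi> \<omega>) \<le> r ^ ?k * R"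
      unfolding coding_map_dist[OF sn w ag] using r
      by (intro mult_left_mono R(2) coding_map_in_X Sigma_K_shift_funpow sn w) auto
    also have "r ^ ?k = r powr real ?k" using r by (simp add: powr_realpow)
    also have "\<dots> * R \<le> r powr (s + real c) * R"
    proof (intro mult_right_mono powr_mono')
      show "s + real c \<le> real ?k" by linarith
    qed (use r R in auto)
    also have "\<dots> = r powr s * (r ^ c * R)" using r by (simp add: powr_add powr_realpow)
    also have "\<dots> \<le> r powr s * 1" using c R(1) by (intro mult_left_mono) (auto simp: field_simps)
    finally show "norm (\<pi> ((shift ^^ n) \<omega>) - \<pi> \<omega>) \<le> r powr s" by simp
  qed
qed

end

section \<open>From recurrence of symbols to recurrence in the attractor\<close>

theorem theorem7p2:
  fixes K :: nat and r :: real and \<phi> :: "nat \<Rightarrow> 'a::euclidean_space \<Rightarrow> 'a"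
    and X :: "'a set" and f :: "(nat \<Rightarrow> nat) \<Rightarrow> real" and \<mu> :: "(nat \<Rightarrow> nat) measure"
    and \<epsilon> :: real
  assumes "homogeneous_IFS K r \<phi>"
    and "self_similar_set K \<phi> X"
    and "strong_separation K \<phi> X"
    and "holder_continuous K f"
    and "\<not> cohomologous_to_constant K f"
    and "is_gibbs_measure K f \<mu>"
    and "\<epsilon> > 0"
  shows "(recurrence_set K r \<phi> X (psi_plus (entropy K \<mu>) (asymp_variance f \<mu>) \<epsilon>) \<in> sets borel
       \<and> measure (distr \<mu> borel (coding_map \<phi>))
           (recurrence_set K r \<phi> X (psi_plus (entropy K \<mu>) (asymp_variance f \<mu>) \<epsilon>)) = 0)
     \<and> (recurrence_set K r \<phi> X (psi_minus (entropy K \<mu>) (asymp_variance f \<mu>) \<epsilon>) \<in> sets borel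
       \<and> measure (distr \<mu> borel (coding_map \<phi>))
           (recurrence_set K r \<phi> X (psi_minus (entropy K \<mu>) (asymp_variance f \<mu>) \<epsilon>)) = 1)"
proof -
  interpret ifs: separated_ifs K r \<phi> X by unfold_locales (fact assms)+
  have K2: "2 \<le> K" by (rule not_cohomologous_imp_K_ge_2[OF assms(5)])
  obtain b \<alpha> where b: "0 < b" and \<alpha>: "0 < \<alpha>" "\<alpha> < 1"
    and hol: "\<And>\<omega> \<eta> n. \<omega> \<in> Sigma_K K \<Longrightarrow> \<eta> \<in> Sigma_K K \<Longrightarrow> agree n \<omega> \<eta> \<Longrightarrow> \<bar>f \<omega> - f \<eta>\<bar> \<le> b * \<alpha> ^ n"
    using assms(4) unfolding holder_continuous_def agree_def by blast
  interpret symbolic K \<alpha> using K2 \<alpha> by unfold_locales auto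
  have fh: "hoelder f" by (rule hoelderI[of b]) (use b hol in auto)
  note gm = assms(6)[unfolded is_gibbs_measure_def]
  have ps: "prob_space \<mu>" using gm by blast
  let ?ratio = "\<lambda>\<omega> n. measure \<mu> (cylinder K (prefix_of n \<omega>)) / exp (- real n * pressure K f + birkhoff f n \<omega>)"
  have "\<exists>C>1. \<forall>\<omega>\<in>Sigma_K K. \<forall>n. inverse C \<le> ?ratio \<omega> n \<and> ?ratio \<omega> n \<le> C"
    using gm unfolding prefix_of_def by (elim conjE)
  then obtain C where C: "1 < C" and cyl: "\<And>\<omega> n. \<omega> \<in> Sigma_K K \<Longrightarrow>
      inverse C \<le> ?ratio \<omega> n \<and> ?ratio \<omega> n \<le> C" by blast
  interpret prob_space \<mu> by (rule ps)
  interpret gibbs K \<alpha> \<mu> f "pressure K f" C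
  proof
    show "sets \<mu> = sets (Sigma_space K)" "shift \<in> measurable \<mu> \<mu>" using gm by blast+
    show "measure \<mu> (shift -` A \<inter> space \<mu>) = measure \<mu> A" if "A \<in> sets \<mu>" for A using gm that by blast
    show "hoelder f" by (rule fh)
    show "1 < C" by (rule C)
    fix \<omega> n assume w: "\<omega> \<in> Sigma_K K"
    let ?e = "exp (- real n * pressure K f + birkhoff f n \<omega>)"
    have "0 < ?e" by simp
    then show "?e / C \<le> measure \<mu> (cylinder K (prefix_of n \<omega>))" "measure \<mu> (cylinder K (prefix_of n \<omega>)) \<le> C * ?e"
      using cyl[OF w, of n] C by (auto simp: pos_le_divide_eq pos_divide_le_eq inverse_eq_divide field_simps)
  qed
  obtain g b' A0 where g: "normalized K \<alpha> g b'" "0 < A0"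
    "\<And>n \<phi> \<omega>. (\<And>\<omega>. \<omega> \<in> Sigma_K K \<Longrightarrow> 0 \<le> \<phi> \<omega>) \<Longrightarrow> \<omega> \<in> Sigma_K K \<Longrightarrow>
        (transfer K q ^^ n) \<phi> \<omega> \<le> A0 * (transfer K g ^^ n) \<phi> \<omega>"
    by (rule normalization) blast
  interpret normalized K \<alpha> g b' by (rule g(1))
  interpret gibbs_normalized K \<alpha> \<mu> f "pressure K f" C g b' A0
    by unfold_locales (use g in auto)
  define \<rho> where "\<rho> = asymp_variance f \<mu>"
  obtain A t0 where A: "1 \<le> A" "0 < t0" "0 < \<rho>"
    "\<And>n t \<omega>. \<omega> \<in> Sigma_K K \<Longrightarrow> \<bar>t\<bar> \<le> t0 \<Longrightarrow> real n * \<bar>t\<bar> ^ 3 \<le> 1 \<Longrightarrow>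
      exp (n * \<rho> * t\<^sup>2 / 2) / A \<le> (G ^^ n) (\<lambda>\<omega>. exp (t * info (prefix_of n \<omega>))) \<omega>"
    "\<And>n t \<omega>. \<omega> \<in> Sigma_K K \<Longrightarrow> \<bar>t\<bar> \<le> t0 \<Longrightarrow> real n * \<bar>t\<bar> ^ 3 \<le> 1 \<Longrightarrow>
      (G ^^ n) (\<lambda>\<omega>. exp (t * info (prefix_of n \<omega>))) \<omega> \<le> A * exp (n * \<rho> * t\<^sup>2 / 2)"
    unfolding \<rho>_def by (rule limit_theory[OF assms(5)]) blast
  interpret gc: gibbs_clt K \<alpha> \<mu> f "pressure K f" C g b' A0 A t0 \<rho>
    by unfold_locales (use A K2 in auto)
  obtain R where R: "0 < R" "\<And>x y. x \<in> X \<Longrightarrow> y \<in> X \<Longrightarrow> norm (x - y) \<le> R" by (rule ifs.diameter) blast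
  have meas: "coding_map \<phi> \<in> borel_measurable \<mu>"
  proof (rule measurable_if_prefix_limit)
    fix \<omega> assume w: "\<omega> \<in> Sigma_K K"
    let ?\<eta> = "\<lambda>n. prepend (prefix_of n \<omega>) (\<lambda>_. 1)"
    have "(\<lambda>n. coding_map \<phi> (?\<eta> n) - coding_map \<phi> \<omega>) \<longlonglongrightarrow> 0"
    proof (rule Lim_null_comparison)
      have "norm (coding_map \<phi> (?\<eta> n) - coding_map \<phi> \<omega>) \<le> r ^ n * R" for n
      proof -
        have e: "?\<eta> n \<in> Sigma_K K" using prepend_Sigma_K[OF prefix_of_words[OF w] base_point] .
        show ?thesis
          unfolding ifs.coding_map_dist[OF e w agree_sym[OF agree_prepend_prefix_of]] using ifs.r
          by (intro mult_left_mono R(2) ifs.coding_map_in_X Sigma_K_shift_funpow e w) auto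
      qed
      then show "\<forall>\<^sub>F n in sequentially. norm (coding_map \<phi> (?\<eta> n) - coding_map \<phi> \<omega>) \<le> r ^ n * R" by simp
      show "(\<lambda>n. r ^ n * R) \<longlonglongrightarrow> 0" using ifs.r by (intro tendsto_mult_left_zero LIMSEQ_power_zero) auto
    qed
    then show "(\<lambda>n. coding_map \<phi> (?\<eta> n)) \<longlonglongrightarrow> coding_map \<phi> \<omega>" by (simp add: LIM_zero_iff)
  qed
  \<comment> \<open>Measurability of the coding map lets the pushforward be computed on the symbolic
    space, where almost sure statements about sequences decide the measure.\<close>
  have pull: "measure (distr \<mu> borel (coding_map \<phi>)) (recurrence_set K r \<phi> X \<psi>)
      = measure \<mu> (coding_map \<phi> -` recurrence_set K r \<phi> X \<psi> \<inter> space \<mu>)"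
    and ev: "coding_map \<phi> -` recurrence_set K r \<phi> X \<psi> \<inter> space \<mu> \<in> sets \<mu>" for \<psi>
    using measure_distr[OF meas ifs.recurrence_set_borel] measurable_sets[OF meas ifs.recurrence_set_borel] by auto
  obtain c1 where c1: "0 \<le> c1" "\<And>\<omega> n s. \<omega> \<in> Sigma_K K \<Longrightarrow> norm (coding_map \<phi> ((shift ^^ n) \<omega>) - coding_map \<phi> \<omega>) \<le> r powr s \<Longrightarrow>
    agree (nat \<lceil>s - c1\<rceil>) ((shift ^^ n) \<omega>) \<omega>" by (rule ifs.agreement_necessary) blast
  obtain c2 where c2: "\<And>\<omega> n s. \<omega> \<in> Sigma_K K \<Longrightarrow> agree (nat \<lceil>s + c2\<rceil>) ((shift ^^ n) \<omega>) \<omega> \<Longrightarrow>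
    norm (coding_map \<phi> ((shift ^^ n) \<omega>) - coding_map \<phi> \<omega>) \<le> r powr s" by (rule ifs.agreement_sufficient) blast
  have "AE \<omega> in \<mu>. \<omega> \<notin> coding_map \<phi> -` recurrence_set K r \<phi> X (psi_plus h \<rho> \<epsilon>) \<inter> space \<mu>"
    using gc.recurrence_upper[OF assms(7) c1(1)] AE_space
  proof eventually_elim
    case (elim \<omega>)
    then have w: "\<omega> \<in> Sigma_K K" by (simp add: space_mu)
    have "\<forall>\<^sub>F n in sequentially. \<not> norm (coding_map \<phi> ((shift ^^ n) \<omega>) - coding_map \<phi> \<omega>) \<le> r powr psi_plus h \<rho> \<epsilon> n"
      using elim(1) by eventually_elim (use c1(2)[OF w] in blast)
    then show ?case
      using ifs.coding_in_recurrence_set_iff[OF w] by (simp add: frequently_def cofinite_eq_sequentially)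
  qed
  moreover have "AE \<omega> in \<mu>. \<omega> \<in> coding_map \<phi> -` recurrence_set K r \<phi> X (psi_minus h \<rho> \<epsilon>) \<inter> space \<mu>"
    using gc.recurrence_lower[OF assms(7), of c2] AE_space
  proof eventually_elim
    case (elim \<omega>)
    then have w: "\<omega> \<in> Sigma_K K" by (simp add: space_mu)
    have "\<exists>\<^sub>\<infinity>n. norm (coding_map \<phi> ((shift ^^ n) \<omega>) - coding_map \<phi> \<omega>) \<le> r powr psi_minus h \<rho> \<epsilon> n"
      using elim(1) by (rule INFM_mono) (rule c2[OF w])
    then show ?case using ifs.coding_in_recurrence_set_iff[OF w] elim(2) by simp
  qed
  ultimately have "measure \<mu> (coding_map \<phi> -` recurrence_set K r \<phi> X (psi_plus h \<rho> \<epsilon>) \<inter> space \<mu>) = 0"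
    "measure \<mu> (coding_map \<phi> -` recurrence_set K r \<phi> X (psi_minus h \<rho> \<epsilon>) \<inter> space \<mu>) = 1"
    using prob_eq_0[OF ev] prob_eq_1[OF ev] by blast+
  then show ?thesis
    unfolding entropy_eq \<rho>_def[symmetric] pull using ifs.recurrence_set_borel by blast
qed

end
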